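(* Let $(u_\varepsilon)_{0<\varepsilon\le1}$ be the family of $C^1([0,T_0]\times\mathbb R^d)$ oscillating solutions described in the context, with parameter $\gamma>1$ and initial profile $U_0$. For all $1\le p<+\infty$, the family $(u_\varepsilon)_{0<\varepsilon\le1}$ is uniformly bounded in $$C^0([0,T_0],W^{s,p}_{loc}(\mathbb R^d,\mathbb R))\cap W^{s,p}_{loc}([0,T_0]\times\mathbb R^d,\mathbb R)\qquad\text{with } s=\frac1\gamma .$$ Furthermore, if $U_0$ is a non constant function, then for all $s>1/\gamma$ the family $(u_\varepsilon)_{0<\varepsilon<1}$ is unbounded in $C^0([0,T_0],W^{s,p}_{loc}(\mathbb R^d,\mathbb R))$ and unbounded in $W^{s,p}_{loc}([0,T_0]\times\mathbb R^d,\mathbb R)$.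
   Context: Oscillating solutions: let $d\ge1$, $\gamma>1$, $q$ the integer with $q-1<\gamma\le q$, $\mathbf F\in C^{q+3}(\mathbb R,\mathbb R^d)$, $\mathbf a=\mathbf F'$, $U_0\in C^1(\mathbb R/\mathbb Z,\mathbb R)$, $\underline u\in\mathbb R$, and $\mathbf v\in\mathbb R^d\setminus\{0\}$ with $\mathbf a^{(k)}(\underline u)\cdot\mathbf v=0$ for $k=1,\dots,q-1$. For $\varepsilon\in\,]0,1]$, $u_\varepsilon$ is the entropy solution of $\partial_tu_\varepsilon+\operatorname{div}_{\mathbf x}\mathbf F(u_\varepsilon)=0$, $u_\varepsilon(0,\mathbf x)=\underline u+\varepsilon U_0(\varepsilon^{-\gamma}\mathbf v\cdot\mathbf x)$. The time $T_0>0$ is such that for all $\varepsilon\in\,]0,1]$ the solution $u_\varepsilon$ is $C^1$ on $[0,T_0]\times\mathbb R^d$ and $u_\varepsilon(t,\mathbf x)=\underline u+\varepsilon U_\varepsilon(t,\varepsilon^{-\gamma}\phi(t,\mathbf x))$, where $\phi(t,\mathbf x)=\mathbf v\cdot(\mathbf x-t\mathbf a(\underline u))$, $U_\varepsilon\in C^1([0,T_0]\times\mathbb R/\mathbb Z,\mathbb R)$, and $\|U_\varepsilon-U\|_{C^1([0,T_0]\times\mathbb R/\mathbb Z)}=\mathcal O(\varepsilon^r)$ as $\varepsilon\to0$, with $r=1$ if $\gamma=q$ and $r=q-\gamma$ otherwise; here $U\in C^1([0,T_0]\times\mathbb R/\mathbb Z,\mathbb R)$ solves $\partial_tU+b\,\partial_\theta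 U^{q+1}=0$, $U(0,\theta)=U_0(\theta)$, with $b=\frac{1}{(q+1)!}\mathbf a^{(q)}(\underline u)\cdot\mathbf v$ if $\gamma=q$ and $b=0$ otherwise. Sobolev spaces: for an open set $Q\subset\mathbb R^n$, $0<s<1$ and $1\le p<\infty$, $\|V\|_{W^{s,p}(Q)}=\|V\|_{L^p(Q)}+|V|_{\dot W^{s,p}(Q)}$ with $|V|^p_{\dot W^{s,p}(Q)}=\int_Q\int_Q\frac{|V(\mathbf x)-V(\mathbf y)|^p}{|\mathbf x-\mathbf y|^{n+sp}}\,d\mathbf x\,d\mathbf y$; for $s\ge1$, $W^{s,p}$ is the usual Sobolev(–Slobodeckij) space. A family $(u_\varepsilon)$ is (uniformly) bounded in $W^{s,p}_{loc}(\mathbb R^d)$ if for every $\mathbf x_0\in\mathbb R^d$ there are $A>0$, $C\ge0$ with $\|u_\varepsilon\|_{W^{s,p}(\mathbf x_0+]-A,A[^d)}\le C$ for all $\varepsilon$; it is bounded in $C^0([0,T_0],W^{s,p}_{loc}(\mathbb R^d))$ if the same holds for $u_\varepsilon(t,\cdot)$ with $C$ independent also of $t\in[0,T_0]$; it is bounded in $W^{s,p}_{loc}([0,T_0]\times\mathbb R^d)$ if the analogous statement holds around every point of $[0,T_0]\times\mathbb R^d$ with cubes of $\mathbb R^{d+1}$ intersected with $]0,T_0[\times\mathbb R^d$. "Unbounded" means not bounded (a norm is $+\infty$ if the function is not in the space). *)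

theory Defs
  imports "HOL-Analysis.Analysis" "HOL-Library.Landau_Symbols"
begin

section \<open>Classical regularity\<close>

definition vderiv :: "nat \<Rightarrow> (real \<Rightarrow> 'b::real_normed_vector) \<Rightarrow> real \<Rightarrow> 'b" where
  "vderiv k f = ((\<lambda>g x. vector_derivative g (at x)) ^^ k) f"

definition Ck_real :: "nat \<Rightarrow> (real \<Rightarrow> 'b::real_normed_vector) \<Rightarrow> bool" where
  "Ck_real k f \<longleftrightarrow>
     (\<forall>j<k. vderiv j f differentiable_on UNIV) \<and> continuous_on UNIV (vderiv k f)"

text \<open>On sets such as \<open>[0,T] \<times> \<real>\<^sup>d\<close> the derivative is taken within the set, i.e. it is
  one-sided on the boundary, and it is continuous up to the boundary.\<close>

definition C1_on :: "'a::real_normed_vector set \<Rightarrow> ('a \<Rightarrow> 'b::real_normed_vector) \<Rightarrow> bool" where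
  "C1_on S f \<longleftrightarrow>
     (\<exists>f' :: 'a \<Rightarrow> 'a \<Rightarrow>\<^sub>L 'b. continuous_on S f' \<and>
        (\<forall>z\<in>S. (f has_derivative blinfun_apply (f' z)) (at z within S)))"

text \<open>Functions on \<open>[0,T] \<times> \<real>/\<int>\<close> are functions of \<open>(t,\<theta>)\<close>, 1-periodic in \<open>\<theta>\<close>.\<close>

definition C1_per :: "real \<Rightarrow> (real \<times> real \<Rightarrow> real) \<Rightarrow> bool" where
  "C1_per T W \<longleftrightarrow>
     C1_on ({0..T} \<times> UNIV) W \<and> (\<forall>t\<in>{0..T}. \<forall>\<theta>. W (t, \<theta> + 1) = W (t, \<theta>))"

text \<open>The suprema are those of bounded sets as soon as \<open>C1_per T W\<close> holds.\<close>

definition C1_norm :: "real \<Rightarrow> (real \<times> real \<Rightarrow> real) \<Rightarrow> real" where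
  "C1_norm T W =
     (SUP (t, \<theta>)\<in>{0..T} \<times> UNIV. \<bar>W (t, \<theta>)\<bar>) +
     (SUP (t, \<theta>)\<in>{0..T} \<times> UNIV. \<bar>vector_derivative (\<lambda>\<tau>. W (\<tau>, \<theta>)) (at t within {0..T})\<bar>) +
     (SUP (t, \<theta>)\<in>{0..T} \<times> UNIV. \<bar>deriv (\<lambda>\<eta>. W (t, \<eta>)) \<theta>\<bar>)"

section \<open>Test functions\<close>

definition partial :: "'a::euclidean_space \<Rightarrow> ('a \<Rightarrow> real) \<Rightarrow> 'a \<Rightarrow> real" where
  "partial b f = (\<lambda>x. frechet_derivative f (at x) b)"

definition partials :: "'a::euclidean_space list \<Rightarrow> ('a \<Rightarrow> real) \<Rightarrow> 'a \<Rightarrow> real" where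
  "partials bs f = foldr partial bs f"

definition smooth :: "('a::euclidean_space \<Rightarrow> real) \<Rightarrow> bool" where
  "smooth f \<longleftrightarrow> (\<forall>bs\<in>lists Basis. partials bs f differentiable_on UNIV)"

definition test_function :: "'a::euclidean_space set \<Rightarrow> ('a \<Rightarrow> real) \<Rightarrow> bool" where
  "test_function Q \<phi> \<longleftrightarrow>
     smooth \<phi> \<and> compact (closure {x. \<phi> x \<noteq> 0}) \<and> closure {x. \<phi> x \<noteq> 0} \<subseteq> Q"

section \<open>Entropy solutions\<close>

text \<open>Kruzhkov's entropy solutions of \<open>\<partial>\<^sub>t u + div F(u) = 0\<close>, \<open>u(0,\<cdot>) = u0\<close> on
  \<open>[0,\<infinity>[ \<times> \<real>\<^sup>d\<close>. The test functions are restrictions to \<open>t \<ge> 0\<close> of test functions on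
  \<open>\<real> \<times> \<real>\<^sup>d\<close>, so the initial datum is attained through the last integral. Note that
  \<open>partial (0, w) \<phi>\<close> is \<open>w \<bullet> \<nabla>\<^sub>x \<phi>\<close>.\<close>

definition entropy_solution ::
    "(real \<Rightarrow> real ^ 'n) \<Rightarrow> (real ^ 'n \<Rightarrow> real) \<Rightarrow> (real \<times> (real ^ 'n) \<Rightarrow> real) \<Rightarrow> bool" where
  "entropy_solution F u0 u \<longleftrightarrow>
     set_borel_measurable lebesgue ({0<..} \<times> UNIV) u \<and>
     (\<exists>M. AE z in lebesgue. z \<in> {0<..} \<times> UNIV \<longrightarrow> \<bar>u z\<bar> \<le> M) \<and>
     (\<forall>k \<phi>. test_function UNIV \<phi> \<and> (\<forall>z. 0 \<le> \<phi> z) \<longrightarrow>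
        0 \<le> (LINT z:{0<..} \<times> UNIV|lebesgue.
               \<bar>u z - k\<bar> * partial (1, 0) \<phi> z
               + sgn (u z - k) * partial (0, F (u z) - F k) \<phi> z)
            + (LINT x|lebesgue. \<bar>u0 x - k\<bar> * \<phi> (0, x)))"

section \<open>Sobolev--Slobodeckij norms\<close>

text \<open>All norms take values in \<open>[0,\<infinity>]\<close>; the value \<open>\<infinity>\<close> means that the function is not in the
  space.\<close>

definition ennreal_rpow :: "ennreal \<Rightarrow> real \<Rightarrow> ennreal" where
  "ennreal_rpow x r = (if x = \<infinity> then \<infinity> else ennreal (enn2real x powr r))"

definition Lp_norm :: "real \<Rightarrow> 'a::euclidean_space set \<Rightarrow> ('a \<Rightarrow> real) \<Rightarrow> ennreal" where
  "Lp_norm p Q V =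
     (if set_borel_measurable lebesgue Q V
      then ennreal_rpow (\<integral>\<^sup>+x\<in>Q. ennreal (\<bar>V x\<bar> powr p) \<partial>lebesgue) (1 / p)
      else \<infinity>)"

definition slobodeckij_seminorm ::
    "real \<Rightarrow> real \<Rightarrow> 'a::euclidean_space set \<Rightarrow> ('a \<Rightarrow> real) \<Rightarrow> ennreal" where
  "slobodeckij_seminorm s p Q V =
     ennreal_rpow
       (\<integral>\<^sup>+x\<in>Q. (\<integral>\<^sup>+y\<in>Q.
           ennreal (\<bar>V x - V y\<bar> powr p / norm (x - y) powr (real DIM('a) + s * p))
         \<partial>lebesgue) \<partial>lebesgue)
       (1 / p)"

definition locally_integrable :: "'a::euclidean_space set \<Rightarrow> ('a \<Rightarrow> real) \<Rightarrow> bool" where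
  "locally_integrable Q V \<longleftrightarrow> (\<forall>K. compact K \<and> K \<subseteq> Q \<longrightarrow> set_integrable lebesgue K V)"

definition weak_derivative ::
    "'a::euclidean_space set \<Rightarrow> 'a list \<Rightarrow> ('a \<Rightarrow> real) \<Rightarrow> ('a \<Rightarrow> real) \<Rightarrow> bool" where
  "weak_derivative Q bs V G \<longleftrightarrow>
     locally_integrable Q V \<and> locally_integrable Q G \<and>
     (\<forall>\<phi>. test_function Q \<phi> \<longrightarrow>
        (LINT x:Q|lebesgue. V x * partials bs \<phi> x)
          = (-1) ^ length bs * (LINT x:Q|lebesgue. G x * \<phi> x))"

text \<open>For \<open>s \<ge> 1\<close> write \<open>s = m + \<sigma>\<close> with \<open>m = \<lfloor>s\<rfloor>\<close>. A partial derivative of order \<open>k\<close> is indexed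
  by a list of \<open>k\<close> basis vectors rather than by a multi-index, which only repeats mixed
  derivatives in the sums and gives an equivalent norm. The infimum ranges over the families of
  all weak derivatives of order at most \<open>m\<close>, which are unique up to null sets; it is \<open>\<infinity>\<close> if there
  are none.\<close>

definition sobolev_norm ::
    "real \<Rightarrow> real \<Rightarrow> 'a::euclidean_space set \<Rightarrow> ('a \<Rightarrow> real) \<Rightarrow> ennreal" where
  "sobolev_norm s p Q V =
     (if s < 1 then Lp_norm p Q V + slobodeckij_seminorm s p Q V
      else
        let m = nat \<lfloor>s\<rfloor>; \<sigma> = frac s;
            I = {bs. set bs \<subseteq> Basis \<and> length bs \<le> m};
            J = {bs. set bs \<subseteq> Basis \<and> length bs = m}
        in INF G\<in>{G. \<forall>bs\<in>I. weak_derivative Q bs V (G bs)}.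
             (\<Sum>bs\<in>I. Lp_norm p Q (G bs)) +
             (if \<sigma> = 0 then 0 else \<Sum>bs\<in>J. slobodeckij_seminorm \<sigma> p Q (G bs)))"

text \<open>Every basis vector of \<open>real ^ 'n\<close> and of \<open>real \<times> (real ^ 'n)\<close> is a coordinate vector, so
  this is \<open>x\<^sub>0 + ]-A,A[\<^sup>n\<close>.\<close>

definition cube :: "'a::euclidean_space \<Rightarrow> real \<Rightarrow> 'a set" where
  "cube x0 A = box (x0 - A *\<^sub>R One) (x0 + A *\<^sub>R One)"

text \<open>Families \<open>u \<epsilon>\<close> of functions of \<open>(t,x)\<close>, with \<open>\<epsilon>\<close> ranging over \<open>E\<close>.\<close>

definition bounded_C0_Wloc ::
    "real set \<Rightarrow> real \<Rightarrow> real \<Rightarrow> real \<Rightarrow> (real \<Rightarrow> real \<times> (real ^ 'n) \<Rightarrow> real) \<Rightarrow> bool" where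
  "bounded_C0_Wloc E T s p u \<longleftrightarrow>
     (\<forall>x0. \<exists>A>0. \<exists>C\<ge>0. \<forall>\<epsilon>\<in>E. \<forall>t\<in>{0..T}.
        sobolev_norm s p (cube x0 A) (\<lambda>x. u \<epsilon> (t, x)) \<le> ennreal C)"

definition bounded_Wloc_spacetime ::
    "real set \<Rightarrow> real \<Rightarrow> real \<Rightarrow> real \<Rightarrow> (real \<Rightarrow> real \<times> (real ^ 'n) \<Rightarrow> real) \<Rightarrow> bool" where
  "bounded_Wloc_spacetime E T s p u \<longleftrightarrow>
     (\<forall>z0\<in>{0..T} \<times> UNIV. \<exists>A>0. \<exists>C\<ge>0. \<forall>\<epsilon>\<in>E.
        sobolev_norm s p (cube z0 A \<inter> {0<..<T} \<times> UNIV) (u \<epsilon>) \<le> ennreal C)"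

end

theory Submission
  imports Defs
begin

text \<open>
  Where \<open>u\<^sub>\<epsilon>\<close> is \<open>C\<^sup>1\<close>, the entropy inequalities force \<open>\<partial>\<^sub>t u + a(u) \<cdot> \<nabla>u = 0\<close>, so the profiles
  \<open>U\<^sub>\<epsilon>\<close> are constant along characteristics. Together with the convergence \<open>U\<^sub>\<epsilon> \<longlongrightarrow> U\<close> this bounds \<open>U\<^sub>\<epsilon>\<close>
  and its derivatives uniformly in \<open>\<epsilon> \<in> {0<..1}\<close>. Hence
  \<open>\<bar>u\<^sub>\<epsilon>(x) - u\<^sub>\<epsilon>(y)\<bar> \<le> M \<epsilon> min 1 (\<bar>x - y\<bar> / \<epsilon>\<^sup>\<gamma>)\<close>, and the Slobodeckij integral of the right-hand
  side scales like \<open>\<epsilon>\<^sup>p\<^sup>(\<^sup>1\<^sup>-\<^sup>\<gamma>\<^sup>s\<^sup>)\<close>, which is bounded for \<open>s = 1/\<gamma>\<close>.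

  Conversely, if \<open>U\<^sub>0\<close> is not constant, then near \<open>t = 0\<close> there are two families of stripes of width
  \<open>\<epsilon>\<^sup>\<gamma>\<close> and period \<open>\<epsilon>\<^sup>\<gamma>\<close> between which \<open>u\<^sub>\<epsilon>\<close> varies by \<open>\<epsilon>\<close>, and on the first of which its derivative
  has a fixed sign and size \<open>\<epsilon>\<^sup>1\<^sup>-\<^sup>\<gamma>\<close>. The stripes fill a fixed proportion of every box. This bounds the
  seminorm from below by \<open>\<epsilon>\<^sup>1\<^sup>-\<^sup>\<gamma>\<^sup>s\<close> if \<open>s < 1\<close>, and the first weak derivatives, tested with a
  periodic bump concentrated on the stripes, by \<open>\<epsilon>\<^sup>1\<^sup>-\<^sup>\<gamma>\<close> if \<open>s \<ge> 1\<close>.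
\<close>

section \<open>Smooth test functions\<close>

text \<open>The convergence of the profiles is asymptotic: it controls small
  \<open>\<epsilon>\<close> only, whereas the bounds are needed on all of ]0,1]. For the other
  \<open>\<epsilon>\<close> they come from the transport equation, since a \<open>C\<^sup>1\<close>
  solution on \<open>[0, T]\<close> cannot have crossing characteristics. That equation is not given
  pointwise; it has to be extracted from the entropy inequalities, hence from test functions. Test
  functions return in the lower bounds. For s \<ge> 1 the norm is an infimum over families of weak
  derivatives, which are known only through their pairings. A pairing with an oscillating derivative
  may cancel, so the test function must itself oscillate and live where the derivative has one sign.
  This is why stripes carry both a value gap, used for s < 1, and a signed slope, used for s \<ge>
  1, and why constants must not depend on the wave number \<open>L\<close>. Unboundedness is
  detected at or just after t = 0, because there every profile is still controlled by
  \<open>U0\<close> itself.\<close>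

definition flat :: "real poly \<Rightarrow> real \<Rightarrow> real" where
  "flat P x = (if x > 0 then poly P (1 / x) * exp (- (1 / x)) else 0)"

lemma poly_times_exp_minus_tendsto_0:
  fixes P :: "real poly"
  shows "((\<lambda>y. poly P y * exp (- y)) \<longlongrightarrow> 0) at_top"
proof -
  have "((\<lambda>y::real. coeff P i * y ^ i * exp (- y)) \<longlongrightarrow> 0) at_top" for i
    using tendsto_mult_right_zero[OF tendsto_power_div_exp_0[of i], of "coeff P i"]
    by (simp add: exp_minus field_simps)
  then have "((\<lambda>y::real. \<Sum>i\<le>degree P. coeff P i * y ^ i * exp (- y)) \<longlongrightarrow> (\<Sum>i\<le>degree P. 0)) at_top"
    by (intro tendsto_sum)
  then show ?thesis
    by (simp add: poly_altdef sum_distrib_right)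
qed

lemma flat_tendsto_0: "(flat P \<longlongrightarrow> 0) (at 0)"
proof -
  have "((\<lambda>x. poly P (inverse x) * exp (- inverse x)) \<longlongrightarrow> 0) (at_right 0)"
    by (rule filterlim_compose[OF poly_times_exp_minus_tendsto_0 filterlim_inverse_at_top_right])
  then have "(flat P \<longlongrightarrow> 0) (at_right 0)"
    by (rule Lim_transform_eventually)
       (auto simp: flat_def eventually_at_filter inverse_eq_divide intro: always_eventually)
  moreover have "(flat P \<longlongrightarrow> 0) (at_left 0)"
    by (rule Lim_transform_eventually[OF tendsto_const])
       (auto simp: flat_def eventually_at_filter intro: always_eventually)
  ultimately show ?thesis
    by (simp add: filterlim_at_split)
qed

text \<open>\<open>flat 1\<close> is the classical exp(-1/x), extended by 0. A polynomial in
  \<open>1/x\<close> is carried along so that the family is closed under differentiation: the chain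
  rule produces the factor \<open>1/x\<^sup>2\<close>, that is \<open>[:0, 0, 1:]\<close>, and turns
  \<open>P\<close> into \<open>P - pderiv P\<close>.\<close>

lemma flat_has_derivative:
  "(flat P has_real_derivative flat ((P - pderiv P) * [:0, 0, 1:]) x) (at x)"
proof -
  consider "x > 0" | "x < 0" | "x = 0" by linarith
  then show ?thesis
  proof cases
    case 1
    have "((\<lambda>x. poly P (1 / x) * exp (- (1 / x))) has_real_derivative
            flat ((P - pderiv P) * [:0, 0, 1:]) x) (at x)"
      using 1 by (auto intro!: derivative_eq_intros DERIV_chain2[OF poly_DERIV]
                       simp: flat_def field_simps power2_eq_square)
    then show ?thesis
      by (rule has_field_derivative_transform_within_open[where S = "{0<..}"])
         (use 1 in \<open>auto simp: flat_def\<close>)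
  next
    case 2
    have "((\<lambda>x. 0) has_real_derivative flat ((P - pderiv P) * [:0, 0, 1:]) x) (at x)"
      using 2 by (simp add: flat_def)
    then show ?thesis
      by (rule has_field_derivative_transform_within_open[where S = "{..<0}"])
         (use 2 in \<open>auto simp: flat_def\<close>)
  next
    case 3
    \<comment> \<open>The difference quotient of \<open>flat P\<close> at 0 is again of this form:
      division by x multiplies the polynomial by its variable.\<close>
    have "(flat (pCons 0 P) \<longlongrightarrow> 0) (at 0)"
      by (rule flat_tendsto_0)
    then have "((\<lambda>h. (flat P (0 + h) - flat P 0) / h) \<longlongrightarrow> 0) (at 0)"
      by (rule Lim_transform_eventually)
         (auto simp: flat_def eventually_at_filter intro: always_eventually)
    then show ?thesis
      using 3 by (simp add: DERIV_def) (simp add: flat_def)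
  qed
qed

text \<open>\<open>smooth\<close> speaks of all iterated partial derivatives. A syntactic class
  closed under differentiation settles them by one induction, and these generators suffice for the
  box bumps and the periodic cut-offs.\<close>

inductive smooth_fun :: "('a::euclidean_space \<Rightarrow> real) \<Rightarrow> bool" where
  const: "smooth_fun (\<lambda>x. c)"
| inner: "smooth_fun (\<lambda>x. x \<bullet> w)"
| add: "smooth_fun f \<Longrightarrow> smooth_fun g \<Longrightarrow> smooth_fun (\<lambda>x. f x + g x)"
| mult: "smooth_fun f \<Longrightarrow> smooth_fun g \<Longrightarrow> smooth_fun (\<lambda>x. f x * g x)"
| sin: "smooth_fun f \<Longrightarrow> smooth_fun (\<lambda>x. sin (f x))"
| cos: "smooth_fun f \<Longrightarrow> smooth_fun (\<lambda>x. cos (f x))"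
| flat: "smooth_fun f \<Longrightarrow> smooth_fun (\<lambda>x. flat P (f x))"

text \<open>An existential derivative lets each case use only the differentiation rules; uniqueness
  identifies it with \<open>frechet_derivative\<close> afterwards.\<close>

lemma smooth_fun_derivative:
  assumes "smooth_fun f"
  shows "\<exists>f'. (\<forall>x. (f has_derivative f' x) (at x)) \<and> (\<forall>b. smooth_fun (\<lambda>x. f' x b))"
  using assms
proof induction
  case (const c)
  show ?case
    by (rule exI[of _ "\<lambda>x h. 0"]) (auto intro: smooth_fun.const)
next
  case (inner w)
  show ?case
    by (rule exI[of _ "\<lambda>x h. h \<bullet> w"]) (auto intro: smooth_fun.const intro!: derivative_eq_intros)
next
  case (add f g)
  then obtain f' g' where
    "\<forall>x. (f has_derivative f' x) (at x)" "\<forall>b. smooth_fun (\<lambda>x. f' x b)"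
    "\<forall>x. (g has_derivative g' x) (at x)" "\<forall>b. smooth_fun (\<lambda>x. g' x b)" by blast
  then show ?case
    by (intro exI[of _ "\<lambda>x h. f' x h + g' x h"])
       (auto intro: smooth_fun.intros intro!: derivative_eq_intros)
next
  case (mult f g)
  then obtain f' g' where
    "\<forall>x. (f has_derivative f' x) (at x)" "\<forall>b. smooth_fun (\<lambda>x. f' x b)"
    "\<forall>x. (g has_derivative g' x) (at x)" "\<forall>b. smooth_fun (\<lambda>x. g' x b)" by blast
  then show ?case using mult.hyps
    by (intro exI[of _ "\<lambda>x h. f x * g' x h + f' x h * g x"])
       (auto intro!: smooth_fun.add smooth_fun.mult has_derivative_mult)
next
  case (sin f)
  then obtain f' where
    "\<forall>x. (f has_derivative f' x) (at x)" "\<forall>b. smooth_fun (\<lambda>x. f' x b)" by blast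
  then show ?case using sin.hyps
    by (intro exI[of _ "\<lambda>x h. f' x h * cos (f x)"])
       (auto intro: smooth_fun.intros intro!: has_derivative_sin)
next
  case (cos f)
  then obtain f' where
    "\<forall>x. (f has_derivative f' x) (at x)" "\<forall>b. smooth_fun (\<lambda>x. f' x b)" by blast
  then show ?case using cos.hyps
    by (intro exI[of _ "\<lambda>x h. f' x h * (sin (f x) * (-1))"] conjI allI
          smooth_fun.mult smooth_fun.sin smooth_fun.const)
       (auto intro!: derivative_eq_intros)
next
  case (flat f P)
  then obtain f' where
    "\<forall>x. (f has_derivative f' x) (at x)" "\<forall>b. smooth_fun (\<lambda>x. f' x b)" by blast
  then show ?case using flat.hyps
    by (intro exI[of _ "\<lambda>x h. f' x h * flat ((P - pderiv P) * [:0, 0, 1:]) (f x)"] conjI allI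
          smooth_fun.mult smooth_fun.flat DERIV_compose_FDERIV[OF flat_has_derivative]) blast+
qed

lemma smooth_fun_frechet_derivative:
  assumes "smooth_fun f"
  shows "(f has_derivative frechet_derivative f (at x)) (at x)"
    and "smooth_fun (\<lambda>x. frechet_derivative f (at x) b)"
proof -
  obtain f' where f': "\<forall>x. (f has_derivative f' x) (at x)" "\<forall>b. smooth_fun (\<lambda>x. f' x b)"
    using smooth_fun_derivative[OF assms] by blast
  then have "frechet_derivative f (at x) = f' x" for x
    by (metis frechet_derivative_at)
  with f' show "(f has_derivative frechet_derivative f (at x)) (at x)"
    and "smooth_fun (\<lambda>x. frechet_derivative f (at x) b)"
    by simp_all
qed

lemma continuous_on_smooth_fun: "smooth_fun f \<Longrightarrow> continuous_on S f"
  by (meson smooth_fun_frechet_derivative(1) has_derivative_continuous continuous_at_imp_continuous_on)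

lemma smooth_fun_imp_smooth:
  assumes "smooth_fun f"
  shows "smooth f"
proof -
  have "smooth_fun (partials bs f)" for bs
    by (induction bs)
       (use assms smooth_fun_frechet_derivative(2) in \<open>auto simp: partials_def partial_def\<close>)
  then show ?thesis
    unfolding smooth_def
    using smooth_fun_frechet_derivative(1) by (blast intro: differentiableI differentiable_at_imp_differentiable_on)
qed

lemma smooth_fun_prod:
  assumes "\<And>i. i \<in> I \<Longrightarrow> smooth_fun (f i)"
  shows "smooth_fun (\<lambda>x. \<Prod>i\<in>I. f i x)"
  using assms by (induction I rule: infinite_finite_induct) (auto intro: smooth_fun.intros)

lemma smooth_fun_cmult_add:
  assumes "smooth_fun f"
  shows "smooth_fun (\<lambda>x. c * f x + d)"
  using assms by (intro smooth_fun.intros)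

section \<open>Bumps supported in a box\<close>

definition box_bump :: "'a::euclidean_space \<Rightarrow> 'a \<Rightarrow> 'a \<Rightarrow> real" where
  "box_bump l u x = (\<Prod>b\<in>Basis. flat 1 (x \<bullet> b - l \<bullet> b) * flat 1 (u \<bullet> b - x \<bullet> b))"

lemma flat_1: "0 \<le> flat 1 x" "flat 1 x \<le> 1" "0 < flat 1 x \<longleftrightarrow> 0 < x" "flat 1 x = 0 \<longleftrightarrow> x \<le> 0"
  by (auto simp: flat_def)

lemma smooth_fun_box_bump: "smooth_fun (box_bump l u)"
proof -
  have "smooth_fun (\<lambda>x. x \<bullet> b - l \<bullet> b)" "smooth_fun (\<lambda>x. u \<bullet> b - x \<bullet> b)" for b
    using smooth_fun_cmult_add[OF smooth_fun.inner[of b], of 1 "- (l \<bullet> b)"]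
      smooth_fun_cmult_add[OF smooth_fun.inner[of b], of "-1" "u \<bullet> b"]
    by (simp_all add: algebra_simps)
  then have "smooth_fun (\<lambda>x. \<Prod>b\<in>Basis. flat 1 (x \<bullet> b - l \<bullet> b) * flat 1 (u \<bullet> b - x \<bullet> b))"
    by (intro smooth_fun_prod smooth_fun.intros)
  then show ?thesis
    by (simp add: box_bump_def[abs_def])
qed

lemma box_bump_bounds: "0 \<le> box_bump l u x" "box_bump l u x \<le> 1"
  unfolding box_bump_def
  by (auto intro!: prod_nonneg prod_le_1 mult_le_one simp: flat_1)

lemma box_bump_pos_iff: "0 < box_bump l u x \<longleftrightarrow> x \<in> box l u"
proof -
  have "box_bump l u x \<noteq> 0 \<longleftrightarrow> x \<in> box l u"
    by (auto simp: box_bump_def prod_zero_iff flat_1 mem_box not_le)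
  then show ?thesis
    using box_bump_bounds(1)[of l u x] by linarith
qed

lemma box_bump_eq_0: "x \<notin> box l u \<Longrightarrow> box_bump l u x = 0"
  using box_bump_pos_iff[of l u x] box_bump_bounds(1)[of l u x] by linarith

text \<open>The closure of the support need not be computed: it is contained in any closed box off
  which the function vanishes, and such a box is compact.\<close>

lemma test_function_smooth_fun:
  assumes "smooth_fun \<phi>" and "\<And>x. x \<notin> cbox l u \<Longrightarrow> \<phi> x = 0" and "cbox l u \<subseteq> Q"
  shows "test_function Q \<phi>"
proof -
  have "{x. \<phi> x \<noteq> 0} \<subseteq> cbox l u"
    using assms(2) by blast
  then have cl: "closure {x. \<phi> x \<noteq> 0} \<subseteq> cbox l u"
    by (simp add: closure_minimal closed_cbox)
  moreover have "compact (closure {x. \<phi> x \<noteq> 0})"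
    using cl by (meson bounded_cbox bounded_subset compact_closure closure_subset subset_trans)
  ultimately show ?thesis
    using assms smooth_fun_imp_smooth unfolding test_function_def by blast
qed

section \<open>Integration by parts\<close>

lemma has_derivative_zero_off_cbox:
  fixes f :: "'a::euclidean_space \<Rightarrow> real"
  assumes "(f has_derivative f') (at x)" and "\<And>x. x \<notin> cbox l u \<Longrightarrow> f x = 0" and "x \<notin> cbox l u"
  shows "f' = (\<lambda>h. 0)"
proof -
  have "((\<lambda>x. 0) has_derivative f') (at x)"
    by (rule has_derivative_transform_within_open[OF assms(1), of "- cbox l u"])
       (use assms in \<open>auto simp: closed_cbox\<close>)
  then show ?thesis
    by (metis has_derivative_const has_derivative_unique)
qed

lemma lborel_integral_translation:
  fixes f :: "'a::euclidean_space \<Rightarrow> real"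
  assumes "f \<in> borel_measurable borel"
  shows "integral\<^sup>L lborel (\<lambda>x. f (c + x)) = integral\<^sup>L lborel f"
proof -
  have "integral\<^sup>L (distr lborel borel ((+) c)) f = integral\<^sup>L lborel (\<lambda>x. f (c + x))"
    by (rule integral_distr) (use assms in auto)
  then show ?thesis
    by (simp add: lborel_distr_plus)
qed

lemma integrable_compactly_supported:
  fixes f :: "'a::euclidean_space \<Rightarrow> real"
  assumes "continuous_on (cbox l u) f" and "\<And>x. x \<notin> cbox l u \<Longrightarrow> f x = 0"
  shows "integrable lborel f"
proof -
  have "(\<lambda>x. indicator (cbox l u) x *\<^sub>R f x) = f"
    by (rule ext, rename_tac x, case_tac "x \<in> cbox l u") (simp_all add: assms(2))
  with borel_integrable_compact[OF compact_cbox assms(1)] show ?thesis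
    by simp
qed

text \<open>The integral of the difference quotients vanishes by translation invariance.\<close>

lemma integral_directional_derivative_eq_0:
  fixes f :: "'a::euclidean_space \<Rightarrow> real"
  assumes deriv: "\<And>x. (f has_derivative f' x) (at x)"
    and cont: "continuous_on UNIV (\<lambda>x. f' x b)"
    and supp: "\<And>x. x \<notin> cbox l u \<Longrightarrow> f x = 0"
  shows "integral\<^sup>L lborel (\<lambda>x. f' x b) = 0"
proof -
  have contf: "continuous_on S f" for S
    by (meson deriv has_derivative_continuous continuous_at_imp_continuous_on)
  have f'0: "f' x b = 0" if "x \<notin> cbox l u" for x
    using has_derivative_zero_off_cbox[OF deriv supp that] by simp
  have "bounded ((\<lambda>x. f' x b) ` cbox l u)"
    by (rule compact_imp_bounded[OF compact_continuous_image[OF continuous_on_subset[OF cont] compact_cbox]]) simp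
  then obtain M where M: "M > 0" "\<And>x. x \<in> cbox l u \<Longrightarrow> \<bar>f' x b\<bar> \<le> M"
    unfolding bounded_pos by (auto simp: image_iff)
  have M': "\<bar>f' x b\<bar> \<le> M" for x
    by (cases "x \<in> cbox l u") (use M f'0 in auto)
  \<comment> \<open>The mean value theorem along \<open>b\<close> bounds all difference quotients by
    \<open>M\<close>, as dominated convergence requires.\<close>
  have lip: "\<bar>f (h *\<^sub>R b + x) - f x\<bar> \<le> M * h" if "0 < h" for x h
  proof -
    have "((\<lambda>\<tau>. f (\<tau> *\<^sub>R b + x)) has_derivative (\<lambda>k. f' (\<tau> *\<^sub>R b + x) (k *\<^sub>R b))) (at \<tau> within {0..h})" for \<tau>
      by (rule has_derivative_compose[where g = f])
         (auto intro!: derivative_eq_intros deriv)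
    from mvt_simple[OF that this]
    obtain \<tau> where "f (h *\<^sub>R b + x) - f x = f' (\<tau> *\<^sub>R b + x) (h *\<^sub>R b)"
      by auto
    also have "\<dots> = h * f' (\<tau> *\<^sub>R b + x) b"
      using has_derivative_bounded_linear[OF deriv] by (simp add: linear_simps)
    finally show ?thesis
      using M'[of "\<tau> *\<^sub>R b + x"] that by (simp add: abs_mult mult.commute mult_left_mono)
  qed
  obtain R where R: "\<And>x. x \<in> cbox l u \<Longrightarrow> norm x \<le> R"
    using bounded_cbox[of l u] unfolding bounded_iff by blast
  \<comment> \<open>All steps used are at most 1, so enlarging the radius by \<open>norm b\<close>
    captures the supports of all difference quotients.\<close>
  define K where "K = cball (0::'a) (R + norm b)"
  define s where "s n x = (f ((1 / real (Suc n)) *\<^sub>R b + x) - f x) * real (Suc n)" for n x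
  have int: "integrable lborel (\<lambda>x. f (c + x))" for c
  proof (rule integrable_compactly_supported[where l = "l - c" and u = "u - c"])
    show "continuous_on (cbox (l - c) (u - c)) (\<lambda>x. f (c + x))"
      by (intro continuous_on_compose2[OF contf[of UNIV]] continuous_intros) auto
    show "f (c + x) = 0" if "x \<notin> cbox (l - c) (u - c)" for x
      by (rule supp) (use that in \<open>auto simp: mem_box algebra_simps\<close>)
  qed
  have "(\<lambda>n. integral\<^sup>L lborel (s n)) \<longlonglongrightarrow> integral\<^sup>L lborel (\<lambda>x. f' x b)"
  proof (rule integral_dominated_convergence[where w = "\<lambda>x. M * indicator K x"])
    show "(\<lambda>x. f' x b) \<in> borel_measurable lborel"
      using cont by (simp add: borel_measurable_continuous_onI)
    show "s n \<in> borel_measurable lborel" for n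
      unfolding s_def
      using borel_measurable_integrable[OF int[of "(1 / real (Suc n)) *\<^sub>R b"]]
        borel_measurable_integrable[OF int[of 0]]
      by (intro borel_measurable_times borel_measurable_diff) auto
    have "integrable lborel (\<lambda>x. indicator K x *\<^sub>R M)"
      by (rule borel_integrable_compact) (auto simp: K_def)
    then show "integrable lborel (\<lambda>x. M * indicator K x)"
      by (simp add: mult.commute)
    show "AE x in lborel. (\<lambda>n. s n x) \<longlonglongrightarrow> f' x b"
    proof (rule AE_I2)
      fix x
      have "((\<lambda>\<tau>. f (x + \<tau> *\<^sub>R b)) has_derivative (\<lambda>k. f' x (k *\<^sub>R b))) (at 0)"
        by (rule has_derivative_compose[where g = f and g' = "f' x"])
           (use deriv[of x] in \<open>auto intro!: derivative_eq_intros\<close>)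
      then have "((\<lambda>\<tau>. f (x + \<tau> *\<^sub>R b)) has_real_derivative f' x b) (at 0)"
        using has_derivative_bounded_linear[OF deriv[of x]]
        by (simp add: has_field_derivative_def linear_simps mult.commute[of _ "f' x b"])
      then have "((\<lambda>h. (f (x + h *\<^sub>R b) - f x) / h) \<longlongrightarrow> f' x b) (at 0)"
        by (simp add: DERIV_def)
      moreover have "filterlim (\<lambda>n. 1 / real (Suc n)) (at 0) sequentially"
        using LIMSEQ_inverse_real_of_nat
        by (simp add: filterlim_at inverse_eq_divide)
      ultimately have "(\<lambda>n. (f (x + (1 / real (Suc n)) *\<^sub>R b) - f x) / (1 / real (Suc n))) \<longlonglongrightarrow> f' x b"
        by (rule filterlim_compose)
      then show "(\<lambda>n. s n x) \<longlonglongrightarrow> f' x b"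
        by (simp add: s_def add.commute)
    qed
    show "AE x in lborel. norm (s n x) \<le> M * indicator K x" for n
    proof (rule AE_I2)
      fix x
      show "norm (s n x) \<le> M * indicator K x"
      proof (cases "x \<in> K")
        case True
        then show ?thesis
          using lip[of "1 / real (Suc n)" x]
          by (simp add: s_def abs_mult pos_le_divide_eq del: of_nat_Suc)
      next
        case False
        have nx: "norm x > R + norm b"
          using False by (simp add: K_def)
        then have "x \<notin> cbox l u"
          using R[of x] norm_ge_zero[of b] by linarith
        moreover have "norm x \<le> norm ((1 / real (Suc n)) *\<^sub>R b + x) + norm ((1 / real (Suc n)) *\<^sub>R b)"
          by (metis add_diff_cancel_left' norm_triangle_ineq4)
        then have "norm x \<le> norm ((1 / real (Suc n)) *\<^sub>R b + x) + norm b"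
          by (rule order_trans) (simp add: mult_left_le_one_le divide_le_eq field_simps)
        then have "(1 / real (Suc n)) *\<^sub>R b + x \<notin> cbox l u"
          using R[of "(1 / real (Suc n)) *\<^sub>R b + x"] nx by linarith
        ultimately show ?thesis
          using supp M by (simp add: s_def)
      qed
    qed
  qed
  moreover have "integral\<^sup>L lborel (s n) = 0" for n
    unfolding s_def
    using int int[of 0] contf[of UNIV]
    by (simp add: lborel_integral_translation borel_measurable_continuous_onI)
  ultimately show ?thesis
    by (simp add: LIMSEQ_const_iff)
qed

lemma partial_eq_0:
  assumes "smooth_fun \<phi>" and "\<And>x. x \<notin> cbox l u \<Longrightarrow> \<phi> x = 0" and "x \<notin> cbox l u"
  shows "partial b \<phi> x = 0"
  using has_derivative_zero_off_cbox[OF smooth_fun_frechet_derivative(1)[OF assms(1)] assms(2,3)]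
  by (simp add: partial_def)

lemma continuous_on_partial: "smooth_fun \<phi> \<Longrightarrow> continuous_on S (partial b \<phi>)"
  using smooth_fun_frechet_derivative(2) unfolding partial_def by (rule continuous_on_smooth_fun)

text \<open>\<open>g\<close> has to be differentiable only on a neighbourhood of the box. The
  product with \<open>\<phi>\<close> vanishes off the box, so it is differentiable on the whole
  space and its directional derivative integrates to 0.\<close>

lemma integration_by_parts:
  fixes g :: "'a::euclidean_space \<Rightarrow> real"
  assumes \<phi>: "smooth_fun \<phi>" "\<And>x. x \<notin> cbox l u \<Longrightarrow> \<phi> x = 0"
    and \<Omega>: "open \<Omega>" "cbox l u \<subseteq> \<Omega>"
    and g: "\<And>x. x \<in> \<Omega> \<Longrightarrow> (g has_derivative g' x) (at x)" "continuous_on \<Omega> (\<lambda>x. g' x b)"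
  shows "integrable lborel (\<lambda>x. g x * partial b \<phi> x)"
    and "integrable lborel (\<lambda>x. \<phi> x * g' x b)"
    and "integral\<^sup>L lborel (\<lambda>x. g x * partial b \<phi> x) = - integral\<^sup>L lborel (\<lambda>x. \<phi> x * g' x b)"
proof -
  have contg: "continuous_on \<Omega> g"
    using g(1) by (meson has_derivative_continuous continuous_at_imp_continuous_on)
  have p0: "partial b \<phi> x = 0" if "x \<notin> cbox l u" for x
    by (rule partial_eq_0[of \<phi> l u]) (use \<phi> that in auto)
  show i1: "integrable lborel (\<lambda>x. g x * partial b \<phi> x)"
    by (rule integrable_compactly_supported[of l u])
       (use p0 \<Omega> in \<open>auto intro!: continuous_on_mult continuous_on_subset[OF contg] continuous_on_partial[OF \<phi>(1)]\<close>)
  show i2: "integrable lborel (\<lambda>x. \<phi> x * g' x b)"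
    by (rule integrable_compactly_supported[of l u])
       (use \<phi> \<Omega> in \<open>auto intro!: continuous_on_mult continuous_on_smooth_fun[OF \<phi>(1)] continuous_on_subset[OF g(2)]\<close>)
  define f where "f x = \<phi> x * g x" for x
  define f' where "f' x h = \<phi> x * g' x h + frechet_derivative \<phi> (at x) h * g x" for x h
  \<comment> \<open>Off \<open>\<Omega>\<close> the formula \<open>f'\<close> is meaningless, but
    the product is locally 0 there.\<close>
  define f1 where "f1 x = (if x \<in> \<Omega> then f' x else (\<lambda>h. 0))" for x
  have supp: "f x = 0" if "x \<notin> cbox l u" for x
    using \<phi>(2)[OF that] by (simp add: f_def)
  have "(f has_derivative f1 x) (at x)" for x
  proof (cases "x \<in> \<Omega>")
    case True
    then show ?thesis
      unfolding f_def f1_def f'_def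
      using has_derivative_mult[OF smooth_fun_frechet_derivative(1)[OF \<phi>(1)] g(1)[OF True]] by simp
  next
    case False
    have "((\<lambda>x. 0) has_derivative f1 x) (at x)"
      using False by (simp add: f1_def)
    then show ?thesis
      by (rule has_derivative_transform_within_open[of _ _ _ _ "- cbox l u"])
         (use \<Omega> False supp in \<open>auto simp: closed_cbox\<close>)
  qed
  moreover have f1b: "f1 x b = g x * partial b \<phi> x + \<phi> x * g' x b" for x
    using \<Omega>(2) \<phi>(2)[of x] p0[of x]
    by (cases "x \<in> cbox l u") (auto simp: f1_def f'_def partial_def)
  \<comment> \<open>The two open sets cover the space because the box lies in
    \<open>\<Omega>\<close>.\<close>
  have "continuous_on (\<Omega> \<union> - cbox l u) (\<lambda>x. f1 x b)"
  proof (rule continuous_on_open_Un)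
    show "continuous_on \<Omega> (\<lambda>x. f1 x b)"
      unfolding f1b
      by (intro continuous_intros contg g(2) continuous_on_partial continuous_on_smooth_fun \<phi>)
    have "continuous_on (- cbox l u) (\<lambda>x. 0 :: real)" by simp
    then show "continuous_on (- cbox l u) (\<lambda>x. f1 x b)"
      by (rule continuous_on_eq) (use \<phi>(2) p0 in \<open>auto simp: f1b\<close>)
  qed (use \<Omega> in \<open>auto simp: closed_cbox\<close>)
  then have "continuous_on UNIV (\<lambda>x. f1 x b)"
    by (rule continuous_on_subset) (use \<Omega>(2) in auto)
  ultimately have "integral\<^sup>L lborel (\<lambda>x. f1 x b) = 0"
    using supp by (rule integral_directional_derivative_eq_0)
  then show "integral\<^sup>L lborel (\<lambda>x. g x * partial b \<phi> x) = - integral\<^sup>L lborel (\<lambda>x. \<phi> x * g' x b)"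
    unfolding f1b using i1 i2 by (simp add: Bochner_Integration.integral_add)
qed

section \<open>Entropy solutions that are classical\<close>

text \<open>Test functions supported where \<open>u\<close> is \<open>C\<^sup>1\<close> and the constants \<open>k = \<plusminus>K\<close> with \<open>K\<close> larger
  than \<open>\<bar>u\<bar>\<close> on the support turn the entropy inequality into two opposite inequalities.\<close>

lemma entropy_solution_weak_residual:
  fixes F a :: "real \<Rightarrow> real ^ 'n" and u :: "real \<times> (real ^ 'n) \<Rightarrow> real"
    and u' :: "real \<times> (real ^ 'n) \<Rightarrow> (real \<times> (real ^ 'n)) \<Rightarrow>\<^sub>L real"
  assumes ent: "entropy_solution F u0 u"
    and F: "\<And>y. (F has_vector_derivative a y) (at y)" "continuous_on UNIV a"
    and \<Omega>: "open \<Omega>" "\<Omega> \<subseteq> {0<..} \<times> UNIV"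
    and u': "\<And>z. z \<in> \<Omega> \<Longrightarrow> (u has_derivative u' z) (at z)" "continuous_on \<Omega> u'"
    and \<phi>: "smooth_fun \<phi>" "\<And>z. 0 \<le> \<phi> z" "\<And>z. z \<notin> cbox l r \<Longrightarrow> \<phi> z = 0" "cbox l r \<subseteq> \<Omega>"
  shows "integrable lborel (\<lambda>z. \<phi> z * u' z (1, a (u z)))"
    and "integral\<^sup>L lborel (\<lambda>z. \<phi> z * u' z (1, a (u z))) = 0"
proof -
  define D where "D z = frechet_derivative \<phi> (at z)" for z
  have D: "bounded_linear (D z)" for z
    using has_derivative_bounded_linear[OF smooth_fun_frechet_derivative(1)[OF \<phi>(1)]]
    by (simp add: D_def)
  have D0: "D z = (\<lambda>h. 0)" if "z \<notin> cbox l r" for z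
    unfolding D_def
    by (rule has_derivative_zero_off_cbox[OF smooth_fun_frechet_derivative(1)[OF \<phi>(1)] _ that])
       (rule \<phi>(3))
  have contu: "continuous_on \<Omega> u"
    using u'(1) by (meson has_derivative_continuous continuous_at_imp_continuous_on)
  have conta: "continuous_on \<Omega> (\<lambda>z. a (u z))"
    by (rule continuous_on_compose2[OF F(2) contu]) simp
  \<comment> \<open>Components of the space-time flux relative to the constant \<open>k\<close>.
    Summing the integrations by parts over \<open>b\<close> turns its divergence into the residual
    \<open>u' (1, a u)\<close>.\<close>
  define g where "g k b z = (u z - k, F (u z) - F k) \<bullet> b"
    for k and b z :: "real \<times> (real ^ 'n)"
  define g' where "g' b z h = u' z h * ((1, a (u z)) \<bullet> b)"
    for b z h :: "real \<times> (real ^ 'n)"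
  have g: "(g k b has_derivative g' b z) (at z)" if "z \<in> \<Omega>" for k b z
  proof -
    have "((\<lambda>z. F (u z)) has_derivative (\<lambda>h. u' z h *\<^sub>R a (u z))) (at z)"
      using has_derivative_compose[OF u'(1)[OF that] F(1)[of "u z", unfolded has_vector_derivative_def]]
      by simp
    then have "((\<lambda>z. (u z - k, F (u z) - F k)) has_derivative (\<lambda>h. (u' z h - 0, u' z h *\<^sub>R a (u z) - 0))) (at z)"
      by (intro has_derivative_Pair has_derivative_diff u'(1)[OF that] has_derivative_const)
    then have "((\<lambda>z. (u z - k, F (u z) - F k) \<bullet> b) has_derivative
         (\<lambda>h. (u' z h - 0, u' z h *\<^sub>R a (u z) - 0) \<bullet> b)) (at z)"
      by (rule has_derivative_inner_left)
    then show ?thesis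
      by (simp add: g_def[abs_def] g'_def[abs_def] inner_prod_def algebra_simps)
  qed
  have contg': "continuous_on \<Omega> (\<lambda>z. g' b z h)" for b h
    unfolding g'_def by (intro continuous_intros u'(2) conta)
  note ibp = integration_by_parts[OF \<phi>(1) \<phi>(3) \<Omega>(1) \<phi>(4) g contg', simplified]
  have sum1: "(\<Sum>b\<in>Basis. g k b z * partial b \<phi> z) = D z (u z - k, F (u z) - F k)" for k z
  proof -
    have "D z (u z - k, F (u z) - F k) = D z (\<Sum>b\<in>Basis. g k b z *\<^sub>R b)"
      unfolding g_def by (subst euclidean_representation) simp
    also have "\<dots> = (\<Sum>b\<in>Basis. g k b z * D z b)"
      using D[of z] by (simp add: linear_simps bounded_linear.linear linear_sum)
    finally show ?thesis
      by (simp add: partial_def D_def)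
  qed
  have sum2: "(\<Sum>b\<in>Basis. \<phi> z * g' b z b) = \<phi> z * u' z (1, a (u z))" for z
  proof -
    have "u' z (1, a (u z)) = u' z (\<Sum>b\<in>Basis. ((1, a (u z)) \<bullet> b) *\<^sub>R b)"
      by (subst euclidean_representation) simp
    also have "\<dots> = (\<Sum>b\<in>Basis. g' b z b)"
      by (simp add: g'_def blinfun.sum_right blinfun.scaleR_right mult.commute del: inner_Pair)
    finally show ?thesis
      by (simp add: sum_distrib_left)
  qed
  have "integrable lborel (\<lambda>z. \<Sum>b\<in>Basis. \<phi> z * g' b z b)"
    by (intro Bochner_Integration.integrable_sum ibp(2))
  then show int: "integrable lborel (\<lambda>z. \<phi> z * u' z (1, a (u z)))"
    unfolding sum2 .
  define I where "I = integral\<^sup>L lborel (\<lambda>z. \<phi> z * u' z (1, a (u z)))"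
  have int1: "integrable lborel (\<lambda>z. D z (u z - k, F (u z) - F k))" for k
    unfolding sum1[symmetric] by (intro Bochner_Integration.integrable_sum ibp(1))
  have I1: "integral\<^sup>L lborel (\<lambda>z. D z (u z - k, F (u z) - F k)) = - I" for k
  proof -
    have "integral\<^sup>L lborel (\<lambda>z. D z (u z - k, F (u z) - F k))
        = (\<Sum>b\<in>Basis. integral\<^sup>L lborel (\<lambda>z. g k b z * partial b \<phi> z))"
      unfolding sum1[symmetric] by (intro Bochner_Integration.integral_sum ibp(1))
    also have "\<dots> = - (\<Sum>b\<in>Basis. integral\<^sup>L lborel (\<lambda>z. \<phi> z * g' b z b))"
      by (simp add: ibp(3) sum_negf)
    also have "(\<Sum>b\<in>Basis. integral\<^sup>L lborel (\<lambda>z. \<phi> z * g' b z b)) = I"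
      unfolding I_def sum2[symmetric]
      by (rule Bochner_Integration.integral_sum[symmetric]) (rule ibp(2))
    finally show ?thesis .
  qed
  have tf: "test_function UNIV \<phi>"
    by (rule test_function_smooth_fun[OF \<phi>(1,3)]) auto
  \<comment> \<open>If \<open>sgn (u - k)\<close> is constant on the support, the entropy integrand
    is that sign times an expression linear in the flux, whose integral is \<open>- I\<close>
    whatever \<open>k\<close> is.\<close>
  have ineq: "0 \<le> - \<sigma> * I" if \<sigma>: "\<And>z. z \<in> cbox l r \<Longrightarrow> sgn (u z - k) = \<sigma>" for k \<sigma>
  proof -
    have "(LINT z:{0<..} \<times> UNIV|lebesgue. \<bar>u z - k\<bar> * partial (1, 0) \<phi> z
             + sgn (u z - k) * partial (0, F (u z) - F k) \<phi> z)
        = (LINT z|lebesgue. \<sigma> * D z (u z - k, F (u z) - F k))"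
      unfolding set_lebesgue_integral_def
    proof (rule Bochner_Integration.integral_cong[OF refl])
      fix z
      show "indicator ({0<..} \<times> UNIV) z *\<^sub>R (\<bar>u z - k\<bar> * partial (1, 0) \<phi> z
             + sgn (u z - k) * partial (0, F (u z) - F k) \<phi> z)
           = \<sigma> * D z (u z - k, F (u z) - F k)"
      proof (cases "z \<in> cbox l r")
        case True
        then have a0: "z \<in> {0<..} \<times> UNIV" using \<phi>(4) \<Omega>(2) by blast
        have a1: "D z (u z - k, F (u z) - F k) = (u z - k) * D z (1, 0) + D z (0, F (u z) - F k)"
        proof -
          have "(u z - k, F (u z) - F k) = (u z - k) *\<^sub>R (1, 0) + (0, F (u z) - F k)"
            by simp
          then show ?thesis
            using D[of z] by (simp only: linear_simps bounded_linear.linear real_scaleR_def)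
        qed
        have a2: "\<bar>u z - k\<bar> = \<sigma> * (u z - k)"
          using \<sigma>[OF True] by (simp add: abs_sgn mult.commute)
        show ?thesis
          unfolding partial_def D_def[symmetric] a1 a2 \<sigma>[OF True]
          using a0 by (simp add: algebra_simps)
      next
        case False
        then have "partial (1, 0) \<phi> z = 0" "partial (0, F (u z) - F k) \<phi> z = 0"
          using D0 unfolding D_def partial_def by metis+
        then show ?thesis
          using D0[OF False] by simp
      qed
    qed
    also have "\<dots> = \<sigma> * (LINT z|lborel. D z (u z - k, F (u z) - F k))"
      using int1[of k] by (simp add: integral_completion)
    also have "\<dots> = - \<sigma> * I"
      by (simp add: I1)
    finally have "(LINT z:{0<..} \<times> UNIV|lebesgue. \<bar>u z - k\<bar> * partial (1, 0) \<phi> z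
             + sgn (u z - k) * partial (0, F (u z) - F k) \<phi> z) = - \<sigma> * I" .
    \<comment> \<open>The support lies in t > 0, so the initial term drops out.\<close>
    moreover have "\<phi> (0, x) = 0" for x
      by (rule \<phi>(3)) (use \<phi>(4) \<Omega>(2) in auto)
    moreover have "0 \<le> (LINT z:{0<..} \<times> UNIV|lebesgue. \<bar>u z - k\<bar> * partial (1, 0) \<phi> z
             + sgn (u z - k) * partial (0, F (u z) - F k) \<phi> z)
           + (LINT x|lebesgue. \<bar>u0 x - k\<bar> * \<phi> (0, x))"
      using ent tf \<phi>(2) unfolding entropy_solution_def by blast
    ultimately show ?thesis
      by simp
  qed
  have "bounded (u ` cbox l r)"
    using \<phi>(4) contu continuous_on_subset
    by (intro compact_imp_bounded compact_continuous_image compact_cbox) blast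
  then obtain K where K: "\<And>z. z \<in> cbox l r \<Longrightarrow> \<bar>u z\<bar> \<le> K"
    unfolding bounded_iff by (auto simp: image_iff)
  have "sgn (u z - (K + 1)) = - 1" "sgn (u z - (- K - 1)) = 1" if "z \<in> cbox l r" for z
    using K[OF that] by (auto simp: sgn_if)
  then have "0 \<le> - (-1) * I" "0 \<le> - 1 * I"
    using ineq by blast+
  then show "integral\<^sup>L lborel (\<lambda>z. \<phi> z * u' z (1, a (u z))) = 0"
    by (simp add: I_def)
qed

text \<open>The residual is continuous, so a nonzero value keeps its sign on a box around the point.
  Weighted with a bump positive on that box, its integral would be nonzero.\<close>

lemma entropy_solution_classical:
  fixes F a :: "real \<Rightarrow> real ^ 'n" and u :: "real \<times> (real ^ 'n) \<Rightarrow> real"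
    and u' :: "real \<times> (real ^ 'n) \<Rightarrow> (real \<times> (real ^ 'n)) \<Rightarrow>\<^sub>L real"
  assumes ent: "entropy_solution F u0 u"
    and F: "\<And>y. (F has_vector_derivative a y) (at y)" "continuous_on UNIV a"
    and \<Omega>: "open \<Omega>" "\<Omega> \<subseteq> {0<..} \<times> UNIV"
    and u': "\<And>z. z \<in> \<Omega> \<Longrightarrow> (u has_derivative u' z) (at z)" "continuous_on \<Omega> u'"
    and z0: "z0 \<in> \<Omega>"
  shows "u' z0 (1, a (u z0)) = 0"
proof (rule ccontr)
  define R where "R z = u' z (1, a (u z))" for z
  define \<sigma> where "\<sigma> = sgn (R z0)"
  assume "u' z0 (1, a (u z0)) \<noteq> 0"
  then have pos: "0 < \<sigma> * R z0"
    by (simp add: \<sigma>_def R_def sgn_mult_self_eq abs_sgn[symmetric] mult.commute)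
  have contu: "continuous_on \<Omega> u"
    using u'(1) by (meson has_derivative_continuous continuous_at_imp_continuous_on)
  have "continuous_on \<Omega> (\<lambda>z. a (u z))"
    by (rule continuous_on_compose2[OF F(2) contu]) simp
  then have contR: "continuous_on \<Omega> (\<lambda>z. \<sigma> * R z)"
    unfolding R_def by (intro continuous_intros u'(2))
  have "open (\<Omega> \<inter> (\<lambda>z. \<sigma> * R z) -` {0<..})"
    by (intro continuous_open_preimage contR \<Omega>) auto
  then obtain l r where lr: "cbox l r \<subseteq> \<Omega> \<inter> (\<lambda>z. \<sigma> * R z) -` {0<..}" "z0 \<in> box l r"
    using open_contains_cbox z0 pos by (metis IntI greaterThan_iff vimageI)
  define f where "f z = box_bump l r z * (\<sigma> * R z)" for z
  have zero: "box_bump l r z = 0" if "z \<notin> cbox l r" for z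
    using that box_subset_cbox box_bump_eq_0 by blast
  have "integrable lborel (\<lambda>z. box_bump l r z * R z)" "integral\<^sup>L lborel (\<lambda>z. box_bump l r z * R z) = 0"
    unfolding R_def
    using entropy_solution_weak_residual[OF ent F \<Omega> u' smooth_fun_box_bump box_bump_bounds(1) zero] lr(1)
    by auto
  then have int: "integrable lborel f" and I: "integral\<^sup>L lborel f = 0"
    unfolding f_def by (simp_all add: mult.left_commute[of _ \<sigma>])
  have nonneg: "0 \<le> f z" for z
  proof (cases "z \<in> cbox l r")
    case True
    then have "0 < \<sigma> * R z" using lr(1) by auto
    then show ?thesis by (simp add: f_def box_bump_bounds)
  qed (simp add: f_def zero)
  then have "AE z in lborel. f z = 0"
    using integral_nonneg_eq_0_iff_AE[OF int] I by simp
  moreover have "f z \<noteq> 0" if "z \<in> box l r" for z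
  proof -
    have "0 < \<sigma> * R z" using lr(1) that box_subset_cbox by blast
    then show ?thesis
      using that box_bump_pos_iff[of l r z] by (auto simp: f_def)
  qed
  ultimately have "AE z in lborel. z \<notin> box l r"
    by (auto elim: eventually_mono)
  then have "emeasure lborel (box l r) = 0"
    using AE_iff_measurable[of "box l r" lborel "\<lambda>z. z \<notin> box l r"] by simp
  moreover have "0 < (r - l) \<bullet> b" if "b \<in> Basis" for b
    using lr(2) that unfolding mem_box inner_diff_left by force
  then have "emeasure lborel (box l r) > 0"
    by (auto simp: emeasure_lborel_box_eq inner_diff_left intro!: prod_pos less_imp_le)
  ultimately show False by simp
qed

section \<open>Periodic profiles\<close>

lemma periodic_int:
  fixes g :: "real \<Rightarrow> 'b"
  assumes "\<And>\<theta>. g (\<theta> + 1) = g \<theta>"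
  shows "g (\<theta> + of_int k) = g \<theta>"
proof (induction k rule: int_induct[of _ 0])
  case (step1 i)
  then show ?case
    using assms[of "\<theta> + of_int i"] by (simp add: add.assoc)
next
  case (step2 i)
  then show ?case
    using assms[of "\<theta> + of_int (i - 1)"] by (simp add: add.assoc)
qed simp

lemma periodic_bounded:
  fixes f :: "real \<times> real \<Rightarrow> real"
  assumes "continuous_on ({0..T} \<times> UNIV) f"
    and "\<And>t \<theta>. t \<in> {0..T} \<Longrightarrow> f (t, \<theta> + 1) = f (t, \<theta>)"
  obtains M where "\<And>t \<theta>. t \<in> {0..T} \<Longrightarrow> \<bar>f (t, \<theta>)\<bar> \<le> M"
proof -
  have "bounded (f ` ({0..T} \<times> {0..1}))"
    by (intro compact_imp_bounded compact_continuous_image continuous_on_subset[OF assms(1)] compact_Times) auto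
  then obtain M where M: "\<And>z. z \<in> {0..T} \<times> {0..1} \<Longrightarrow> \<bar>f z\<bar> \<le> M"
    unfolding bounded_iff by (auto simp: image_iff)
  have "\<bar>f (t, \<theta>)\<bar> \<le> M" if "t \<in> {0..T}" for t \<theta>
  proof -
    have "f (t, \<theta>) = f (t, frac \<theta>)"
      using periodic_int[of "\<lambda>\<theta>. f (t, \<theta>)" "frac \<theta>" "\<lfloor>\<theta>\<rfloor>"] assms(2)[OF that] by (simp add: frac_def)
    then show ?thesis
      using M[of "(t, frac \<theta>)"] that frac_lt_1[of \<theta>] by (auto simp: less_imp_le)
  qed
  then show ?thesis using that by blast
qed

text \<open>One-sided at t = 0 and t = T: this is the quantity whose supremum enters
  \<open>C1_norm\<close>.\<close>

definition deriv_t :: "real \<Rightarrow> (real \<times> real \<Rightarrow> real) \<Rightarrow> real \<times> real \<Rightarrow> real" where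
  "deriv_t T W z = vector_derivative (\<lambda>\<tau>. W (\<tau>, snd z)) (at (fst z) within {0..T})"

definition deriv_x :: "(real \<times> real \<Rightarrow> real) \<Rightarrow> real \<times> real \<Rightarrow> real" where
  "deriv_x W z = deriv (\<lambda>\<eta>. W (fst z, \<eta>)) (snd z)"

context
  fixes T :: real and W :: "real \<times> real \<Rightarrow> real"
  assumes T: "0 < T" and W: "C1_per T W"
begin

lemma C1_per_periodic: "t \<in> {0..T} \<Longrightarrow> W (t, \<theta> + of_int k) = W (t, \<theta>)"
  using W periodic_int[of "\<lambda>\<theta>. W (t, \<theta>)"] unfolding C1_per_def by blast

text \<open>The derivative provided by \<open>C1_on\<close> is linear, hence fixed by its values at
  \<open>(1, 0)\<close> and \<open>(0, 1)\<close>. These are the two partial derivatives, so they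
  inherit its continuity.\<close>

lemma C1_per_derivatives:
  assumes z: "z \<in> {0..T} \<times> UNIV"
  shows "(W has_derivative (\<lambda>h. fst h * deriv_t T W z + snd h * deriv_x W z)) (at z within {0..T} \<times> UNIV)"
    and "((\<lambda>\<tau>. W (\<tau>, snd z)) has_real_derivative deriv_t T W z) (at (fst z) within {0..T})"
    and "((\<lambda>\<eta>. W (fst z, \<eta>)) has_real_derivative deriv_x W z) (at (snd z))"
    and "continuous_on ({0..T} \<times> UNIV) (deriv_t T W)"
    and "continuous_on ({0..T} \<times> UNIV) (deriv_x W)"
proof -
  obtain f' :: "real \<times> real \<Rightarrow> (real \<times> real) \<Rightarrow>\<^sub>L real"
    where cont: "continuous_on ({0..T} \<times> UNIV) f'"
      and f': "\<And>z. z \<in> {0..T} \<times> UNIV \<Longrightarrow> (W has_derivative f' z) (at z within {0..T} \<times> UNIV)"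
    using W unfolding C1_per_def C1_on_def by blast
  have 1: "((\<lambda>\<tau>. W (\<tau>, \<theta>)) has_real_derivative f' (t, \<theta>) (1, 0)) (at t within {0..T})"
    if "t \<in> {0..T}" for t \<theta>
  proof -
    have "((\<lambda>\<tau>. W (\<tau>, \<theta>)) has_derivative (\<lambda>h. f' (t, \<theta>) (h, 0))) (at t within {0..T})"
    proof (rule has_derivative_in_compose2[OF f', where f = "\<lambda>\<tau>. (\<tau>, \<theta>)"])
      show "((\<lambda>\<tau>. (\<tau>, \<theta>)) has_derivative (\<lambda>h. (h, 0))) (at t within {0..T})"
        by (intro has_derivative_Pair derivative_intros)
      show "(\<lambda>\<tau>. (\<tau>, \<theta>)) ` {0..T} \<subseteq> {0..T} \<times> UNIV" by auto
    qed (use that in simp_all)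
    moreover have "(\<lambda>h. f' (t, \<theta>) (h, 0)) = (*) (f' (t, \<theta>) (1, 0))"
    proof (rule ext)
      show "f' (t, \<theta>) (h, 0) = f' (t, \<theta>) (1, 0) * h" for h
        using blinfun.scaleR_right[of "f' (t, \<theta>)" h "(1, 0)"] by simp
    qed
    ultimately show ?thesis
      by (simp only: has_field_derivative_def)
  qed
  have 2: "((\<lambda>\<eta>. W (t, \<eta>)) has_real_derivative f' (t, \<theta>) (0, 1)) (at \<theta>)"
    if "t \<in> {0..T}" for t \<theta>
  proof -
    have "((\<lambda>\<eta>. W (t, \<eta>)) has_derivative (\<lambda>h. f' (t, \<theta>) (0, h))) (at \<theta> within UNIV)"
    proof (rule has_derivative_in_compose2[OF f', where f = "\<lambda>\<eta>. (t, \<eta>)"])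
      show "((\<lambda>\<eta>. (t, \<eta>)) has_derivative (\<lambda>h. (0, h))) (at \<theta> within UNIV)"
        by (intro has_derivative_Pair derivative_intros)
      show "range (\<lambda>\<eta>. (t, \<eta>)) \<subseteq> {0..T} \<times> UNIV" using that by auto
    qed simp_all
    moreover have "(\<lambda>h. f' (t, \<theta>) (0, h)) = (*) (f' (t, \<theta>) (0, 1))"
    proof (rule ext)
      show "f' (t, \<theta>) (0, h) = f' (t, \<theta>) (0, 1) * h" for h
        using blinfun.scaleR_right[of "f' (t, \<theta>)" h "(0, 1)"] by simp
    qed
    ultimately show ?thesis
      by (simp only: has_field_derivative_def)
  qed
  \<comment> \<open>Since 0 < T the interval is nondegenerate, so one-sided derivatives at its ends
    are unique.\<close>
  have e1: "deriv_t T W z = f' z (1, 0)" if "z \<in> {0..T} \<times> UNIV" for z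
    using 1[of "fst z" "snd z"] that T unfolding deriv_t_def
    by (intro vector_derivative_within_closed_interval)
       (auto simp: has_real_derivative_iff_has_vector_derivative)
  have e2: "deriv_x W z = f' z (0, 1)" if "z \<in> {0..T} \<times> UNIV" for z
    using 2[of "fst z" "snd z"] that unfolding deriv_x_def by (auto intro: DERIV_imp_deriv)
  show "((\<lambda>\<tau>. W (\<tau>, snd z)) has_real_derivative deriv_t T W z) (at (fst z) within {0..T})"
    using 1[of "fst z" "snd z"] z by (auto simp: e1)
  show "((\<lambda>\<eta>. W (fst z, \<eta>)) has_real_derivative deriv_x W z) (at (snd z))"
    using 2[of "fst z" "snd z"] z by (auto simp: e2)
  have "(\<lambda>h. fst h * deriv_t T W z + snd h * deriv_x W z) = f' z"
  proof (rule ext)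
    fix h
    have "h = fst h *\<^sub>R (1, 0) + snd h *\<^sub>R (0, 1)"
      by (simp add: prod_eq_iff)
    then have "f' z h = f' z (fst h *\<^sub>R (1, 0) + snd h *\<^sub>R (0, 1))" by simp
    then show "fst h * deriv_t T W z + snd h * deriv_x W z = f' z h"
      unfolding blinfun.add_right blinfun.scaleR_right e1[OF z] e2[OF z] by simp
  qed
  then show "(W has_derivative (\<lambda>h. fst h * deriv_t T W z + snd h * deriv_x W z)) (at z within {0..T} \<times> UNIV)"
    using f'[OF z] by (simp only:)
  have "continuous_on ({0..T} \<times> UNIV) (\<lambda>z. f' z (1, 0))" "continuous_on ({0..T} \<times> UNIV) (\<lambda>z. f' z (0, 1))"
    by (intro continuous_intros cont)+
  then show "continuous_on ({0..T} \<times> UNIV) (deriv_t T W)" "continuous_on ({0..T} \<times> UNIV) (deriv_x W)"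
    using e1 e2 by (auto intro: continuous_on_eq)
qed

lemma deriv_t_periodic:
  assumes "t \<in> {0..T}"
  shows "deriv_t T W (t, \<theta> + of_int k) = deriv_t T W (t, \<theta>)"
proof -
  have "((\<lambda>\<tau>. W (\<tau>, \<theta>)) has_real_derivative deriv_t T W (t, \<theta> + of_int k)) (at t within {0..T})"
    by (rule has_field_derivative_transform_within[where d = 1 and f = "\<lambda>\<tau>. W (\<tau>, \<theta> + of_int k)"])
       (use C1_per_derivatives(2)[of "(t, \<theta> + of_int k)"] assms in \<open>auto simp: C1_per_periodic\<close>)
  then show ?thesis
    using C1_per_derivatives(2)[of "(t, \<theta>)"] assms T
    by (auto simp: has_real_derivative_iff_has_vector_derivative
             intro: vector_derivative_unique_within_closed_interval)
qed

lemma deriv_x_periodic: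
  assumes "t \<in> {0..T}"
  shows "deriv_x W (t, \<theta> + of_int k) = deriv_x W (t, \<theta>)"
proof -
  have "((\<lambda>\<eta>. W (t, \<eta>)) has_real_derivative deriv_x W (t, \<theta> + of_int k)) (at (\<theta> + of_int k))"
    using C1_per_derivatives(3)[of "(t, \<theta> + of_int k)"] assms by simp
  then have "((\<lambda>\<eta>. W (t, \<eta> + of_int k)) has_real_derivative deriv_x W (t, \<theta> + of_int k)) (at \<theta>)"
    by (simp add: DERIV_shift)
  then show ?thesis
    using C1_per_derivatives(3)[of "(t, \<theta>)"] assms
    by (auto simp: C1_per_periodic intro: DERIV_unique)
qed

text \<open>A real supremum dominates its terms only if the set is bounded; periodicity reduces this
  to a compact cell. Each supremum is also nonnegative, so a single one is at most the sum of the
  three.\<close>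

lemma C1_norm_bounds:
  assumes t: "t \<in> {0..T}"
  shows "\<bar>W (t, \<theta>)\<bar> \<le> C1_norm T W" "\<bar>deriv_t T W (t, \<theta>)\<bar> \<le> C1_norm T W"
    "\<bar>deriv_x W (t, \<theta>)\<bar> \<le> C1_norm T W"
proof -
  let ?S = "{0..T} \<times> (UNIV :: real set)"
  have sup: "\<bar>f (t, \<theta>)\<bar> \<le> (SUP (t, \<theta>)\<in>?S. \<bar>f (t, \<theta>)\<bar>)" "0 \<le> (SUP (t, \<theta>)\<in>?S. \<bar>f (t, \<theta>)\<bar>)"
    if cont: "continuous_on ?S f" and per: "\<And>t \<theta>. t \<in> {0..T} \<Longrightarrow> f (t, \<theta> + 1) = f (t, \<theta>)"
    for f :: "real \<times> real \<Rightarrow> real"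
  proof -
    obtain M where M: "\<And>t \<theta>. t \<in> {0..T} \<Longrightarrow> \<bar>f (t, \<theta>)\<bar> \<le> M"
      using periodic_bounded[OF cont per] by blast
    have "bdd_above ((\<lambda>(t, \<theta>). \<bar>f (t, \<theta>)\<bar>) ` ?S)"
      unfolding bdd_above_def by (rule exI[of _ M]) (use M in auto)
    then show "\<bar>f (t, \<theta>)\<bar> \<le> (SUP (t, \<theta>)\<in>?S. \<bar>f (t, \<theta>)\<bar>)"
      using cSUP_upper[of "(t, \<theta>)" ?S "\<lambda>(t, \<theta>). \<bar>f (t, \<theta>)\<bar>"] t by simp
    then show "0 \<le> (SUP (t, \<theta>)\<in>?S. \<bar>f (t, \<theta>)\<bar>)"
      by linarith
  qed
  have "continuous_on ?S W"
    using C1_per_derivatives(1) by (rule has_derivative_continuous_on)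
  note s0 = sup[OF this]
  note s1 = sup[OF C1_per_derivatives(4)] and s2 = sup[OF C1_per_derivatives(5)]
  have zt: "(t, \<theta>) \<in> ?S" using t by simp
  have p: "W (t, \<theta> + 1) = W (t, \<theta>)" "deriv_t T W (t, \<theta> + 1) = deriv_t T W (t, \<theta>)"
    "deriv_x W (t, \<theta> + 1) = deriv_x W (t, \<theta>)" if "t \<in> {0..T}" for t \<theta>
    using C1_per_periodic[OF that, of \<theta> 1] deriv_t_periodic[OF that, of \<theta> 1]
      deriv_x_periodic[OF that, of \<theta> 1] by auto
  have e: "C1_norm T W = (SUP (t, \<theta>)\<in>?S. \<bar>W (t, \<theta>)\<bar>) + (SUP (t, \<theta>)\<in>?S. \<bar>deriv_t T W (t, \<theta>)\<bar>)
      + (SUP (t, \<theta>)\<in>?S. \<bar>deriv_x W (t, \<theta>)\<bar>)"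
    by (simp add: C1_norm_def deriv_t_def deriv_x_def)
  show "\<bar>W (t, \<theta>)\<bar> \<le> C1_norm T W" "\<bar>deriv_t T W (t, \<theta>)\<bar> \<le> C1_norm T W"
    "\<bar>deriv_x W (t, \<theta>)\<bar> \<le> C1_norm T W"
    unfolding e using s0[OF p(1)] s1[OF zt p(2)] s2[OF zt p(3)] by linarith+
qed

end

lemma C1_per_diff:
  assumes T: "0 < T" and V: "C1_per T V" and W: "C1_per T W"
  shows "C1_per T (\<lambda>z. V z - W z)"
    and "t \<in> {0..T} \<Longrightarrow> deriv_t T (\<lambda>z. V z - W z) (t, \<theta>) = deriv_t T V (t, \<theta>) - deriv_t T W (t, \<theta>)"
    and "t \<in> {0..T} \<Longrightarrow> deriv_x (\<lambda>z. V z - W z) (t, \<theta>) = deriv_x V (t, \<theta>) - deriv_x W (t, \<theta>)"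
proof -
  let ?S = "{0..T} \<times> (UNIV :: real set)"
  obtain f' g' :: "real \<times> real \<Rightarrow> (real \<times> real) \<Rightarrow>\<^sub>L real"
    where "continuous_on ?S f'" "continuous_on ?S g'"
      and "\<forall>z\<in>?S. (V has_derivative f' z) (at z within ?S)" "\<forall>z\<in>?S. (W has_derivative g' z) (at z within ?S)"
    using V W unfolding C1_per_def C1_on_def by blast
  then have "continuous_on ?S (\<lambda>z. f' z - g' z)"
    and "\<forall>z\<in>?S. ((\<lambda>z. V z - W z) has_derivative blinfun_apply (f' z - g' z)) (at z within ?S)"
    by (auto intro!: continuous_intros has_derivative_diff simp: blinfun.diff_left[abs_def] minus_blinfun.rep_eq fun_diff_def)
  then show "C1_per T (\<lambda>z. V z - W z)"
    using V W unfolding C1_per_def C1_on_def by fastforce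
  assume t: "t \<in> {0..T}"
  show "deriv_t T (\<lambda>z. V z - W z) (t, \<theta>) = deriv_t T V (t, \<theta>) - deriv_t T W (t, \<theta>)"
    using DERIV_diff[OF C1_per_derivatives(2)[OF T V, of "(t, \<theta>)"] C1_per_derivatives(2)[OF T W, of "(t, \<theta>)"]] t T
    unfolding deriv_t_def[of T "\<lambda>z. V z - W z"] has_real_derivative_iff_has_vector_derivative
    by (intro vector_derivative_within_closed_interval) auto
  show "deriv_x (\<lambda>z. V z - W z) (t, \<theta>) = deriv_x V (t, \<theta>) - deriv_x W (t, \<theta>)"
    using DERIV_diff[OF C1_per_derivatives(3)[OF T V, of "(t, \<theta>)"] C1_per_derivatives(3)[OF T W, of "(t, \<theta>)"]] t
    unfolding deriv_x_def[of "\<lambda>z. V z - W z"]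
    by (intro DERIV_imp_deriv) auto
qed

section \<open>Characteristics and uniform bounds\<close>

lemma C1_per_has_derivative_at:
  assumes "0 < T" "C1_per T W" "t \<in> {0<..<T}"
  shows "(W has_derivative (\<lambda>h. fst h * deriv_t T W (t, \<theta>) + snd h * deriv_x W (t, \<theta>))) (at (t, \<theta>))"
proof -
  have "(t, \<theta>) \<in> interior ({0..T} \<times> UNIV)"
    using assms(3) by (simp add: interior_Times)
  then have "at (t, \<theta>) within {0..T} \<times> UNIV = at (t, \<theta>)"
    by (rule at_within_interior)
  moreover have "(t, \<theta>) \<in> {0..T} \<times> UNIV"
    using assms(3) by simp
  ultimately show ?thesis
    using C1_per_derivatives(1)[OF assms(1,2), of "(t, \<theta>)"] by (simp only:)
qed

section \<open>Transport with a nonlinear speed\<close>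

context
  fixes T :: real and W :: "real \<times> real \<Rightarrow> real" and c c' :: "real \<Rightarrow> real"
  assumes T: "0 < T" and W: "C1_per T W"
    and c: "\<And>y. (c has_real_derivative c' y) (at y)" "continuous_on UNIV c'"
    and pde: "\<And>t \<theta>. t \<in> {0<..<T} \<Longrightarrow> deriv_t T W (t, \<theta>) + c (W (t, \<theta>)) * deriv_x W (t, \<theta>) = 0"
begin

text \<open>Gronwall's argument for \<open>m s = W (s, \<theta> + s c\<^sub>0) - W (0, \<theta>)\<close>, which satisfies
  \<open>m' = (c\<^sub>0 - c (m + W (0, \<theta>))) \<partial>\<^sub>x W\<close> and \<open>m 0 = 0\<close>.\<close>

lemma constant_along_characteristics:
  assumes t: "t \<in> {0..T}"
  shows "W (t, \<theta> + t * c (W (0, \<theta>))) = W (0, \<theta>)"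
proof -
  define M where "M = C1_norm T W"
  have M: "\<bar>W (s, \<eta>)\<bar> \<le> M" "\<bar>deriv_x W (s, \<eta>)\<bar> \<le> M" if "s \<in> {0..T}" for s \<eta>
    using C1_norm_bounds[OF T W that] by (auto simp: M_def)
  then have M0: "0 \<le> M"
    using T abs_ge_zero order_trans by (metis atLeastAtMost_iff less_imp_le order_refl)
  \<comment> \<open>\<open>c\<close> is only locally Lipschitz, but the values of \<open>W\<close>
    stay in \<open>{-M..M}\<close>.\<close>
  have "bounded (c' ` {-M..M})"
    by (intro compact_imp_bounded compact_continuous_image continuous_on_subset[OF c(2)]) auto
  then obtain L0 where L0: "L0 > 0" "\<And>y. y \<in> {-M..M} \<Longrightarrow> \<bar>c' y\<bar> \<le> L0"
    unfolding bounded_pos by (auto simp: image_iff)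
  have lip: "\<bar>c x - c y\<bar> \<le> L0 * \<bar>x - y\<bar>" if "x \<in> {-M..M}" "y \<in> {-M..M}" for x y
    using field_differentiable_bound[of "{-M..M}" c c' L0 x y] c(1) L0 that
    by (auto intro: has_field_derivative_at_within)
  define c0 where "c0 = c (W (0, \<theta>))"
  define L where "L = L0 * M"
  define m where "m s = W (s, \<theta> + s * c0) - W (0, \<theta>)" for s
  define m' where "m' s = deriv_t T W (s, \<theta> + s * c0) + c0 * deriv_x W (s, \<theta> + s * c0)" for s
  have m: "(m has_real_derivative m' s) (at s)" if "s \<in> {0<..<T}" for s
  proof -
    have "((\<lambda>s. (s, \<theta> + s * c0)) has_derivative (\<lambda>h. (h, h * c0))) (at s)"
      by (auto intro!: derivative_eq_intros)
    from has_derivative_compose[OF this C1_per_has_derivative_at[OF T W that]]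
    have "((\<lambda>s. W (s, \<theta> + s * c0)) has_derivative
        (\<lambda>h. fst (h, h * c0) * deriv_t T W (s, \<theta> + s * c0) + snd (h, h * c0) * deriv_x W (s, \<theta> + s * c0))) (at s)" .
    then have "((\<lambda>s. W (s, \<theta> + s * c0)) has_real_derivative m' s) (at s)"
      unfolding has_field_derivative_def m'_def
      by (rule has_derivative_eq_rhs) (auto simp: fun_eq_iff algebra_simps)
    then show ?thesis
      unfolding m_def by (auto intro!: derivative_eq_intros)
  qed
  have m'_bound: "\<bar>m' s\<bar> \<le> L * \<bar>m s\<bar>" if "s \<in> {0<..<T}" for s
  proof -
    have s: "s \<in> {0..T}" using that by simp
    let ?z = "(s, \<theta> + s * c0)"
    have "m' s = (c (W (0, \<theta>)) - c (W ?z)) * deriv_x W ?z"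
      using pde[OF that, of "\<theta> + s * c0"] by (simp add: m'_def c0_def algebra_simps)
    also have "\<bar>\<dots>\<bar> \<le> (L0 * \<bar>W (0, \<theta>) - W ?z\<bar>) * M"
      unfolding abs_mult using M(1)[OF s, of "\<theta> + s * c0"] M(1)[of 0 \<theta>] T L0
      by (intro mult_mono lip M(2)[OF s]) (auto simp: abs_le_iff)
    finally show ?thesis
      by (simp add: L_def m_def abs_minus_commute mult_ac)
  qed
  \<comment> \<open>The exponential weight absorbs the growth allowed by \<bar>m'\<bar> \<le> L
    \<bar>m\<bar>, so \<open>g\<close> decreases from \<open>g 0 = 0\<close>. The equation holds at
    interior times only; the ends are reached by continuity.\<close>
  define g where "g s = (m s)\<^sup>2 * exp (- 2 * L * s)" for s
  have "g t \<le> g 0"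
  proof (cases "t = 0")
    case False
    then have "0 < t" using t by simp
    then show ?thesis
    proof (rule DERIV_nonpos_imp_decreasing_open[OF less_imp_le])
      fix s assume s: "0 < s" "s < t"
      then have sT: "s \<in> {0<..<T}" using t by auto
      have "(g has_real_derivative (2 * m s * m' s - 2 * L * (m s)\<^sup>2) * exp (- 2 * L * s)) (at s)"
        unfolding g_def
        by (auto intro!: derivative_eq_intros m[OF sT] simp: algebra_simps power2_eq_square)
      moreover have "m s * m' s \<le> L * (m s)\<^sup>2"
      proof -
        have "m s * m' s \<le> \<bar>m s\<bar> * \<bar>m' s\<bar>" by (simp add: abs_mult[symmetric])
        also have "\<dots> \<le> \<bar>m s\<bar> * (L * \<bar>m s\<bar>)"
          by (intro mult_left_mono m'_bound[OF sT]) simp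
        finally show ?thesis by (simp add: power2_eq_square mult.left_commute)
      qed
      then have "(2 * m s * m' s - 2 * L * (m s)\<^sup>2) * exp (- 2 * L * s) \<le> 0"
        by (simp add: mult_nonpos_nonneg)
      ultimately show "\<exists>y. (g has_real_derivative y) (at s) \<and> y \<le> 0"
        by blast
    next
      have "continuous_on {0..t} (\<lambda>s. W (s, \<theta> + s * c0))"
        by (rule continuous_on_compose2[of "{0..T} \<times> UNIV" W])
           (use t in \<open>auto intro!: continuous_intros has_derivative_continuous_on[OF C1_per_derivatives(1)[OF T W]]\<close>)
      then show "continuous_on {0..t} g"
        unfolding g_def m_def by (intro continuous_intros)
    qed
  qed simp
  then have "m t = 0"
    by (simp add: g_def m_def mult_le_0_iff)
  then show ?thesis
    by (simp add: m_def c0_def)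
qed

text \<open>Differentiate the identity of \<open>constant_along_characteristics\<close> in
  \<open>\<theta>\<close>; the second factor is the Jacobian of the characteristic map.\<close>

lemma deriv_x_along_characteristics:
  assumes t: "t \<in> {0..T}"
  shows "deriv_x W (t, \<theta> + t * c (W (0, \<theta>))) * (1 + t * (c' (W (0, \<theta>)) * deriv_x W (0, \<theta>)))
           = deriv_x W (0, \<theta>)"
proof -
  have d0: "((\<lambda>\<eta>. W (0, \<eta>)) has_real_derivative deriv_x W (0, \<theta>)) (at \<theta>)"
    using C1_per_derivatives(3)[OF T W, of "(0, \<theta>)"] T by simp
  have dt: "((\<lambda>\<eta>. W (t, \<eta>)) has_real_derivative deriv_x W (t, \<theta> + t * c (W (0, \<theta>)))) (at (\<theta> + t * c (W (0, \<theta>))))"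
    using C1_per_derivatives(3)[OF T W, of "(t, \<theta> + t * c (W (0, \<theta>)))"] t by simp
  have "((\<lambda>\<eta>. \<eta> + t * c (W (0, \<eta>))) has_real_derivative 1 + t * (c' (W (0, \<theta>)) * deriv_x W (0, \<theta>))) (at \<theta>)"
    by (intro DERIV_add DERIV_ident DERIV_cmult DERIV_chain2[OF c(1) d0])
  from DERIV_chain2[OF dt this] have "((\<lambda>\<eta>. W (0, \<eta>)) has_real_derivative
      deriv_x W (t, \<theta> + t * c (W (0, \<theta>))) * (1 + t * (c' (W (0, \<theta>)) * deriv_x W (0, \<theta>)))) (at \<theta>)"
    by (simp only: constant_along_characteristics[OF t])
  then show ?thesis
    using d0 by (rule DERIV_unique)
qed

text \<open>Otherwise the Jacobian, which is 1 at time 0, vanishes at some time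
  \<open>- 1 / D\<close> in \<open>{0..T}\<close>. The previous identity then forces the initial
  slope to be 0, although \<open>D\<close> is negative and contains it as a factor.\<close>

lemma no_shock:
  "0 < 1 + T * (c' (W (0, \<theta>)) * deriv_x W (0, \<theta>))"
proof (rule ccontr)
  define D where "D = c' (W (0, \<theta>)) * deriv_x W (0, \<theta>)"
  assume "\<not> ?thesis"
  then have TD: "T * D \<le> - 1" by (simp add: D_def)
  then have D: "D < 0"
    using T by (smt (verit) mult_nonneg_nonneg)
  have "- 1 / D \<in> {0..T}"
    using TD D by (auto simp: field_simps zero_le_divide_iff)
  from deriv_x_along_characteristics[OF this, of \<theta>] have "deriv_x W (0, \<theta>) = 0"
    unfolding D_def[symmetric] using D by simp
  then show False
    using D by (simp add: D_def)
qed

text \<open>\<open>c\<close> is bounded on the values of \<open>W\<close>, so the characteristic map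
  differs from the identity by at most \<open>t * B\<close>, and the intermediate value theorem
  applies.\<close>

lemma characteristics_onto:
  assumes t: "t \<in> {0..T}"
  obtains \<theta> where "\<eta> = \<theta> + t * c (W (0, \<theta>))"
proof -
  define h where "h \<theta> = \<theta> + t * c (W (0, \<theta>))" for \<theta>
  define M where "M = C1_norm T W"
  have M: "W (0, \<theta>) \<in> {-M..M}" for \<theta>
    using C1_norm_bounds(1)[OF T W, of 0 \<theta>] T by (auto simp: M_def abs_le_iff)
  have contc: "continuous_on S c" for S
    using c(1) by (meson DERIV_isCont continuous_at_imp_continuous_on)
  have "bounded (c ` {-M..M})"
    by (intro compact_imp_bounded compact_continuous_image contc) auto
  then obtain B where B: "\<And>y. y \<in> {-M..M} \<Longrightarrow> \<bar>c y\<bar> \<le> B"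
    unfolding bounded_iff by (metis imageI real_norm_def)
  have tB: "\<bar>t * c (W (0, \<theta>))\<bar> \<le> t * B" for \<theta>
    using B[OF M] t by (simp add: abs_mult mult_left_mono)
  have "continuous_on UNIV (\<lambda>\<theta>. W (0, \<theta>))"
    using C1_per_derivatives(3)[OF T W, of "(0, _)"] T
    by (auto intro!: continuous_at_imp_continuous_on DERIV_isCont)
  then have "continuous_on UNIV h"
    unfolding h_def by (intro continuous_intros continuous_on_compose2[OF contc[of UNIV]]) auto
  then have "continuous_on {\<eta> - t * B..\<eta> + t * B} h"
    by (rule continuous_on_subset) simp
  moreover have "h (\<eta> - t * B) \<le> \<eta>" "\<eta> \<le> h (\<eta> + t * B)" "\<eta> - t * B \<le> \<eta> + t * B"
    using tB[of "\<eta> - t * B"] tB[of "\<eta> + t * B"] unfolding h_def by linarith+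
  ultimately obtain \<theta> where "h \<theta> = \<eta>"
    using IVT'[of h "\<eta> - t * B" \<eta> "\<eta> + t * B"] by blast
  then show ?thesis
    using that by (auto simp: h_def)
qed

text \<open>The Jacobian is affine in time, equal to 1 at time 0 and at least \<open>m\<close> at
  time \<open>T\<close>. Since m \<le> 1, it is at least \<open>m\<close> in between.\<close>

lemma bounds_from_initial_slope:
  assumes m: "0 < m" "m \<le> 1" "\<And>\<theta>. m \<le> 1 + T * (c' (W (0, \<theta>)) * deriv_x W (0, \<theta>))"
    and K: "\<And>\<theta>. \<bar>W (0, \<theta>)\<bar> \<le> K" "\<And>\<theta>. \<bar>deriv_x W (0, \<theta>)\<bar> \<le> K"
    and t: "t \<in> {0..T}"
  shows "\<bar>W (t, \<eta>)\<bar> \<le> K" "\<bar>deriv_x W (t, \<eta>)\<bar> \<le> K / m"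
proof -
  obtain \<theta> where \<theta>: "\<eta> = \<theta> + t * c (W (0, \<theta>))"
    using characteristics_onto[OF t] .
  show "\<bar>W (t, \<eta>)\<bar> \<le> K"
    using constant_along_characteristics[OF t, of \<theta>] K(1)[of \<theta>] \<theta> by simp
  define D where "D = c' (W (0, \<theta>)) * deriv_x W (0, \<theta>)"
  have "m = (1 - t / T) * m + t / T * m"
    by (simp add: algebra_simps)
  also have "\<dots> \<le> (1 - t / T) * 1 + t / T * (1 + T * D)"
    using m(2) m(3)[of \<theta>] t T by (intro add_mono mult_left_mono) (auto simp: D_def)
  also have "\<dots> = 1 + t * D"
    using T by (simp add: field_simps)
  finally have mD: "m \<le> 1 + t * D" .
  have "deriv_x W (t, \<eta>) * (1 + t * D) = deriv_x W (0, \<theta>)"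
    using deriv_x_along_characteristics[OF t, of \<theta>] \<theta> by (simp add: D_def)
  then have "\<bar>deriv_x W (t, \<eta>)\<bar> * (1 + t * D) \<le> K"
    using K(2)[of \<theta>] mD m(1) by (metis abs_mult abs_of_pos less_le_trans)
  then have "\<bar>deriv_x W (t, \<eta>)\<bar> * m \<le> K"
    using mD by (meson abs_ge_zero mult_left_mono order_trans)
  then show "\<bar>deriv_x W (t, \<eta>)\<bar> \<le> K / m"
    using m(1) by (simp add: pos_le_divide_eq)
qed

end

text \<open>Near \<open>\<epsilon> = 0\<close> the bounds come from the convergence of the profiles; for \<open>\<epsilon>\<close> away from \<open>0\<close>
  the absence of shocks on \<open>[0, T]\<close> is made quantitative by compactness.\<close>

lemma profile_uniform_bounds:
  fixes a :: "real \<Rightarrow> 'b::euclidean_space"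
  assumes T: "0 < T"
    and a: "\<And>y. (a has_vector_derivative a' y) (at y)" "continuous_on UNIV a'"
    and W: "\<And>\<epsilon>. \<epsilon> \<in> {0<..1} \<Longrightarrow> C1_per T (W \<epsilon>)"
    and init: "\<And>\<epsilon> \<theta>. \<epsilon> \<in> {0<..1} \<Longrightarrow> W \<epsilon> (0, \<theta>) = U0 \<theta>"
    and pde: "\<And>\<epsilon> t \<theta>. \<epsilon> \<in> {0<..1} \<Longrightarrow> t \<in> {0<..<T} \<Longrightarrow>
        deriv_t T (W \<epsilon>) (t, \<theta>)
          + \<epsilon> powr (- \<gamma>) * ((a (ubar + \<epsilon> * W \<epsilon> (t, \<theta>)) - a ubar) \<bullet> v) * deriv_x (W \<epsilon>) (t, \<theta>) = 0"
    and U: "C1_per T U"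
    and near: "0 < e0" "\<And>\<epsilon>. \<epsilon> \<in> {0<..<e0} \<Longrightarrow> \<epsilon> \<le> 1 \<Longrightarrow> C1_norm T (\<lambda>z. W \<epsilon> z - U z) \<le> K0"
  obtains K where "0 < K"
    and "\<And>\<epsilon> t \<theta>. \<epsilon> \<in> {0<..1} \<Longrightarrow> t \<in> {0..T} \<Longrightarrow> \<bar>W \<epsilon> (t, \<theta>)\<bar> \<le> K"
    and "\<And>\<epsilon> t \<theta>. \<epsilon> \<in> {0<..1} \<Longrightarrow> t \<in> {0..T} \<Longrightarrow> \<bar>deriv_x (W \<epsilon>) (t, \<theta>)\<bar> \<le> K"
    and "\<And>\<epsilon> t \<theta>. \<epsilon> \<in> {0<..1} \<Longrightarrow> t \<in> {0<..<T} \<Longrightarrow> \<bar>deriv_t T (W \<epsilon>) (t, \<theta>)\<bar> \<le> K"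
proof -
  have one: "1 \<in> {0<..(1::real)}" by simp
  have t0: "0 \<in> {0..T}" using T by simp
  define U0' where "U0' \<theta> = deriv_x (W 1) (0, \<theta>)" for \<theta>
  have U0': "deriv_x (W \<epsilon>) (0, \<theta>) = U0' \<theta>" if "\<epsilon> \<in> {0<..1}" for \<epsilon> \<theta>
    using init[OF that] init[OF one] by (simp add: U0'_def deriv_x_def)
  \<comment> \<open>Speed in the phase variable: the characteristic speed relative to
    \<open>a ubar\<close>, in the direction \<open>v\<close>, times the wave number.\<close>
  define c where "c \<epsilon> y = \<epsilon> powr (- \<gamma>) * ((a (ubar + \<epsilon> * y) - a ubar) \<bullet> v)" for \<epsilon> y
  define c' where "c' \<epsilon> y = \<epsilon> powr (- \<gamma>) * (\<epsilon> * (a' (ubar + \<epsilon> * y) \<bullet> v))" for \<epsilon> y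
  have conta: "continuous_on S a" for S
    using a(1) by (meson has_vector_derivative_continuous continuous_at_imp_continuous_on)
  have c: "(c \<epsilon> has_real_derivative c' \<epsilon> y) (at y)" for \<epsilon> y
  proof -
    have "((\<lambda>y. ubar + \<epsilon> * y) has_derivative (\<lambda>h. \<epsilon> * h)) (at y)"
      by (auto intro!: derivative_eq_intros)
    from has_derivative_compose[OF this a(1)[unfolded has_vector_derivative_def]]
    have "((\<lambda>y. a (ubar + \<epsilon> * y)) has_derivative (\<lambda>h. (\<epsilon> * h) *\<^sub>R a' (ubar + \<epsilon> * y))) (at y)" .
    then have "(c \<epsilon> has_derivative (\<lambda>h. \<epsilon> powr (- \<gamma>) * (((\<epsilon> * h) *\<^sub>R a' (ubar + \<epsilon> * y) - 0) \<bullet> v))) (at y)"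
      unfolding c_def by (intro has_derivative_mult_right has_derivative_inner_left has_derivative_diff has_derivative_const)
    then show ?thesis
      unfolding has_field_derivative_def
      by (rule has_derivative_eq_rhs) (auto simp: c'_def fun_eq_iff)
  qed
  have contc': "continuous_on UNIV (c' \<epsilon>)" for \<epsilon>
    unfolding c'_def by (intro continuous_intros continuous_on_compose2[OF a(2)]) auto
  have pde': "deriv_t T (W \<epsilon>) (t, \<theta>) + c \<epsilon> (W \<epsilon> (t, \<theta>)) * deriv_x (W \<epsilon>) (t, \<theta>) = 0"
    if "\<epsilon> \<in> {0<..1}" "t \<in> {0<..<T}" for \<epsilon> t \<theta>
    using pde[OF that] by (simp add: c_def)
  define N where "N = C1_norm T (W 1)"
  have N: "\<bar>U0 \<theta>\<bar> \<le> N" "\<bar>U0' \<theta>\<bar> \<le> N" for \<theta>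
    using C1_norm_bounds(1,3)[OF T W[OF one] t0, of \<theta>] by (auto simp: N_def init[OF one] U0'_def)
  define e1 where "e1 = min e0 1"
  have e1: "0 < e1" "e1 \<le> 1" "e1 \<le> e0" using near(1) by (auto simp: e1_def)
  have contU0: "continuous_on UNIV U0"
    using C1_per_derivatives(3)[OF T W[OF one], of "(0, _)"] t0
    by (auto intro!: continuous_at_imp_continuous_on DERIV_isCont simp: init[OF one])
  have contU0': "continuous_on UNIV U0'"
    unfolding U0'_def
    by (rule continuous_on_compose2[OF C1_per_derivatives(5)[OF T W[OF one], of "(0, 0)"], where f = "\<lambda>\<theta>. (0, \<theta>)"])
       (use T in \<open>auto intro!: continuous_intros\<close>)
  \<comment> \<open>One period in \<open>\<theta>\<close> is enough, and away from
    \<open>\<epsilon> = 0\<close> the singular power of \<open>\<epsilon>\<close> is continuous, so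
    the Jacobian at time \<open>T\<close> attains its minimum.\<close>
  let ?C = "{e1..1} \<times> {0..1::real}"
  define G where "G z = 1 + T * (c' (fst z) (U0 (snd z)) * U0' (snd z))" for z
  have "continuous_on ?C G"
    unfolding G_def c'_def using e1(1)
    by (intro continuous_intros continuous_on_compose2[OF a(2)] continuous_on_compose2[OF contU0]
          continuous_on_compose2[OF contU0']) auto
  moreover have "compact ?C" "?C \<noteq> {}"
    using e1 by (auto simp: compact_Times)
  ultimately obtain z1 where z1: "z1 \<in> ?C" "\<And>z. z \<in> ?C \<Longrightarrow> G z1 \<le> G z"
    using continuous_attains_inf[of ?C G] by blast
  have Gpos: "0 < G (\<epsilon>, \<theta>)" if "\<epsilon> \<in> {0<..1}" for \<epsilon> \<theta>
    using no_shock[OF T W[OF that] c contc' pde'[OF that], of \<theta>] by (simp add: G_def init[OF that] U0'[OF that])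
  \<comment> \<open>Capped at 1, the value of the Jacobian at time 0.\<close>
  define m where "m = min 1 (G z1)"
  have m: "0 < m" "m \<le> 1"
    using Gpos[of "fst z1" "snd z1"] z1(1) e1 by (auto simp: m_def)
  have mG: "m \<le> 1 + T * (c' \<epsilon> (W \<epsilon> (0, \<theta>)) * deriv_x (W \<epsilon>) (0, \<theta>))" if \<epsilon>: "\<epsilon> \<in> {e1..1}" for \<epsilon> \<theta>
  proof -
    have \<epsilon>': "\<epsilon> \<in> {0<..1}" using \<epsilon> e1 by auto
    have "W \<epsilon> (0, \<theta>) = W \<epsilon> (0, frac \<theta>)" "deriv_x (W \<epsilon>) (0, \<theta>) = deriv_x (W \<epsilon>) (0, frac \<theta>)"
      using C1_per_periodic[OF T W[OF \<epsilon>'] t0, of "frac \<theta>" "\<lfloor>\<theta>\<rfloor>"]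
        deriv_x_periodic[OF T W[OF \<epsilon>'] t0, of "frac \<theta>" "\<lfloor>\<theta>\<rfloor>"] by (auto simp: frac_def)
    then have "G (\<epsilon>, frac \<theta>) = 1 + T * (c' \<epsilon> (W \<epsilon> (0, \<theta>)) * deriv_x (W \<epsilon>) (0, \<theta>))"
      by (simp add: G_def init[OF \<epsilon>'] U0'[OF \<epsilon>'])
    moreover have "G z1 \<le> G (\<epsilon>, frac \<theta>)"
      by (rule z1(2)) (use \<epsilon> frac_lt_1[of \<theta>] in \<open>auto simp: less_imp_le\<close>)
    ultimately show ?thesis by (simp add: m_def)
  qed
  have far: "\<bar>W \<epsilon> (t, \<theta>)\<bar> \<le> N" "\<bar>deriv_x (W \<epsilon>) (t, \<theta>)\<bar> \<le> N / m" if "\<epsilon> \<in> {e1..1}" "t \<in> {0..T}" for \<epsilon> t \<theta>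
  proof -
    have \<epsilon>': "\<epsilon> \<in> {0<..1}" using that e1 by auto
    have K: "\<bar>W \<epsilon> (0, \<theta>)\<bar> \<le> N" "\<bar>deriv_x (W \<epsilon>) (0, \<theta>)\<bar> \<le> N" for \<theta>
      using N by (simp_all add: init[OF \<epsilon>'] U0'[OF \<epsilon>'])
    show "\<bar>W \<epsilon> (t, \<theta>)\<bar> \<le> N" "\<bar>deriv_x (W \<epsilon>) (t, \<theta>)\<bar> \<le> N / m"
      using bounds_from_initial_slope[OF T W[OF \<epsilon>'] c contc' pde'[OF \<epsilon>'] m mG[OF that(1)] K that(2)] by auto
  qed
  have "bounded ((\<lambda>z. c (fst z) (snd z)) ` ({e1..1} \<times> {-N..N}))"
    unfolding c_def using e1(1)
    by (intro compact_imp_bounded compact_continuous_image compact_Times continuous_intros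
          continuous_on_compose2[OF conta[of UNIV]]) auto
  then obtain B where B: "\<And>\<epsilon> y. \<epsilon> \<in> {e1..1} \<Longrightarrow> y \<in> {-N..N} \<Longrightarrow> \<bar>c \<epsilon> y\<bar> \<le> B"
    unfolding bounded_iff by (force simp: image_iff)
  \<comment> \<open>The time derivative is read off the equation, hence the restriction to interior
    times.\<close>
  have far_t: "\<bar>deriv_t T (W \<epsilon>) (t, \<theta>)\<bar> \<le> B * (N / m)" if "\<epsilon> \<in> {e1..1}" "t \<in> {0<..<T}" for \<epsilon> t \<theta>
  proof -
    have \<epsilon>': "\<epsilon> \<in> {0<..1}" and t: "t \<in> {0..T}" using that e1 by auto
    have "\<bar>deriv_t T (W \<epsilon>) (t, \<theta>)\<bar> = \<bar>c \<epsilon> (W \<epsilon> (t, \<theta>))\<bar> * \<bar>deriv_x (W \<epsilon>) (t, \<theta>)\<bar>"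
      using pde'[OF \<epsilon>' that(2), of \<theta>] unfolding abs_mult[symmetric] by linarith
    also have "\<dots> \<le> B * (N / m)"
    proof (rule mult_mono)
      show 1: "\<bar>c \<epsilon> (W \<epsilon> (t, \<theta>))\<bar> \<le> B"
        using far(1)[OF that(1) t, of \<theta>] by (intro B that(1)) (auto simp: abs_le_iff)
      then show "0 \<le> B" by linarith
    qed (use far(2)[OF that(1) t] in auto)
    finally show ?thesis .
  qed
  define N1 where "N1 = C1_norm T U"
  have close: "\<bar>W \<epsilon> (t, \<theta>)\<bar> \<le> K0 + N1" "\<bar>deriv_t T (W \<epsilon>) (t, \<theta>)\<bar> \<le> K0 + N1"
      "\<bar>deriv_x (W \<epsilon>) (t, \<theta>)\<bar> \<le> K0 + N1"
    if "\<epsilon> \<in> {0<..<e1}" "t \<in> {0..T}" for \<epsilon> t \<theta>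
  proof -
    have \<epsilon>': "\<epsilon> \<in> {0<..1}" using that e1 by auto
    have n: "C1_norm T (\<lambda>z. W \<epsilon> z - U z) \<le> K0"
      by (rule near(2)) (use that e1 in auto)
    note D = C1_per_diff[OF T W[OF \<epsilon>'] U]
    show "\<bar>W \<epsilon> (t, \<theta>)\<bar> \<le> K0 + N1" "\<bar>deriv_t T (W \<epsilon>) (t, \<theta>)\<bar> \<le> K0 + N1"
      "\<bar>deriv_x (W \<epsilon>) (t, \<theta>)\<bar> \<le> K0 + N1"
      using C1_norm_bounds[OF T D(1) that(2), of \<theta>] C1_norm_bounds[OF T U that(2), of \<theta>] n
      unfolding D(2)[OF that(2)] D(3)[OF that(2)] N1_def by linarith+
  qed
  define K where "K = \<bar>K0 + N1\<bar> + \<bar>B * (N / m)\<bar> + \<bar>N\<bar> + \<bar>N / m\<bar> + 1"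
  show ?thesis
  proof (rule that[of K])
    have KB: "K0 + N1 \<le> K" "N \<le> K" "N / m \<le> K" "B * (N / m) \<le> K" and "0 < K"
      using abs_ge_self[of "K0 + N1"] abs_ge_self[of "B * (N / m)"] abs_ge_self[of N] abs_ge_self[of "N / m"]
        abs_ge_zero[of "K0 + N1"] abs_ge_zero[of "B * (N / m)"] abs_ge_zero[of N] abs_ge_zero[of "N / m"]
      unfolding K_def by linarith+
    show "0 < K" by fact
    fix \<epsilon> t \<theta> assume \<epsilon>: "\<epsilon> \<in> {0<..(1::real)}"
    consider "\<epsilon> \<in> {0<..<e1}" | "\<epsilon> \<in> {e1..1}" using \<epsilon> by force
    note cs = this
    show "\<bar>W \<epsilon> (t, \<theta>)\<bar> \<le> K" if "t \<in> {0..T}"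
      using cs
    proof cases
      case 1
      then show ?thesis using close(1)[OF 1 that, of \<theta>] KB by linarith
    next
      case 2
      then show ?thesis using far(1)[OF 2 that, of \<theta>] KB by linarith
    qed
    show "\<bar>deriv_x (W \<epsilon>) (t, \<theta>)\<bar> \<le> K" if "t \<in> {0..T}"
      using cs
    proof cases
      case 1
      then show ?thesis using close(3)[OF 1 that, of \<theta>] KB by linarith
    next
      case 2
      then show ?thesis using far(2)[OF 2 that, of \<theta>] KB by linarith
    qed
    show "\<bar>deriv_t T (W \<epsilon>) (t, \<theta>)\<bar> \<le> K" if "t \<in> {0<..<T}"
      using cs
    proof cases
      case 1
      then show ?thesis using close(2)[OF 1, of t \<theta>] that KB by force
    next
      case 2
      then show ?thesis using far_t[OF 2 that, of \<theta>] KB by linarith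
    qed
  qed
qed

section \<open>Slobodeckij norms of small oscillations\<close>

lemma dyadic_bracket:
  fixes r :: real
  assumes "1 \<le> r"
  obtains j :: nat where "2 ^ j \<le> r" "r < 2 ^ Suc j"
proof -
  obtain m where m: "r < 2 ^ m"
    using real_arch_pow[of 2 r] by auto
  define k where "k = (LEAST k. r < 2 ^ k)"
  have k: "r < 2 ^ k"
    unfolding k_def using m by (rule LeastI)
  then have "k \<noteq> 0" using assms by (auto intro!: gr0I)
  then obtain j where j: "k = Suc j" by (cases k) auto
  have "\<not> r < 2 ^ j"
    using not_less_Least[of j "\<lambda>k. r < 2 ^ k"] j by (simp add: k_def)
  with k show ?thesis
    by (intro that[of j]) (simp_all add: j not_less)
qed

lemma norm_le_imp_mem_cbox:
  fixes h :: "'a::euclidean_space"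
  assumes "norm h \<le> \<rho>"
  shows "h \<in> cbox (- (\<rho> *\<^sub>R One)) (\<rho> *\<^sub>R One)"
  using Basis_le_norm[of _ h] assms unfolding mem_box by (fastforce simp: abs_le_iff)

lemma emeasure_centered_cbox:
  fixes \<rho> :: real
  assumes "0 \<le> \<rho>"
  shows "emeasure lborel (cbox (- (\<rho> *\<^sub>R One)) (\<rho> *\<^sub>R One :: 'a::euclidean_space)) = ennreal ((2 * \<rho>) ^ DIM('a))"
proof -
  have "(\<Prod>b\<in>Basis. (\<rho> *\<^sub>R One - - (\<rho> *\<^sub>R One) :: 'a) \<bullet> b) = (\<Prod>b\<in>(Basis :: 'a set). 2 * \<rho>)"
    by (rule prod.cong) (auto simp: inner_add_left)
  then show ?thesis
    using assms by (simp only: emeasure_lborel_cbox_eq) (simp add: inner_diff_left)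
qed

text \<open>The volume of a cube of side \<open>4 * X\<close> cancels the dimension in the exponent
  of the kernel.\<close>

lemma powr_scaled_power:
  fixes X :: real
  assumes "0 < X"
  shows "X powr (- (real n + \<alpha>)) * (4 * X) ^ n = 4 ^ n * X powr (- \<alpha>)"
proof -
  have "X powr (- (real n + \<alpha>)) = X powr (- \<alpha>) / X ^ n"
    using assms by (simp add: powr_diff powr_realpow[symmetric] add.commute[of "real n"])
  then show ?thesis
    using assms by (simp add: power_mult_distrib)
qed

text \<open>The annuli \<open>2\<^sup>j \<le> \<bar>h\<bar>/L < 2\<^sup>j\<^sup>+\<^sup>1\<close>, \<open>j \<in> \<int>\<close>, are covered by cubes of comparable volume, and the
  contributions form two geometric series since \<open>0 < s < 1\<close>.\<close>

lemma truncated_kernel_integral: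
  fixes s p :: real
  assumes s: "0 < s" "s < 1" and p: "1 \<le> p"
  obtains C where "0 \<le> C"
    and "\<And>L. 0 < L \<Longrightarrow>
      (\<integral>\<^sup>+h. ennreal (min 1 (norm h / L) powr p / norm h powr (real DIM('a::euclidean_space) + s * p)) \<partial>(lborel :: 'a measure))
        \<le> ennreal (C * L powr (- (s * p)))"
proof -
  define n where "n = DIM('a)"
  define \<alpha> where "\<alpha> = s * p"
  have \<alpha>: "0 < \<alpha>" "\<alpha> < p" using s p by (auto simp: \<alpha>_def)
  \<comment> \<open>Ratios of the two series: \<open>x < 1\<close> for the annuli outside radius
    \<open>L\<close> because s p > 0, and \<open>y < 1\<close> for those inside because s p <
    p.\<close>
  define x where "x = (2::real) powr (- \<alpha>)"
  define y where "y = (2::real) powr (\<alpha> - p)"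
  have x: "0 < x" "x < 1" and y: "0 < y" "y < 1"
    using \<alpha> by (auto simp: x_def y_def powr_less_one)
  define D where "D j = 4 ^ n * x ^ j + 4 ^ n * 2 powr p * y ^ Suc j" for j
  define C where "C = (\<Sum>j. D j)"
  have sD: "summable D"
    unfolding D_def using x y
    by (intro summable_add summable_mult summable_geometric summable_ignore_initial_segment[where k = 1, simplified]) auto
  have D0: "0 \<le> D j" for j using x y by (simp add: D_def)
  have C0: "0 \<le> C" unfolding C_def by (rule suminf_nonneg[OF sD D0])
  have "(\<integral>\<^sup>+h. ennreal (min 1 (norm h / L) powr p / norm h powr (real n + \<alpha>)) \<partial>(lborel :: 'a measure))
          \<le> ennreal (C * L powr (- \<alpha>))" if L: "0 < L" for L
  proof -
    \<comment> \<open>Inner radii of the annuli: \<open>X j\<close> from \<open>L\<close> outwards,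
      \<open>Y j\<close> from \<open>L / 2\<close> inwards. In both cases the outer radius is twice
      the inner one.\<close>
    define X where "X j = L * 2 ^ j" for j :: nat
    define Y where "Y j = L / 2 ^ Suc j" for j :: nat
    have X: "0 < X j" and Y: "0 < Y j" for j using L by (auto simp: X_def Y_def)
    define Q where "Q \<rho> = cbox (- (\<rho> *\<^sub>R One)) (\<rho> *\<^sub>R One :: 'a)" for \<rho> :: real
    define A where "A j = X j powr (- (real n + \<alpha>))" for j
    define B where "B j = (2 * Y j / L) powr p * Y j powr (- (real n + \<alpha>))" for j
    define f where "f j h = ennreal (A j) * indicator (Q (2 * X j)) h + ennreal (B j) * indicator (Q (2 * Y j)) h" for j and h :: 'a
    have le: "ennreal (min 1 (norm h / L) powr p / norm h powr (real n + \<alpha>)) \<le> (\<Sum>j. f j h)" for h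
    proof -
      have "\<exists>j. ennreal (min 1 (norm h / L) powr p / norm h powr (real n + \<alpha>)) \<le> f j h"
      \<comment> \<open>At the origin numerator and denominator are 0, and the quotient is 0 by
        convention.\<close>
      proof (cases "h = 0")
        case False
        then have h: "0 < norm h" by simp
        have exp0: "0 \<le> real n + \<alpha>" using \<alpha> by simp
        show ?thesis
        proof (cases "L \<le> norm h")
          case True
          then have "1 \<le> norm h / L" using L by simp
          then obtain j where j: "2 ^ j \<le> norm h / L" "norm h / L < 2 ^ Suc j"
            using dyadic_bracket by blast
          have Xh: "X j \<le> norm h" "norm h \<le> 2 * X j"
            using j L by (auto simp: X_def field_simps)
          have "min 1 (norm h / L) powr p / norm h powr (real n + \<alpha>) \<le> 1 / norm h powr (real n + \<alpha>)"
            using \<open>1 \<le> norm h / L\<close> by (simp add: min_def)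
          also have "\<dots> \<le> 1 / X j powr (real n + \<alpha>)"
            using X[of j] Xh exp0 by (intro divide_left_mono powr_mono2 mult_pos_pos) auto
          also have "\<dots> = A j" by (simp only: A_def powr_minus_divide)
          finally have "ennreal (min 1 (norm h / L) powr p / norm h powr (real n + \<alpha>)) \<le> ennreal (A j)"
            by (rule ennreal_leI)
          also have "\<dots> \<le> f j h"
            using norm_le_imp_mem_cbox[OF Xh(2)] by (simp add: f_def Q_def)
          finally show ?thesis by blast
        next
          case False
          then have "1 \<le> L / norm h" using h by simp
          then obtain j where j: "2 ^ j \<le> L / norm h" "L / norm h < 2 ^ Suc j"
            using dyadic_bracket by blast
          have Yh: "Y j \<le> norm h" "norm h \<le> 2 * Y j"
            using j L h by (auto simp: Y_def field_simps)
          have mn: "0 \<le> min 1 (norm h / L)" "min 1 (norm h / L) \<le> 2 * Y j / L"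
            using L Yh(2) by (auto simp: min_le_iff_disj intro: divide_right_mono)
          have "min 1 (norm h / L) powr p / norm h powr (real n + \<alpha>)
              \<le> (2 * Y j / L) powr p / norm h powr (real n + \<alpha>)"
            using p by (intro divide_right_mono powr_mono2 mn) auto
          also have "\<dots> \<le> (2 * Y j / L) powr p / Y j powr (real n + \<alpha>)"
            using Y[of j] Yh exp0 h by (intro divide_left_mono powr_mono2 mult_pos_pos) auto
          also have "\<dots> = B j" by (simp only: B_def powr_minus_divide times_divide_eq_right mult_1_right)
          finally have "ennreal (min 1 (norm h / L) powr p / norm h powr (real n + \<alpha>)) \<le> ennreal (B j)"
            by (rule ennreal_leI)
          also have "\<dots> \<le> f j h"
            using norm_le_imp_mem_cbox[OF Yh(2)] by (simp add: f_def Q_def)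
          finally show ?thesis by blast
        qed
      qed simp
      then obtain j where "ennreal (min 1 (norm h / L) powr p / norm h powr (real n + \<alpha>)) \<le> f j h" ..
      also have "\<dots> \<le> (\<Sum>j. f j h)"
        using sum_le_suminf[of "\<lambda>j. f j h" "{j}"] by (simp add: summableI)
      finally show ?thesis .
    qed
    have eQ: "emeasure lborel (Q (2 * Z)) = ennreal ((4 * Z) ^ n)" if "0 < Z" for Z
      unfolding Q_def n_def using that by (subst emeasure_centered_cbox) (simp_all add: mult.assoc[symmetric])
    have int: "(\<integral>\<^sup>+h. f j h \<partial>lborel) = ennreal (L powr (- \<alpha>) * D j)" for j
    proof -
      have "(\<integral>\<^sup>+h. f j h \<partial>lborel) = ennreal (A j) * emeasure lborel (Q (2 * X j)) + ennreal (B j) * emeasure lborel (Q (2 * Y j))"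
        unfolding f_def by (subst nn_integral_add) (auto simp: Q_def nn_integral_cmult_indicator)
      also have "\<dots> = ennreal (A j * (4 * X j) ^ n + B j * (4 * Y j) ^ n)"
        using X[of j] Y[of j] L
        by (simp add: eQ ennreal_mult'[symmetric] ennreal_plus[symmetric] A_def B_def
                 del: ennreal_plus)
      also have "A j * (4 * X j) ^ n = 4 ^ n * X j powr (- \<alpha>)"
        unfolding A_def by (rule powr_scaled_power[OF X])
      also have "X j powr (- \<alpha>) = L powr (- \<alpha>) * x ^ j"
        using L by (simp add: X_def powr_mult x_def powr_realpow[symmetric] powr_powr mult.commute)
      also have "B j * (4 * Y j) ^ n = (2 * Y j / L) powr p * (4 ^ n * Y j powr (- \<alpha>))"
        by (simp only: B_def mult.assoc powr_scaled_power[OF Y])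
      also have "\<dots> = 4 ^ n * 2 powr p * (L powr (- p) * Y j powr (p - \<alpha>))"
        using L Y[of j] by (simp add: powr_divide powr_mult powr_minus powr_diff field_simps)
      also have "Y j powr (p - \<alpha>) = L powr (p - \<alpha>) * y ^ Suc j"
      proof -
        have "Y j = L * 2 powr (- real (Suc j))"
          by (simp only: Y_def powr_minus_divide powr_realpow[OF zero_less_numeral] times_divide_eq_right mult_1_right)
        then have "Y j powr (p - \<alpha>) = L powr (p - \<alpha>) * 2 powr ((\<alpha> - p) * real (Suc j))"
          using L by (simp add: powr_mult powr_powr algebra_simps del: of_nat_Suc)
        then show ?thesis
          by (simp add: y_def powr_powr powr_realpow[symmetric] del: of_nat_Suc power_Suc)
      qed
      also have "L powr (- p) * (L powr (p - \<alpha>) * y ^ Suc j) = L powr (- \<alpha>) * y ^ Suc j"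
        using L by (simp add: powr_add[symmetric] mult.assoc[symmetric])
      finally show ?thesis
        by (simp add: D_def algebra_simps)
    qed
    have "(\<integral>\<^sup>+h. ennreal (min 1 (norm h / L) powr p / norm h powr (real n + \<alpha>)) \<partial>(lborel :: 'a measure))
          \<le> (\<integral>\<^sup>+h. (\<Sum>j. f j h) \<partial>lborel)"
      by (rule nn_integral_mono) (rule le)
    also have "\<dots> = (\<Sum>j. \<integral>\<^sup>+h. f j h \<partial>lborel)"
      by (rule nn_integral_suminf) (auto simp: f_def Q_def)
    also have "\<dots> = ennreal (\<Sum>j. L powr (- \<alpha>) * D j)"
      unfolding int using sD D0 by (intro suminf_ennreal2) (auto intro: summable_mult)
    also have "(\<Sum>j. L powr (- \<alpha>) * D j) = C * L powr (- \<alpha>)"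
      unfolding C_def suminf_mult[OF sD] by (rule mult.commute)
    finally show ?thesis .
  qed
  then show ?thesis
    using that C0 by (simp add: n_def \<alpha>_def)
qed

lemma ennreal_rpow_le:
  assumes "x \<le> ennreal c" "0 \<le> c" "0 \<le> r"
  shows "ennreal_rpow x r \<le> ennreal (c powr r)"
proof -
  have "x \<noteq> \<infinity>" using assms(1) by (auto simp: top_unique)
  moreover have "enn2real x \<le> c"
    using enn2real_mono[OF assms(1)] assms(2) by simp
  ultimately show ?thesis
    using assms(3) by (auto simp: ennreal_rpow_def intro!: ennreal_leI powr_mono2)
qed

lemma Lp_norm_le:
  assumes "set_borel_measurable lebesgue Q V" and "Q \<in> sets lebesgue" "emeasure lebesgue Q \<le> ennreal M" "0 \<le> M"
    and "\<And>x. x \<in> Q \<Longrightarrow> \<bar>V x\<bar> \<le> K" and p: "1 \<le> p"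
  shows "Lp_norm p Q V \<le> ennreal ((K powr p * M) powr (1 / p))"
proof -
  have "(\<integral>\<^sup>+x\<in>Q. ennreal (\<bar>V x\<bar> powr p) \<partial>lebesgue) \<le> (\<integral>\<^sup>+x. ennreal (K powr p) * indicator Q x \<partial>lebesgue)"
    using assms(5) p by (intro nn_integral_mono) (auto simp: indicator_def intro!: ennreal_leI powr_mono2)
  also have "\<dots> = ennreal (K powr p) * emeasure lebesgue Q"
    using assms(2) by (rule nn_integral_cmult_indicator)
  also have "\<dots> \<le> ennreal (K powr p) * ennreal M"
    using assms(3) by (rule mult_left_mono) simp
  also have "\<dots> = ennreal (K powr p * M)"
    using assms(4) by (simp add: ennreal_mult)
  finally show ?thesis
    unfolding Lp_norm_def using assms(1,4) p by (auto intro!: ennreal_rpow_le)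
qed

text \<open>The exponent \<open>1/\<gamma>\<close> balances the amplitude \<open>\<epsilon>\<close> and the wave length \<open>\<epsilon>\<^sup>\<gamma>\<close>.\<close>

lemma sobolev_norm_oscillation_bound:
  fixes \<gamma> p K M :: real
  assumes \<gamma>: "1 < \<gamma>" and p: "1 \<le> p" and M: "0 \<le> M" and K: "0 \<le> K"
  obtains C where "0 \<le> C"
    and "\<And>Q (V :: 'a::euclidean_space \<Rightarrow> real) \<epsilon>. 0 < \<epsilon> \<Longrightarrow> open Q \<Longrightarrow> continuous_on Q V \<Longrightarrow> emeasure lebesgue Q \<le> ennreal M
      \<Longrightarrow> (\<And>x. x \<in> Q \<Longrightarrow> \<bar>V x\<bar> \<le> K)
      \<Longrightarrow> (\<And>x y. x \<in> Q \<Longrightarrow> y \<in> Q \<Longrightarrow> \<bar>V x - V y\<bar> \<le> K * \<epsilon> * min 1 (norm (x - y) / \<epsilon> powr \<gamma>))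
      \<Longrightarrow> sobolev_norm (1 / \<gamma>) p Q V \<le> ennreal C"
proof -
  define s where "s = 1 / \<gamma>"
  have s: "0 < s" "s < 1" using \<gamma> by (auto simp: s_def)
  define N where "N = real DIM('a) + s * p"
  define k where "k L h = min 1 (norm h / L) powr p / norm h powr N" for L and h :: 'a
  obtain C0 where C0: "0 \<le> C0"
    and kern: "\<And>L. 0 < L \<Longrightarrow> (\<integral>\<^sup>+h. ennreal (k L h) \<partial>lborel) \<le> ennreal (C0 * L powr (- (s * p)))"
    unfolding k_def N_def using truncated_kernel_integral[OF s p, where 'a = 'a] by blast
  define C where "C = (K powr p * M) powr (1 / p) + (K powr p * C0 * M) powr (1 / p)"
  show ?thesis
  proof (rule that)
    show "0 \<le> C" by (simp add: C_def)
    fix Q and V :: "'a \<Rightarrow> real" and \<epsilon> :: real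
    assume \<epsilon>: "0 < \<epsilon>" and Q: "open Q" and V: "continuous_on Q V" and m: "emeasure lebesgue Q \<le> ennreal M"
      and VK: "\<And>x. x \<in> Q \<Longrightarrow> \<bar>V x\<bar> \<le> K"
      and osc: "\<And>x y. x \<in> Q \<Longrightarrow> y \<in> Q \<Longrightarrow> \<bar>V x - V y\<bar> \<le> K * \<epsilon> * min 1 (norm (x - y) / \<epsilon> powr \<gamma>)"
    define L where "L = \<epsilon> powr \<gamma>"
    have L: "0 < L" using \<epsilon> by (simp add: L_def)
    have Qs: "Q \<in> sets lebesgue" using Q by auto
    have kmeas: "(\<lambda>h. ennreal (k L h)) \<in> borel_measurable borel"
      unfolding k_def by measurable
    have "(\<lambda>x. indicator Q x *\<^sub>R V x) \<in> borel_measurable borel"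
      using Q V by (intro borel_measurable_continuous_on_indicator) auto
    then have Vm: "set_borel_measurable lebesgue Q V"
      unfolding set_borel_measurable_def by (intro measurable_completion) simp
    have kmeas': "(\<lambda>y. ennreal (k L (c + y))) \<in> borel_measurable lborel" for c
      by (rule measurable_compose[OF _ kmeas]) simp
    \<comment> \<open>For fixed \<open>x\<close> the domain of \<open>y\<close> is enlarged to the
      whole space; translation then gives the kernel integral, a bound free of both \<open>x\<close>
      and \<open>\<epsilon>\<close>.\<close>
    have inner: "(\<integral>\<^sup>+y\<in>Q. ennreal (\<bar>V x - V y\<bar> powr p / norm (x - y) powr N) \<partial>lebesgue) \<le> ennreal (K powr p * C0)"
      if x: "x \<in> Q" for x
    proof -
      have "(\<integral>\<^sup>+y\<in>Q. ennreal (\<bar>V x - V y\<bar> powr p / norm (x - y) powr N) \<partial>lebesgue)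
          \<le> (\<integral>\<^sup>+y. ennreal ((K * \<epsilon>) powr p) * ennreal (k L (- x + y)) \<partial>lebesgue)"
      proof (rule nn_integral_mono)
        fix y
        show "ennreal (\<bar>V x - V y\<bar> powr p / norm (x - y) powr N) * indicator Q y
            \<le> ennreal ((K * \<epsilon>) powr p) * ennreal (k L (- x + y))"
        proof (cases "y \<in> Q")
          case True
          have n: "norm (- x + y) = norm (x - y)" by (metis norm_minus_commute uminus_add_conv_diff)
          have "\<bar>V x - V y\<bar> powr p \<le> (K * \<epsilon> * min 1 (norm (x - y) / L)) powr p"
            using osc[OF x True] p by (intro powr_mono2) (auto simp: L_def)
          also have "\<dots> = (K * \<epsilon>) powr p * min 1 (norm (x - y) / L) powr p"
            using K \<epsilon> L by (simp add: powr_mult)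
          finally have "\<bar>V x - V y\<bar> powr p / norm (x - y) powr N \<le> (K * \<epsilon>) powr p * k L (- x + y)"
            unfolding k_def n by (simp add: divide_right_mono)
          then show ?thesis
            using True by (simp add: ennreal_mult'[symmetric] ennreal_leI)
        qed simp
      qed
      also have "\<dots> = ennreal ((K * \<epsilon>) powr p) * (\<integral>\<^sup>+y. ennreal (k L (- x + y)) \<partial>lborel)"
        unfolding nn_integral_completion
        by (rule nn_integral_cmult[OF kmeas'])
      also have "(\<integral>\<^sup>+y. ennreal (k L (- x + y)) \<partial>lborel) = (\<integral>\<^sup>+h. ennreal (k L h) \<partial>distr lborel borel ((+) (- x)))"
        by (rule nn_integral_distr[symmetric]) (use kmeas in auto)
      also have "\<dots> = (\<integral>\<^sup>+h. ennreal (k L h) \<partial>lborel)"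
        by (simp only: lborel_distr_plus)
      also have "ennreal ((K * \<epsilon>) powr p) * \<dots> \<le> ennreal ((K * \<epsilon>) powr p) * ennreal (C0 * L powr (- (s * p)))"
        by (intro mult_left_mono kern L) simp
      also have "\<dots> = ennreal ((K * \<epsilon>) powr p * (C0 * L powr (- (s * p))))"
        using C0 by (simp add: ennreal_mult)
      also have "(K * \<epsilon>) powr p * (C0 * L powr (- (s * p))) = K powr p * C0"
      proof -
        have "L powr (- (s * p)) = \<epsilon> powr (- p)"
          using \<gamma> by (simp add: L_def s_def powr_powr)
        then show ?thesis
          using K \<epsilon> by (simp add: powr_mult powr_minus field_simps)
      qed
      finally show ?thesis .
    qed
    have "(\<integral>\<^sup>+x\<in>Q. (\<integral>\<^sup>+y\<in>Q. ennreal (\<bar>V x - V y\<bar> powr p / norm (x - y) powr N) \<partial>lebesgue) \<partial>lebesgue)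
        \<le> (\<integral>\<^sup>+x. ennreal (K powr p * C0) * indicator Q x \<partial>lebesgue)"
      by (intro nn_integral_mono) (use inner in \<open>auto simp: indicator_def\<close>)
    also have "\<dots> = ennreal (K powr p * C0) * emeasure lebesgue Q"
      using Qs by (rule nn_integral_cmult_indicator)
    also have "\<dots> \<le> ennreal (K powr p * C0) * ennreal M"
      using m by (rule mult_left_mono) simp
    also have "\<dots> = ennreal (K powr p * C0 * M)"
      using C0 M by (simp add: ennreal_mult)
    finally have "slobodeckij_seminorm s p Q V \<le> ennreal ((K powr p * C0 * M) powr (1 / p))"
      unfolding slobodeckij_seminorm_def N_def using C0 M p by (intro ennreal_rpow_le) auto
    moreover have "Lp_norm p Q V \<le> ennreal ((K powr p * M) powr (1 / p))"
      by (rule Lp_norm_le[OF Vm Qs m M VK p])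
    ultimately show "sobolev_norm (1 / \<gamma>) p Q V \<le> ennreal C"
      using s by (auto simp: sobolev_norm_def C_def s_def[symmetric] intro!: add_mono)
  qed
qed

section \<open>Lower bounds for Sobolev norms\<close>

text \<open>Slabs orthogonal to \<open>w\<close> (if \<open>w\<close> and \<open>L\<close> are
  nonzero) on which the phase is within \<open>\<eta>\<close> of \<open>\<theta>\<close> modulo 1;
  the explicit integer matches the periodicity of the profiles.\<close>

definition stripes :: "'a::euclidean_space \<Rightarrow> real \<Rightarrow> real \<Rightarrow> real \<Rightarrow> 'a set" where
  "stripes w L \<theta> \<eta> = {x. \<exists>k::int. \<bar>L * (w \<bullet> x) - \<theta> - of_int k\<bar> \<le> \<eta>}"

lemma stripes_measurable [measurable]: "stripes w L \<theta> \<eta> \<in> sets borel"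
proof -
  have "stripes w L \<theta> \<eta> = (\<Union>k::int. {x. \<bar>L * (w \<bullet> x) - \<theta> - of_int k\<bar> \<le> \<eta>})"
    by (auto simp: stripes_def)
  then show ?thesis by simp
qed

lemma emeasure_lborel_translation:
  assumes "S \<in> sets borel"
  shows "emeasure lborel {x::'a::euclidean_space. c + x \<in> S} = emeasure lborel S"
proof -
  have "emeasure (distr lborel borel ((+) c)) S = emeasure lborel {x. c + x \<in> S}"
    using assms by (subst emeasure_distr) (auto simp: vimage_def)
  then show ?thesis by (simp add: lborel_distr_plus)
qed

lemma measure_lborel_box_pos:
  fixes l u :: "'a::euclidean_space"
  assumes "box l u \<noteq> {}"
  shows "0 < measure lborel (box l u)"
proof -
  have lu: "l \<bullet> b < u \<bullet> b" if "b \<in> Basis" for b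
    using assms that by (auto simp: box_ne_empty)
  have "0 < (\<Prod>b\<in>Basis. (u - l) \<bullet> b)"
    by (rule prod_pos) (use lu in \<open>simp add: inner_diff_left\<close>)
  then show ?thesis
    using lu by (subst measure_lborel_box_eq) (auto simp: less_imp_le)
qed

text \<open>The margin leaves room for displacements of order \<open>1 / L\<close>, which stay in
  the original box once \<open>L\<close> is large.\<close>

lemma shrunk_box:
  fixes l u :: "'a::euclidean_space"
  assumes "box l u \<noteq> {}"
  obtains \<rho> where "0 < \<rho>" "box (l + \<rho> *\<^sub>R One) (u - \<rho> *\<^sub>R One) \<noteq> {}"
proof -
  have lu: "l \<bullet> b < u \<bullet> b" if "b \<in> Basis" for b
    using assms that by (auto simp: box_ne_empty)
  \<comment> \<open>Each side loses \<open>2 * \<rho>\<close>, at most half of its length.\<close>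
  define \<rho> where "\<rho> = Min ((\<lambda>b. u \<bullet> b - l \<bullet> b) ` Basis) / 4"
  have "0 < Min ((\<lambda>b. u \<bullet> b - l \<bullet> b) ` Basis)"
    using lu by (subst Min_gr_iff) auto
  then have \<rho>: "0 < \<rho>" by (simp add: \<rho>_def)
  have "(l + \<rho> *\<^sub>R One) \<bullet> b < (u - \<rho> *\<^sub>R One) \<bullet> b" if b: "b \<in> Basis" for b
  proof -
    have "4 * \<rho> \<le> u \<bullet> b - l \<bullet> b"
      using b unfolding \<rho>_def by (simp add: Min_le)
    then show ?thesis
      using \<rho> b by (simp add: inner_add_left inner_diff_left)
  qed
  then show ?thesis
    using \<rho> by (intro that[of \<rho>]) (auto simp: box_ne_empty)
qed

lemma mem_box_if_near_shrunk_box: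
  fixes l u :: "'a::euclidean_space"
  assumes "x \<in> box (l + \<rho> *\<^sub>R One) (u - \<rho> *\<^sub>R One)" "norm (y - x) \<le> \<rho>"
  shows "y \<in> box l u"
  unfolding mem_box
proof
  fix b :: 'a assume b: "b \<in> Basis"
  have "\<bar>(y - x) \<bullet> b\<bar> \<le> \<rho>"
    using Basis_le_norm[OF b, of "y - x"] assms(2) by simp
  moreover have "l \<bullet> b + \<rho> < x \<bullet> b" "x \<bullet> b < u \<bullet> b - \<rho>"
    using assms(1) b by (auto simp: mem_box inner_add_left inner_diff_left)
  ultimately show "l \<bullet> b < y \<bullet> b \<and> y \<bullet> b < u \<bullet> b"
    by (auto simp: inner_diff_left abs_le_iff)
qed

text \<open>Finitely many translates of the striped part of a box, by less than one wave length, cover a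
  slightly smaller box.\<close>

lemma measure_stripes_lower_bound:
  fixes w l u :: "'a::euclidean_space"
  assumes w: "w \<noteq> 0" and ne: "box l u \<noteq> {}" and \<eta>: "0 < \<eta>"
  obtains c \<Lambda> where "0 < c" "0 < \<Lambda>"
    and "\<And>L \<theta>. \<Lambda> \<le> L \<Longrightarrow> c \<le> measure lborel (box l u \<inter> stripes w L \<theta> \<eta>)"
proof -
  obtain \<rho> where \<rho>: "0 < \<rho>" "box (l + \<rho> *\<^sub>R One) (u - \<rho> *\<^sub>R One) \<noteq> {}"
    using shrunk_box[OF ne] .
  define B where "B = box (l + \<rho> *\<^sub>R One) (u - \<rho> *\<^sub>R One)"
  have B: "0 < measure lborel B" "emeasure lborel B < \<infinity>"
    unfolding B_def by (rule measure_lborel_box_pos[OF \<rho>(2)]) (rule emeasure_lborel_box_finite)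
  \<comment> \<open>Moving by \<open>(\<tau> / L) *\<^sub>R d\<close> changes the phase by exactly
    \<open>\<tau>\<close>.\<close>
  define d where "d = w /\<^sub>R (w \<bullet> w)"
  have wd: "w \<bullet> d = 1" using w by (simp add: d_def)
  \<comment> \<open>\<open>N\<close> phase steps of size \<open>\<eta>\<close> exceed one
    period.\<close>
  obtain N :: nat where N: "1 / \<eta> < real N"
    using reals_Archimedean2 by blast
  then have N0: "0 < real N" using \<eta> by (meson divide_pos_pos less_trans zero_less_one)
  \<comment> \<open>From this wave number on, even the longest shift, at most
    \<open>real N * \<eta> * norm d / L\<close>, fits into the margin \<open>\<rho>\<close>.\<close>
  define \<Lambda> where "\<Lambda> = (real N * \<eta> * norm d + 1) / \<rho>"
  have \<Lambda>: "0 < \<Lambda>" using \<rho> \<eta> by (auto simp: \<Lambda>_def intro!: divide_pos_pos add_nonneg_pos)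
  show ?thesis
  proof (rule that)
    show "0 < measure lborel B / real N" using B N0 by simp
    show "0 < \<Lambda>" by fact
    fix L \<theta> assume L\<Lambda>: "\<Lambda> \<le> L"
    then have "0 < L" using \<Lambda> by linarith
    moreover have "real N * \<eta> * norm d + 1 \<le> L * \<rho>"
      using L\<Lambda> \<rho>(1) by (simp add: \<Lambda>_def pos_divide_le_eq)
    ultimately have L: "0 < L" "real N * \<eta> * norm d / L \<le> \<rho>"
      by (simp_all add: pos_divide_le_eq mult.commute)
    define S where "S = box l u \<inter> stripes w L \<theta> \<eta>"
    have Sm: "S \<in> sets borel" by (auto simp: S_def)
    define v where "v j = - ((real j * \<eta> / L) *\<^sub>R d)" for j
    have "B \<subseteq> (\<Union>j<N. {x. v j + x \<in> S})"
    proof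
      fix x assume x: "x \<in> B"
      \<comment> \<open>The phase excess over the integer below. Going back by \<open>j\<close>
        steps of size \<open>\<eta>\<close> leaves an excess in [0, \<open>\<eta>\<close>).\<close>
      define \<tau> where "\<tau> = frac (L * (w \<bullet> x) - \<theta>)"
      define j where "j = nat \<lfloor>\<tau> / \<eta>\<rfloor>"
      have \<tau>: "0 \<le> \<tau>" "\<tau> < 1" by (auto simp: \<tau>_def frac_lt_1)
      have "real j = of_int \<lfloor>\<tau> / \<eta>\<rfloor>" using \<tau> \<eta> by (simp add: j_def)
      then have "real j \<le> \<tau> / \<eta>" "\<tau> / \<eta> < real j + 1" by linarith+
      then have j: "real j * \<eta> \<le> \<tau>" "\<tau> < real j * \<eta> + \<eta>"
        using \<eta> by (auto simp: field_simps)
      have "real j \<le> 1 / \<eta>" using j \<tau> \<eta> by (simp add: field_simps)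
      then have jN: "j < N" using N by linarith
      have "norm (v j + x - x) \<le> \<rho>"
      proof -
        have "norm (v j + x - x) = real j * \<eta> * norm d / L"
          using L \<eta> by (simp add: v_def abs_mult)
        also have "\<dots> \<le> real N * \<eta> * norm d / L"
          using jN L \<eta> by (intro divide_right_mono mult_right_mono) auto
        finally show ?thesis using L by simp
      qed
      then have "v j + x \<in> box l u"
        using x mem_box_if_near_shrunk_box unfolding B_def by blast
      moreover have "L * (w \<bullet> (v j + x)) - \<theta> - of_int \<lfloor>L * (w \<bullet> x) - \<theta>\<rfloor> = \<tau> - real j * \<eta>"
        using L by (simp add: v_def inner_add_right wd \<tau>_def frac_def algebra_simps)
      then have "v j + x \<in> stripes w L \<theta> \<eta>"
        unfolding stripes_def using j by (intro CollectI exI[of _ "\<lfloor>L * (w \<bullet> x) - \<theta>\<rfloor>"]) auto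
      ultimately show "x \<in> (\<Union>j<N. {x. v j + x \<in> S})"
        using jN by (auto simp: S_def)
    qed
    then have "emeasure lborel B \<le> emeasure lborel (\<Union>j<N. {x. v j + x \<in> S})"
      using Sm by (intro emeasure_mono) auto
    also have "\<dots> \<le> (\<Sum>j<N. emeasure lborel {x. v j + x \<in> S})"
      using Sm by (intro emeasure_subadditive_finite) auto
    also have "\<dots> = of_nat N * emeasure lborel S"
      by (simp add: emeasure_lborel_translation[OF Sm])
    also have Sfin: "emeasure lborel S < \<infinity>"
      using emeasure_mono[of S "box l u" lborel] emeasure_lborel_box_finite[of l u]
      by (auto simp: S_def intro: le_less_trans)
    then have "of_nat N * emeasure lborel S = ennreal (real N * measure lborel S)"
      by (simp add: emeasure_eq_ennreal_measure ennreal_mult ennreal_of_nat_eq_real_of_nat)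
    also have "emeasure lborel B = ennreal (measure lborel B)"
      using B(2) by (intro emeasure_eq_ennreal_measure) auto
    finally have "measure lborel B \<le> real N * measure lborel S"
      by (simp add: ennreal_le_iff)
    then show "measure lborel B / real N \<le> measure lborel (box l u \<inter> stripes w L \<theta> \<eta>)"
      using N0 by (simp add: S_def field_simps)
  qed
qed

lemma ennreal_rpow_ge:
  assumes "ennreal c \<le> x" "0 \<le> c" "0 \<le> r"
  shows "ennreal (c powr r) \<le> ennreal_rpow x r"
proof (cases "x = \<infinity>")
  case False
  then have "c \<le> enn2real x"
    using enn2real_mono[OF assms(1)] assms(2) by (simp add: top.not_eq_extremum)
  then show ?thesis
    using False assms(2,3) by (auto simp: ennreal_rpow_def intro!: ennreal_leI powr_mono2)
qed (simp add: ennreal_rpow_def)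

lemma stripes_mono:
  assumes "x \<in> stripes w L \<theta> \<eta>" "\<eta> \<le> \<eta>'"
  shows "x \<in> stripes w L \<theta> \<eta>'"
  using assms unfolding stripes_def by (blast intro: order_trans)

text \<open>The shift along \<open>w\<close> carries phase \<open>\<theta>1\<close> to
  \<open>\<theta>2\<close>. Halving the width of the first stripe leaves \<open>\<eta> / 2\<close>
  for the phase error caused by the remaining displacement.\<close>

lemma mem_stripes_shift:
  fixes w :: "'a::euclidean_space"
  assumes w: "w \<noteq> 0" and L: "0 < L" and x: "x \<in> stripes w L \<theta>1 (\<eta> / 2)"
    and y: "norm (y - (x + ((\<theta>2 - \<theta>1) / L) *\<^sub>R (w /\<^sub>R (w \<bullet> w)))) \<le> \<eta> / (2 * norm w) / L"
  shows "y \<in> stripes w L \<theta>2 \<eta>"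
proof -
  obtain k :: int where k: "\<bar>L * (w \<bullet> x) - \<theta>1 - of_int k\<bar> \<le> \<eta> / 2"
    using x by (auto simp: stripes_def)
  define e where "e = y - (x + ((\<theta>2 - \<theta>1) / L) *\<^sub>R (w /\<^sub>R (w \<bullet> w)))"
  have "w \<bullet> y = w \<bullet> (x + ((\<theta>2 - \<theta>1) / L) *\<^sub>R (w /\<^sub>R (w \<bullet> w)) + e)"
    by (simp add: e_def)
  also have "\<dots> = w \<bullet> x + (\<theta>2 - \<theta>1) / L + w \<bullet> e"
    using w by (simp add: inner_add_right)
  finally have "L * (w \<bullet> y) - \<theta>2 - of_int k = (L * (w \<bullet> x) - \<theta>1 - of_int k) + L * (w \<bullet> e)"
    using L by (simp add: distrib_left)
  moreover have "\<bar>L * (w \<bullet> e)\<bar> \<le> \<eta> / 2"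
  proof -
    have "\<bar>L * (w \<bullet> e)\<bar> \<le> L * (norm w * norm e)"
      using L Cauchy_Schwarz_ineq2[of w e] by (simp add: abs_mult)
    also have "\<dots> \<le> L * (norm w * (\<eta> / (2 * norm w) / L))"
      using y L by (intro mult_left_mono) (auto simp: e_def)
    also have "\<dots> = \<eta> / 2"
      using w L by simp
    finally show ?thesis .
  qed
  ultimately have "\<bar>L * (w \<bullet> y) - \<theta>2 - of_int k\<bar> \<le> \<eta>"
    using k by linarith
  then show ?thesis
    unfolding stripes_def by blast
qed

text \<open>Every point of the \<open>\<theta>1\<close> stripes has, within distance
  \<open>R / L\<close>, a whole ball of radius \<open>r / L\<close> inside the
  \<open>\<theta>2\<close> stripes. On such pairs the integrand is at least \<open>J\<close>, the
  ball has volume \<open>v / L ^ n\<close>, and the base points have measure at least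
  \<open>c0\<close>. The dimension cancels and the power \<open>s * p\<close> of \<open>L\<close>
  remains.\<close>

lemma slobodeckij_seminorm_lower_bound:
  fixes w l u :: "'a::euclidean_space" and s p :: real
  assumes w: "w \<noteq> 0" and ne: "box l u \<noteq> {}" and \<eta>: "0 < \<eta>" and p: "1 \<le> p" and s: "0 < s"
  obtains c \<Lambda> where "0 < c" "0 < \<Lambda>"
    and "\<And>L A Q (V :: 'a \<Rightarrow> real). \<Lambda> \<le> L \<Longrightarrow> 0 < A \<Longrightarrow> box l u \<subseteq> Q
      \<Longrightarrow> (\<And>x y. x \<in> box l u \<inter> stripes w L \<theta>1 \<eta> \<Longrightarrow> y \<in> box l u \<inter> stripes w L \<theta>2 \<eta> \<Longrightarrow> A \<le> \<bar>V x - V y\<bar>)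
      \<Longrightarrow> ennreal (c * A * L powr s) \<le> slobodeckij_seminorm s p Q V"
proof -
  define n where "n = DIM('a)"
  define N where "N = real n + s * p"
  obtain \<rho> where \<rho>: "0 < \<rho>" "box (l + \<rho> *\<^sub>R One) (u - \<rho> *\<^sub>R One) \<noteq> {}"
    using shrunk_box[OF ne] .
  define B where "B = box (l + \<rho> *\<^sub>R One) (u - \<rho> *\<^sub>R One)"
  have "0 < \<eta> / 2" using \<eta> by simp
  then obtain c0 \<Lambda>0 where c0: "0 < c0" "0 < \<Lambda>0"
    "\<And>L \<theta>. \<Lambda>0 \<le> L \<Longrightarrow> c0 \<le> measure lborel (B \<inter> stripes w L \<theta> (\<eta> / 2))"
    unfolding B_def using measure_stripes_lower_bound[OF w \<rho>(2)] by blast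
  define d where "d = w /\<^sub>R (w \<bullet> w)"
  define r where "r = \<eta> / (2 * norm w)"
  have r: "0 < r" using w \<eta> by (simp add: r_def)
  \<comment> \<open>Length of the phase shift plus radius of the ball, both in units of
    \<open>1 / L\<close>.\<close>
  define R where "R = \<bar>\<theta>2 - \<theta>1\<bar> * norm d + r"
  have R: "0 < R" using r by (auto simp: R_def intro: add_nonneg_pos)
  define v where "v = unit_ball_vol (real n) * r ^ n"
  have v: "0 < v" using r by (simp add: v_def)
  define c where "c = (v / R powr N * c0) powr (1 / p)"
  define K where "K = v / R powr N * c0"
  have K: "0 < K" using v R c0 by (simp add: K_def)
  have c: "0 < c" "c = K powr (1 / p)" using v R c0 by (simp_all add: c_def K_def)
  \<comment> \<open>The second entry ensures that \<open>R / L\<close> fits into the margin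
    \<open>\<rho>\<close>.\<close>
  define \<Lambda> where "\<Lambda> = max \<Lambda>0 (R / \<rho>)"
  have \<Lambda>: "0 < \<Lambda>" using c0 by (simp add: \<Lambda>_def)
  show ?thesis
  proof (rule that[OF c(1) \<Lambda>])
    fix L A Q and V :: "'a \<Rightarrow> real"
    assume L\<Lambda>: "\<Lambda> \<le> L" and A: "0 < A" and Q: "box l u \<subseteq> Q"
      and VA: "\<And>x y. x \<in> box l u \<inter> stripes w L \<theta>1 \<eta> \<Longrightarrow> y \<in> box l u \<inter> stripes w L \<theta>2 \<eta> \<Longrightarrow> A \<le> \<bar>V x - V y\<bar>"
    have L: "0 < L" "\<Lambda>0 \<le> L" and "R / \<rho> \<le> L" using L\<Lambda> \<Lambda> by (auto simp: \<Lambda>_def)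
    then have RL: "R / L \<le> \<rho>"
      using \<rho> by (simp add: pos_divide_le_eq mult.commute)
    define S where "S = B \<inter> stripes w L \<theta>1 (\<eta> / 2)"
    have Sm: "S \<in> sets borel" by (auto simp: S_def B_def)
    define J where "J = A powr p / (R / L) powr N"
    have J: "0 < J" using A R L by (simp add: J_def)
    have inner: "ennreal (J * (v / L ^ n)) \<le> (\<integral>\<^sup>+y\<in>Q. ennreal (\<bar>V x - V y\<bar> powr p / norm (x - y) powr N) \<partial>lebesgue)"
      if x: "x \<in> S" for x
    proof -
      define z where "z = x + ((\<theta>2 - \<theta>1) / L) *\<^sub>R d"
      have pt: "ennreal J * indicator (ball z (r / L)) y
          \<le> ennreal (\<bar>V x - V y\<bar> powr p / norm (x - y) powr N) * indicator Q y" for y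
      proof (cases "y \<in> ball z (r / L)")
        case True
        then have yz: "norm (y - z) \<le> r / L" by (simp add: dist_norm norm_minus_commute)
        have "norm (y - x) \<le> norm (y - z) + norm (z - x)"
          using norm_triangle_ineq[of "y - z" "z - x"] by simp
        also have "\<dots> \<le> R / L"
        proof -
          have "norm (z - x) = \<bar>\<theta>2 - \<theta>1\<bar> * norm d / L"
            using L by (simp add: z_def)
          then show ?thesis
            using yz unfolding R_def add_divide_distrib by linarith
        qed
        finally have yx: "norm (y - x) \<le> R / L" .
        have yB: "y \<in> box l u"
          using mem_box_if_near_shrunk_box[of x l \<rho> u y] x yx RL by (auto simp: S_def B_def)
        have xB: "x \<in> box l u"
          using mem_box_if_near_shrunk_box[of x l \<rho> u x] x \<rho> by (auto simp: S_def B_def)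
        have xs: "x \<in> stripes w L \<theta>1 (\<eta> / 2)"
          using x by (simp add: S_def)
        have "y \<in> stripes w L \<theta>2 \<eta>"
          by (rule mem_stripes_shift[OF w L(1) xs]) (use yz in \<open>simp only: z_def d_def r_def\<close>)
        moreover have "x \<in> stripes w L \<theta>1 \<eta>"
          using \<eta> by (intro stripes_mono[OF xs]) simp
        ultimately have AV: "A \<le> \<bar>V x - V y\<bar>"
          using VA xB yB by blast
        \<comment> \<open>Needed because a quotient with denominator 0 would be 0 and the lower
          bound would fail.\<close>
        then have "x \<noteq> y" using A by auto
        then have "0 < norm (x - y)" by simp
        moreover have "0 \<le> N" using s p by (simp add: N_def)
        ultimately have "J \<le> \<bar>V x - V y\<bar> powr p / norm (x - y) powr N"
          unfolding J_def using A AV yx p R L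
          by (intro frac_le powr_mono2) (auto simp: norm_minus_commute)
        then show ?thesis
          using True yB Q by (auto intro: ennreal_leI)
      qed simp
      have "ennreal (J * (v / L ^ n)) = ennreal J * emeasure lborel (ball z (r / L))"
        using r L J v by (simp add: emeasure_ball v_def n_def power_divide ennreal_mult[symmetric])
      also have "\<dots> = (\<integral>\<^sup>+y. ennreal J * indicator (ball z (r / L)) y \<partial>lborel)"
        by (rule nn_integral_cmult_indicator[symmetric]) simp
      also have "\<dots> \<le> (\<integral>\<^sup>+y\<in>Q. ennreal (\<bar>V x - V y\<bar> powr p / norm (x - y) powr N) \<partial>lborel)"
        by (intro nn_integral_mono pt)
      finally show ?thesis by (simp add: nn_integral_completion)
    qed
    have fin: "emeasure lborel S < \<infinity>"
      using emeasure_mono[of S B lborel] emeasure_lborel_box_finite[of "l + \<rho> *\<^sub>R One" "u - \<rho> *\<^sub>R One"]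
      by (auto simp: S_def B_def intro: le_less_trans)
    have "ennreal (J * (v / L ^ n) * c0) \<le> ennreal (J * (v / L ^ n) * measure lborel S)"
      using c0(3)[OF L(2)] J v L by (intro ennreal_leI mult_left_mono) (auto simp: S_def)
    also have "\<dots> = ennreal (J * (v / L ^ n)) * ennreal (measure lborel S)"
      by (rule ennreal_mult) (use J v L in auto)
    also have "ennreal (measure lborel S) = emeasure lborel S"
      using fin by (intro emeasure_eq_ennreal_measure[symmetric]) auto
    also have "ennreal (J * (v / L ^ n)) * emeasure lborel S = (\<integral>\<^sup>+x. ennreal (J * (v / L ^ n)) * indicator S x \<partial>lborel)"
      by (rule nn_integral_cmult_indicator[symmetric]) (use Sm in simp)
    also have "\<dots> \<le> (\<integral>\<^sup>+x\<in>Q. (\<integral>\<^sup>+y\<in>Q. ennreal (\<bar>V x - V y\<bar> powr p / norm (x - y) powr N) \<partial>lebesgue) \<partial>lborel)"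
    proof (rule nn_integral_mono)
      fix x
      have "x \<in> Q" if "x \<in> S"
        using mem_box_if_near_shrunk_box[of x l \<rho> u x] that \<rho> Q by (auto simp: S_def B_def)
      then show "ennreal (J * (v / L ^ n)) * indicator S x
          \<le> (\<integral>\<^sup>+y\<in>Q. ennreal (\<bar>V x - V y\<bar> powr p / norm (x - y) powr N) \<partial>lebesgue) * indicator Q x"
        using inner[of x] by (auto simp: indicator_def)
    qed
    finally have "ennreal ((J * (v / L ^ n) * c0) powr (1 / p)) \<le> slobodeckij_seminorm s p Q V"
      unfolding slobodeckij_seminorm_def nn_integral_completion N_def n_def
      using J v L c0 p by (intro ennreal_rpow_ge) auto
    moreover have "(J * (v / L ^ n) * c0) powr (1 / p) = c * A * L powr s"
    proof -
      have "J = A powr p * (L powr N / R powr N)"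
        using L R by (simp add: J_def powr_divide)
      also have "L powr N = L ^ n * L powr (s * p)"
        using L by (simp add: N_def powr_add powr_realpow)
      finally have "J * (v / L ^ n) * c0 = K * A powr p * (L powr s) powr p"
        using L by (simp add: powr_powr K_def)
      then have "(J * (v / L ^ n) * c0) powr (1 / p)
          = K powr (1 / p) * (A powr p) powr (1 / p) * ((L powr s) powr p) powr (1 / p)"
        using K by (simp add: powr_mult)
      moreover have "(A powr p) powr (1 / p) = A" "((L powr s) powr p) powr (1 / p) = L powr s"
        using A L p by (simp_all add: powr_powr)
      ultimately show ?thesis by (simp add: c(2))
    qed
    ultimately show "ennreal (c * A * L powr s) \<le> slobodeckij_seminorm s p Q V"
      by simp
  qed
qed

section \<open>Weak derivatives tested with periodic bumps\<close>

lemma cos_2pi_minus_int: "cos (2 * pi * (y - of_int k)) = cos (2 * pi * y)"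
  by (simp add: right_diff_distrib cos_diff cos_int_2pin sin_int_2pin)

text \<open>Modulo 1 the phase reduces to its distance t \<le> 1/2 from the nearest integer, and cos
  (2 pi t) is strictly decreasing there.\<close>

lemma mem_stripes_if_cos_gt:
  assumes "cos (2 * pi * \<eta>) < cos (2 * pi * (L * (w \<bullet> x) - \<theta>))" and "0 < \<eta>" "\<eta> < 1 / 2"
  shows "x \<in> stripes w L \<theta> \<eta>"
proof -
  define y where "y = L * (w \<bullet> x) - \<theta>"
  define k where "k = round y"
  define t where "t = \<bar>y - of_int k\<bar>"
  have t: "0 \<le> t" "t \<le> 1 / 2"
    using of_int_round_abs_le[of y] by (auto simp: t_def k_def abs_minus_commute)
  have "cos (2 * pi * y) = cos (2 * pi * (y - of_int k))"
    by (rule cos_2pi_minus_int[symmetric])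
  also have "\<dots> = cos (2 * pi * t)"
    by (simp add: t_def abs_if) (metis cos_minus minus_diff_eq mult_minus_right)
  finally have "cos (2 * pi * \<eta>) < cos (2 * pi * t)"
    using assms(1) by (simp add: y_def)
  then have "2 * pi * t < 2 * pi * \<eta>"
    using t assms(2,3) by (subst (asm) cos_mono_less_eq) auto
  then show ?thesis
    unfolding stripes_def by (intro CollectI exI[of _ k]) (simp add: t_def y_def)
qed

lemma cos_ge_if_mem_stripes:
  assumes "x \<in> stripes w L \<theta> (\<eta> / 2)" and "0 < \<eta>" "\<eta> < 1 / 2"
  shows "cos (pi * \<eta>) \<le> cos (2 * pi * (L * (w \<bullet> x) - \<theta>))"
proof -
  define y where "y = L * (w \<bullet> x) - \<theta>"
  obtain k :: int where k: "\<bar>y - of_int k\<bar> \<le> \<eta> / 2"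
    using assms(1) by (auto simp: stripes_def y_def)
  define t where "t = \<bar>y - of_int k\<bar>"
  have "cos (2 * pi * y) = cos (2 * pi * (y - of_int k))"
    by (rule cos_2pi_minus_int[symmetric])
  also have "\<dots> = cos (2 * pi * t)"
    by (simp add: t_def abs_if) (metis cos_minus minus_diff_eq mult_minus_right)
  also have "cos (pi * \<eta>) \<le> cos (2 * pi * t)"
    using k assms(2,3) by (intro cos_monotone_0_pi_le) (auto simp: t_def)
  finally show ?thesis by (simp add: y_def)
qed

text \<open>The test function is a bump in the box times the periodic function
  \<open>flat 1 (cos (2\<pi>\<theta>) - cos (2\<pi>\<eta>))\<close>, which is positive exactly on \<open>[-\<eta>, \<eta>] + \<int>\<close> up to end points.\<close>

lemma weak_derivative_lower_bound:
  fixes w l u :: "'a::euclidean_space"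
  assumes w: "w \<noteq> 0" and ne: "box l u \<noteq> {}" and \<eta>: "0 < \<eta>" "\<eta> < 1 / 2"
  obtains c \<Lambda> where "0 < c" "0 < \<Lambda>"
    and "\<And>L A Q V V' b G \<sigma>. \<Lambda> \<le> L \<Longrightarrow> 0 \<le> A \<Longrightarrow> \<bar>\<sigma>\<bar> = 1 \<Longrightarrow> open Q \<Longrightarrow> cbox l u \<subseteq> Q
      \<Longrightarrow> (\<And>x. x \<in> Q \<Longrightarrow> (V has_derivative V' x) (at x)) \<Longrightarrow> continuous_on Q (\<lambda>x. V' x b)
      \<Longrightarrow> (\<And>x. x \<in> box l u \<inter> stripes w L \<theta> \<eta> \<Longrightarrow> A \<le> \<sigma> * V' x b)
      \<Longrightarrow> weak_derivative Q [b] V G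
      \<Longrightarrow> ennreal (c * A) \<le> (\<integral>\<^sup>+x\<in>Q. ennreal \<bar>G x\<bar> \<partial>lebesgue)"
proof -
  obtain \<rho> where \<rho>: "0 < \<rho>" "box (l + \<rho> *\<^sub>R One) (u - \<rho> *\<^sub>R One) \<noteq> {}"
    using shrunk_box[OF ne] .
  define B where "B = box (l + \<rho> *\<^sub>R One) (u - \<rho> *\<^sub>R One)"
  have "0 < \<eta> / 2" using \<eta> by simp
  then obtain c0 \<Lambda> where c0: "0 < c0" "0 < \<Lambda>"
    "\<And>L \<theta>. \<Lambda> \<le> L \<Longrightarrow> c0 \<le> measure lborel (B \<inter> stripes w L \<theta> (\<eta> / 2))"
    unfolding B_def using measure_stripes_lower_bound[OF w \<rho>(2)] by blast
  let ?B' = "cbox (l + \<rho> *\<^sub>R One) (u - \<rho> *\<^sub>R One)"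
  have B': "?B' \<noteq> {}" using \<rho>(2) box_subset_cbox by blast
  have "?B' \<subseteq> box l u"
    using \<rho>(1) by (auto simp: mem_box inner_add_left inner_diff_left) force+
  obtain x1 where x1: "x1 \<in> ?B'" "\<And>x. x \<in> ?B' \<Longrightarrow> box_bump l u x1 \<le> box_bump l u x"
    using continuous_attains_inf[OF compact_cbox B' continuous_on_smooth_fun[OF smooth_fun_box_bump]] by blast
  \<comment> \<open>Minimum of the test function's two factors on the shrunken box and the stripes
    of half width \<open>\<eta> / 2\<close>; it does not involve \<open>L\<close>.\<close>
  define c1 where "c1 = box_bump l u x1 * flat 1 (cos (pi * \<eta>) - cos (2 * pi * \<eta>))"
  have "cos (2 * pi * \<eta>) < cos (pi * \<eta>)"
    using \<eta> by (intro cos_monotone_0_pi) auto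
  moreover have "0 < box_bump l u x1"
    using x1(1) \<open>?B' \<subseteq> box l u\<close> by (auto simp: box_bump_pos_iff)
  ultimately have c1: "0 < c1" by (simp add: c1_def flat_1)
  show ?thesis
  proof (rule that[of "c1 * c0" \<Lambda>])
    show "0 < c1 * c0" "0 < \<Lambda>" using c0 c1 by auto
    fix L A Q V V' b G \<sigma>
    assume L: "\<Lambda> \<le> L" and A: "0 \<le> A" and \<sigma>: "\<bar>\<sigma>\<bar> = 1" and Q: "open Q" "cbox l u \<subseteq> Q"
      and V: "\<And>x. x \<in> Q \<Longrightarrow> (V has_derivative V' x) (at x)" "continuous_on Q (\<lambda>x. V' x b)"
      and VA: "\<And>x. x \<in> box l u \<inter> stripes w L \<theta> \<eta> \<Longrightarrow> A \<le> \<sigma> * V' x b"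
      and G: "weak_derivative Q [b] V G"
    define \<psi> where "\<psi> x = flat 1 (cos (2 * pi * (L * (w \<bullet> x) - \<theta>)) - cos (2 * pi * \<eta>))" for x
    define \<phi> where "\<phi> x = box_bump l u x * \<psi> x" for x
    have smooth: "smooth_fun \<phi>"
    proof -
      have "smooth_fun (\<lambda>x. (2 * pi * L) * (x \<bullet> w) + (- (2 * pi * \<theta>)))"
        by (rule smooth_fun_cmult_add[OF smooth_fun.inner])
      from smooth_fun_cmult_add[OF smooth_fun.cos[OF this]]
      have "smooth_fun (\<lambda>x. 1 * cos ((2 * pi * L) * (x \<bullet> w) + (- (2 * pi * \<theta>))) + (- cos (2 * pi * \<eta>)))" .
      then have "smooth_fun (\<lambda>x. flat 1 (1 * cos ((2 * pi * L) * (x \<bullet> w) + (- (2 * pi * \<theta>))) + (- cos (2 * pi * \<eta>))))"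
        by (rule smooth_fun.flat)
      then have "smooth_fun \<psi>"
        by (simp add: \<psi>_def[abs_def] algebra_simps inner_commute)
      then show ?thesis
        unfolding \<phi>_def by (intro smooth_fun.mult smooth_fun_box_bump)
    qed
    have \<phi>01: "0 \<le> \<phi> x" "\<phi> x \<le> 1" for x
      unfolding \<phi>_def \<psi>_def by (auto intro!: mult_le_one simp: box_bump_bounds flat_1)
    have \<phi>pos: "x \<in> box l u \<inter> stripes w L \<theta> \<eta>" if "\<phi> x \<noteq> 0" for x
    proof -
      have "box_bump l u x \<noteq> 0" "\<psi> x \<noteq> 0" using that by (auto simp: \<phi>_def)
      then have "x \<in> box l u" "cos (2 * pi * \<eta>) < cos (2 * pi * (L * (w \<bullet> x) - \<theta>))"
        using box_bump_eq_0[of x l u] by (auto simp: \<psi>_def flat_1 not_le)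
      then show ?thesis using mem_stripes_if_cos_gt \<eta> by blast
    qed
    have supp: "\<phi> x = 0" if "x \<notin> cbox l u" for x
      using \<phi>pos[of x] that box_subset_cbox[of l u] by blast
    note ibp = integration_by_parts[OF smooth supp Q V]
    have int\<phi>: "integrable lborel \<phi>"
      by (rule integrable_compactly_supported[of l u, OF continuous_on_smooth_fun[OF smooth] supp])
    have tf: "test_function Q \<phi>"
      by (rule test_function_smooth_fun[OF smooth supp Q(2)])
    have Qs: "Q \<in> sets lebesgue" using Q(1) by auto
    define S where "S = B \<inter> stripes w L \<theta> (\<eta> / 2)"
    have Sm: "S \<in> sets borel" by (auto simp: S_def B_def)
    have fin: "emeasure lborel S < \<infinity>"
      using emeasure_mono[of S B lborel] emeasure_lborel_box_finite[of "l + \<rho> *\<^sub>R One" "u - \<rho> *\<^sub>R One"]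
      by (auto simp: S_def B_def intro: le_less_trans)
    have intS: "integrable lborel (\<lambda>x. c1 * indicator S x)"
      using Sm fin by (auto intro!: integrable_mult_right integrable_real_indicator)
    have "c1 * c0 \<le> c1 * measure lborel S"
      using c0(3)[OF L] c1 by (auto simp: S_def)
    also have "\<dots> = (\<integral>x. c1 * indicator S x \<partial>lborel)"
      using Sm by simp
    also have "\<dots> \<le> integral\<^sup>L lborel \<phi>"
    proof (rule integral_mono[OF intS int\<phi>])
      fix x
      show "c1 * indicator S x \<le> \<phi> x"
      proof (cases "x \<in> S")
        case True
        then have "x \<in> ?B'" using box_subset_cbox by (auto simp: S_def B_def)
        moreover have "flat 1 (cos (pi * \<eta>) - cos (2 * pi * \<eta>)) \<le> \<psi> x"
        proof -
          have mono: "flat 1 a \<le> flat 1 b" if "0 < a" "a \<le> b" for a b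
            using that by (auto simp: flat_def intro: divide_left_mono)
          show ?thesis
            unfolding \<psi>_def using True cos_ge_if_mem_stripes[of x w L \<theta> \<eta>] \<eta> \<open>cos (2 * pi * \<eta>) < cos (pi * \<eta>)\<close>
            by (intro mono) (auto simp: S_def)
        qed
        ultimately have "c1 \<le> \<phi> x"
          unfolding c1_def \<phi>_def using x1(2) by (intro mult_mono) (auto simp: flat_1 box_bump_bounds)
        then show ?thesis using True by simp
      qed (simp add: \<phi>01)
    qed
    finally have "c1 * c0 * A \<le> A * integral\<^sup>L lborel \<phi>"
      using A by (simp add: mult.commute mult_left_mono)
    also have "\<dots> = (\<integral>x. A * \<phi> x \<partial>lborel)" by simp
    \<comment> \<open>Where \<open>\<phi>\<close> is nonzero the slope has the fixed sign, so
      nothing cancels.\<close>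
    also have "\<dots> \<le> (\<integral>x. \<sigma> * (\<phi> x * V' x b) \<partial>lborel)"
    proof (rule integral_mono)
      fix x
      show "A * \<phi> x \<le> \<sigma> * (\<phi> x * V' x b)"
      proof (cases "\<phi> x = 0")
        case False
        then have "A \<le> \<sigma> * V' x b" by (intro VA \<phi>pos)
        then have "A * \<phi> x \<le> \<sigma> * V' x b * \<phi> x" by (rule mult_right_mono) (rule \<phi>01)
        then show ?thesis by (simp add: mult_ac)
      qed simp
    qed (use int\<phi> ibp(2) in auto)
    also have "\<dots> = \<sigma> * (\<integral>x. \<phi> x * V' x b \<partial>lborel)" by simp
    also have "\<dots> = \<sigma> * (LINT x:Q|lebesgue. G x * \<phi> x)"
    proof -
      have "(LINT x:Q|lebesgue. V x * partials [b] \<phi> x) = (-1) ^ length [b] * (LINT x:Q|lebesgue. G x * \<phi> x)"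
        using G tf unfolding weak_derivative_def by blast
      moreover have "(LINT x:Q|lebesgue. V x * partials [b] \<phi> x) = (LINT x|lebesgue. V x * partial b \<phi> x)"
        unfolding set_lebesgue_integral_def
      proof (rule Bochner_Integration.integral_cong[OF refl])
        fix x
        show "indicator Q x *\<^sub>R (V x * partials [b] \<phi> x) = V x * partial b \<phi> x"
        proof (cases "x \<in> Q")
          case False
          then have "x \<notin> cbox l u" using Q by blast
          then have "partial b \<phi> x = 0"
            by (rule partial_eq_0[OF smooth supp, rotated]) auto
          then show ?thesis by (simp add: partials_def)
        qed (simp add: partials_def)
      qed
      moreover have "\<dots> = (LINT x|lborel. V x * partial b \<phi> x)"
        using ibp(1) by (intro integral_completion) auto
      ultimately show ?thesis
        using ibp(3) by simp
    qed
    also have "\<dots> \<le> \<bar>LINT x:Q|lebesgue. G x * \<phi> x\<bar>"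
      using \<sigma> by (metis abs_ge_self abs_mult mult_1)
    finally have main: "c1 * c0 * A \<le> \<bar>LINT x:Q|lebesgue. G x * \<phi> x\<bar>" .
    have "ennreal \<bar>LINT x:Q|lebesgue. G x * \<phi> x\<bar> \<le> (\<integral>\<^sup>+x\<in>Q. ennreal \<bar>G x\<bar> \<partial>lebesgue)"
    \<comment> \<open>For a non-integrable product the integral is 0 by convention and the estimate
      is trivial.\<close>
    proof (cases "integrable lebesgue (\<lambda>x. indicator Q x *\<^sub>R (G x * \<phi> x))")
      case True
      then have "ennreal \<bar>LINT x:Q|lebesgue. G x * \<phi> x\<bar> \<le> (\<integral>\<^sup>+x. ennreal (norm (indicator Q x *\<^sub>R (G x * \<phi> x))) \<partial>lebesgue)"
        unfolding set_lebesgue_integral_def using integral_norm_bound_ennreal[OF True] by simp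
      also have "\<dots> \<le> (\<integral>\<^sup>+x\<in>Q. ennreal \<bar>G x\<bar> \<partial>lebesgue)"
        using \<phi>01 by (intro nn_integral_mono)
          (auto simp: indicator_def abs_mult intro!: ennreal_leI mult_right_le_one_le)
      finally show ?thesis .
    qed (simp add: set_lebesgue_integral_def not_integrable_integral_eq)
    then show "ennreal (c1 * c0 * A) \<le> (\<integral>\<^sup>+x\<in>Q. ennreal \<bar>G x\<bar> \<partial>lebesgue)"
      using ennreal_leI[OF main] by (rule order_trans[rotated])
  qed
qed

section \<open>Oscillations against a uniform Sobolev bound\<close>

lemma small_powr_exceeds:
  fixes a X :: real
  assumes "a < 0"
  obtains e where "0 < e" "\<And>\<epsilon>. 0 < \<epsilon> \<Longrightarrow> \<epsilon> < e \<Longrightarrow> X < \<epsilon> powr a"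
proof (rule that)
  define e where "e = (\<bar>X\<bar> + 1) powr (1 / a)"
  show "0 < (\<bar>X\<bar> + 1) powr (1 / a)" by (simp add: add_nonneg_pos)
  fix \<epsilon> :: real assume \<epsilon>: "0 < \<epsilon>" "\<epsilon> < (\<bar>X\<bar> + 1) powr (1 / a)"
  have "X < \<bar>X\<bar> + 1" by linarith
  also have "\<dots> = ((\<bar>X\<bar> + 1) powr (1 / a)) powr a"
    using assms by (simp add: powr_powr)
  also have "\<dots> \<le> \<epsilon> powr a"
    using \<epsilon> assms by (intro powr_mono2') auto
  finally show "X < \<epsilon> powr a" .
qed

lemma ennreal_rpow_leD:
  assumes "ennreal_rpow x (1 / p) \<le> ennreal c" and p: "1 \<le> p" and c: "0 \<le> c"
  shows "x \<le> ennreal (c powr p)"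
proof (cases "x = \<infinity>")
  case True
  then show ?thesis
    using assms(1) by (simp add: ennreal_rpow_def top_unique)
next
  case False
  then have "enn2real x powr (1 / p) \<le> c"
    using assms by (simp add: ennreal_rpow_def ennreal_le_iff)
  then have "(enn2real x powr (1 / p)) powr p \<le> c powr p"
    using p by (intro powr_mono2) auto
  then have "enn2real x \<le> c powr p"
    using p by (simp add: powr_powr)
  then have "ennreal (enn2real x) \<le> ennreal (c powr p)"
    by (rule ennreal_leI)
  moreover have "x = ennreal (enn2real x)"
    using False by (simp add: less_top)
  ultimately show ?thesis
    by metis
qed

text \<open>For s \<ge> 1 the list \<open>[b]\<close> is among the indices, so an almost minimising
  family contains a first weak derivative with bounded \<open>L\<^sup>p\<close> norm. The infimum
  need not be attained, whence \<open>C + 1\<close>. The passage to \<open>L\<^sup>1\<close> uses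
  \<bar>g\<bar> \<le> 1 + \<bar>g\<bar> powr p on a set of finite measure.\<close>

lemma sobolev_norm_first_derivative:
  fixes Q :: "'a::euclidean_space set"
  assumes s: "1 \<le> s" and p: "1 \<le> p" and le: "sobolev_norm s p Q V \<le> ennreal C" and C: "0 \<le> C"
    and b: "b \<in> Basis" and Q: "Q \<in> sets lebesgue" "emeasure lebesgue Q \<le> ennreal M" "0 \<le> M"
  obtains G where "weak_derivative Q [b] V G"
    and "(\<integral>\<^sup>+x\<in>Q. ennreal \<bar>G x\<bar> \<partial>lebesgue) \<le> ennreal (M + (C + 1) powr p)"
proof -
  define m where "m = nat \<lfloor>s\<rfloor>"
  define I where "I = {bs::'a list. set bs \<subseteq> Basis \<and> length bs \<le> m}"
  define J where "J = {bs::'a list. set bs \<subseteq> Basis \<and> length bs = m}"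
  define R where "R G = (if frac s = 0 then 0 else \<Sum>bs\<in>J. slobodeckij_seminorm (frac s) p Q (G bs))"
    for G :: "'a list \<Rightarrow> 'a \<Rightarrow> real"
  have "(INF G\<in>{G. \<forall>bs\<in>I. weak_derivative Q bs V (G bs)}. (\<Sum>bs\<in>I. Lp_norm p Q (G bs)) + R G) = sobolev_norm s p Q V"
    unfolding sobolev_norm_def Let_def m_def I_def J_def R_def using s by simp
  also have "\<dots> < ennreal (C + 1)"
    using le C by (intro le_less_trans[OF le]) (simp add: ennreal_less_iff)
  finally obtain G where G: "\<forall>bs\<in>I. weak_derivative Q bs V (G bs)"
      and less: "(\<Sum>bs\<in>I. Lp_norm p Q (G bs)) + R G < ennreal (C + 1)"
    unfolding INF_less_iff by blast
  have "1 \<le> m" using s by (simp add: m_def le_nat_floor)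
  then have bI: "[b] \<in> I" using b by (simp add: I_def)
  have "finite I" unfolding I_def by (rule finite_lists_length_le) simp
  then have "Lp_norm p Q (G [b]) \<le> (\<Sum>bs\<in>I. Lp_norm p Q (G bs))"
    using bI by (intro member_le_sum) auto
  also have "\<dots> \<le> (\<Sum>bs\<in>I. Lp_norm p Q (G bs)) + R G"
    by (rule add_increasing2) simp_all
  also have "\<dots> \<le> ennreal (C + 1)" using less by simp
  finally have Lp: "Lp_norm p Q (G [b]) \<le> ennreal (C + 1)" .
  \<comment> \<open>\<open>Lp_norm\<close> is infinite on non-measurable functions, so finiteness
    yields the measurability that splits the integral of a sum below.\<close>
  then have meas: "set_borel_measurable lebesgue Q (G [b])"
    by (auto simp: Lp_norm_def top_unique split: if_splits)
  with Lp have pow: "(\<integral>\<^sup>+x\<in>Q. ennreal (\<bar>G [b] x\<bar> powr p) \<partial>lebesgue) \<le> ennreal ((C + 1) powr p)"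
    using p C by (intro ennreal_rpow_leD) (simp_all add: Lp_norm_def)
  have "(\<integral>\<^sup>+x\<in>Q. ennreal \<bar>G [b] x\<bar> \<partial>lebesgue)
      \<le> (\<integral>\<^sup>+x. indicator Q x + ennreal (\<bar>G [b] x\<bar> powr p) * indicator Q x \<partial>lebesgue)"
  proof (rule nn_integral_mono)
    fix x
    have "\<bar>G [b] x\<bar> \<le> 1 + \<bar>G [b] x\<bar> powr p"
    proof (cases "\<bar>G [b] x\<bar> \<le> 1")
      case False
      then have "\<bar>G [b] x\<bar> powr 1 \<le> \<bar>G [b] x\<bar> powr p" using p by (intro powr_mono) auto
      then show ?thesis using False by simp
    qed (simp add: add_increasing2)
    then have "ennreal \<bar>G [b] x\<bar> \<le> 1 + ennreal (\<bar>G [b] x\<bar> powr p)"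
      by (metis ennreal_1 ennreal_leI ennreal_plus powr_ge_zero zero_le_one)
    then show "ennreal \<bar>G [b] x\<bar> * indicator Q x \<le> indicator Q x + ennreal (\<bar>G [b] x\<bar> powr p) * indicator Q x"
      by (auto simp: indicator_def)
  qed
  also have "(\<integral>\<^sup>+x. indicator Q x + ennreal (\<bar>G [b] x\<bar> powr p) * indicator Q x \<partial>lebesgue)
      = emeasure lebesgue Q + (\<integral>\<^sup>+x\<in>Q. ennreal (\<bar>G [b] x\<bar> powr p) \<partial>lebesgue)"
  proof -
    have "(\<lambda>x. ennreal (\<bar>indicator Q x *\<^sub>R G [b] x\<bar> powr p)) \<in> borel_measurable lebesgue"
      using meas unfolding set_borel_measurable_def by measurable
    moreover have "ennreal (\<bar>indicator Q x *\<^sub>R G [b] x\<bar> powr p) = ennreal (\<bar>G [b] x\<bar> powr p) * indicator Q x" for x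
      using p by (auto simp: indicator_def)
    ultimately have "(\<lambda>x. ennreal (\<bar>G [b] x\<bar> powr p) * indicator Q x) \<in> borel_measurable lebesgue"
      by (simp only:)
    then show ?thesis
      using Q(1) by (subst nn_integral_add) auto
  qed
  also have "\<dots> \<le> ennreal M + ennreal ((C + 1) powr p)"
    using Q(2) pow by (rule add_mono)
  finally show ?thesis
    using that[of "G [b]"] G bI Q(3) by (simp add: ennreal_plus[symmetric] del: ennreal_plus)
qed

text \<open>Stated for an abstract domain and phase vector, so that it serves both the time slice t
  = 0, where \<open>w\<close> is \<open>v\<close>, and a space-time box, where \<open>w\<close> has
  a time component.\<close>

lemma oscillations_unbounded_in_sobolev:
  fixes w l u b :: "'a::euclidean_space" and V :: "real \<Rightarrow> 'a \<Rightarrow> real" and V' :: "real \<Rightarrow> 'a \<Rightarrow> 'a \<Rightarrow> real"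
  assumes \<gamma>: "1 < \<gamma>" and p: "1 \<le> p" and s: "1 / \<gamma> < s"
    and Q: "open Q" "cbox l u \<subseteq> Q" "emeasure lebesgue Q \<le> ennreal M" "0 \<le> M"
    and ne: "box l u \<noteq> {}" and w: "w \<noteq> 0" and b: "b \<in> Basis"
    and \<eta>: "0 < \<eta>" "\<eta> < 1 / 2" and \<delta>: "0 < \<delta>" and \<sigma>: "\<bar>\<sigma>\<bar> = 1" and e0: "0 < e0" and C: "0 \<le> C"
    and osc: "\<And>\<epsilon> x y. \<epsilon> \<in> {0<..<e0} \<Longrightarrow> x \<in> box l u \<inter> stripes w (\<epsilon> powr (- \<gamma>)) \<theta>1 \<eta>
        \<Longrightarrow> y \<in> box l u \<inter> stripes w (\<epsilon> powr (- \<gamma>)) \<theta>2 \<eta> \<Longrightarrow> \<delta> * \<epsilon> \<le> \<bar>V \<epsilon> x - V \<epsilon> y\<bar>"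
    and V': "\<And>\<epsilon> x. \<epsilon> \<in> {0<..<e0} \<Longrightarrow> x \<in> Q \<Longrightarrow> (V \<epsilon> has_derivative V' \<epsilon> x) (at x)"
      "\<And>\<epsilon>. \<epsilon> \<in> {0<..<e0} \<Longrightarrow> continuous_on Q (\<lambda>x. V' \<epsilon> x b)"
    and slope: "\<And>\<epsilon> x. \<epsilon> \<in> {0<..<e0} \<Longrightarrow> x \<in> box l u \<inter> stripes w (\<epsilon> powr (- \<gamma>)) \<theta>1 \<eta>
        \<Longrightarrow> \<delta> * \<epsilon> powr (1 - \<gamma>) \<le> \<sigma> * V' \<epsilon> x b"
    and bound: "\<And>\<epsilon>. \<epsilon> \<in> {0<..<e0} \<Longrightarrow> sobolev_norm s p Q (V \<epsilon>) \<le> ennreal C"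
  shows False
proof (cases "s < 1")
  case True
  have s0: "0 < s" using s \<gamma> by (meson less_trans zero_less_divide_1_iff zero_less_one)
  obtain c \<Lambda> where c: "0 < c" "0 < \<Lambda>"
    and lower: "\<And>L A Q (V :: 'a \<Rightarrow> real). \<Lambda> \<le> L \<Longrightarrow> 0 < A \<Longrightarrow> box l u \<subseteq> Q
      \<Longrightarrow> (\<And>x y. x \<in> box l u \<inter> stripes w L \<theta>1 \<eta> \<Longrightarrow> y \<in> box l u \<inter> stripes w L \<theta>2 \<eta> \<Longrightarrow> A \<le> \<bar>V x - V y\<bar>)
      \<Longrightarrow> ennreal (c * A * L powr s) \<le> slobodeckij_seminorm s p Q V"
    using slobodeckij_seminorm_lower_bound[OF w ne \<eta>(1) p s0] by blast
  obtain e1 where e1: "0 < e1" "\<And>\<epsilon>. 0 < \<epsilon> \<Longrightarrow> \<epsilon> < e1 \<Longrightarrow> \<Lambda> < \<epsilon> powr (- \<gamma>)"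
    using small_powr_exceeds[of "- \<gamma>" \<Lambda>] \<gamma> by auto
  \<comment> \<open>This is where s > 1/\<gamma> enters: amplitude \<open>\<epsilon>\<close> times
    wave number to the power \<open>s\<close> now diverges.\<close>
  have "1 - \<gamma> * s < 0" using s \<gamma> by (simp add: field_simps)
  then obtain e2 where e2: "0 < e2" "\<And>\<epsilon>. 0 < \<epsilon> \<Longrightarrow> \<epsilon> < e2 \<Longrightarrow> C / (c * \<delta>) < \<epsilon> powr (1 - \<gamma> * s)"
    using small_powr_exceeds[of "1 - \<gamma> * s" "C / (c * \<delta>)"] by blast
  define \<epsilon> where "\<epsilon> = min e0 (min e1 e2) / 2"
  have \<epsilon>: "0 < \<epsilon>" "\<epsilon> < e0" "\<epsilon> < e1" "\<epsilon> < e2" using e0 e1 e2 by (auto simp: \<epsilon>_def min_def)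
  have "ennreal (c * (\<delta> * \<epsilon>) * (\<epsilon> powr (- \<gamma>)) powr s) \<le> slobodeckij_seminorm s p Q (V \<epsilon>)"
    using e1(2)[of \<epsilon>] \<epsilon> \<delta> Q(2) box_subset_cbox[of l u] osc[of \<epsilon>] by (intro lower) auto
  also have "\<dots> \<le> sobolev_norm s p Q (V \<epsilon>)"
    using True by (simp add: sobolev_norm_def)
  also have "\<dots> \<le> ennreal C" using \<epsilon> by (intro bound) auto
  finally have "c * (\<delta> * \<epsilon>) * (\<epsilon> powr (- \<gamma>)) powr s \<le> C"
    using C by (simp add: ennreal_le_iff)
  also have "c * (\<delta> * \<epsilon>) * (\<epsilon> powr (- \<gamma>)) powr s = c * \<delta> * \<epsilon> powr (1 - \<gamma> * s)"
    using \<epsilon>(1) powr_add[of \<epsilon> 1 "- (\<gamma> * s)"] by (simp add: powr_powr)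
  finally have "\<epsilon> powr (1 - \<gamma> * s) \<le> C / (c * \<delta>)"
    using c \<delta> by (simp add: field_simps)
  then show False using e2(2)[of \<epsilon>] \<epsilon> by simp
next
  case False
  then have s1: "1 \<le> s" by simp
  obtain c \<Lambda> where c: "0 < c" "0 < \<Lambda>"
    and lower: "\<And>L A Q (V :: 'a \<Rightarrow> real) V' b G \<sigma>. \<Lambda> \<le> L \<Longrightarrow> 0 \<le> A \<Longrightarrow> \<bar>\<sigma>\<bar> = 1 \<Longrightarrow> open Q \<Longrightarrow> cbox l u \<subseteq> Q
      \<Longrightarrow> (\<And>x. x \<in> Q \<Longrightarrow> (V has_derivative V' x) (at x)) \<Longrightarrow> continuous_on Q (\<lambda>x. V' x b)
      \<Longrightarrow> (\<And>x. x \<in> box l u \<inter> stripes w L \<theta>1 \<eta> \<Longrightarrow> A \<le> \<sigma> * V' x b)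
      \<Longrightarrow> weak_derivative Q [b] V G
      \<Longrightarrow> ennreal (c * A) \<le> (\<integral>\<^sup>+x\<in>Q. ennreal \<bar>G x\<bar> \<partial>lebesgue)"
    using weak_derivative_lower_bound[OF w ne \<eta>] by blast
  define D where "D = M + (C + 1) powr p"
  obtain e1 where e1: "0 < e1" "\<And>\<epsilon>. 0 < \<epsilon> \<Longrightarrow> \<epsilon> < e1 \<Longrightarrow> \<Lambda> < \<epsilon> powr (- \<gamma>)"
    using small_powr_exceeds[of "- \<gamma>" \<Lambda>] \<gamma> by auto
  obtain e2 where e2: "0 < e2" "\<And>\<epsilon>. 0 < \<epsilon> \<Longrightarrow> \<epsilon> < e2 \<Longrightarrow> D / (c * \<delta>) < \<epsilon> powr (1 - \<gamma>)"
    using small_powr_exceeds[of "1 - \<gamma>" "D / (c * \<delta>)"] \<gamma> by auto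
  define \<epsilon> where "\<epsilon> = min e0 (min e1 e2) / 2"
  have \<epsilon>: "0 < \<epsilon>" "\<epsilon> < e0" "\<epsilon> < e1" "\<epsilon> < e2" using e0 e1 e2 by (auto simp: \<epsilon>_def min_def)
  then have \<epsilon>0: "\<epsilon> \<in> {0<..<e0}" by simp
  have "Q \<in> sets lebesgue" using Q(1) by auto
  then obtain G where G: "weak_derivative Q [b] (V \<epsilon>) G"
    "(\<integral>\<^sup>+x\<in>Q. ennreal \<bar>G x\<bar> \<partial>lebesgue) \<le> ennreal D"
    unfolding D_def using sobolev_norm_first_derivative[OF s1 p bound[OF \<epsilon>0] C b _ Q(3,4)] by blast
  have "ennreal (c * (\<delta> * \<epsilon> powr (1 - \<gamma>))) \<le> (\<integral>\<^sup>+x\<in>Q. ennreal \<bar>G x\<bar> \<partial>lebesgue)"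
    by (rule lower[where V' = "V' \<epsilon>", OF _ _ \<sigma> Q(1,2) V'(1)[OF \<epsilon>0] V'(2)[OF \<epsilon>0] slope[OF \<epsilon>0] G(1)])
       (use e1(2)[of \<epsilon>] \<epsilon> \<delta> in auto)
  also have "\<dots> \<le> ennreal D" by (rule G(2))
  finally have "ennreal (c * (\<delta> * \<epsilon> powr (1 - \<gamma>))) \<le> ennreal D" .
  moreover have "0 \<le> D" using Q(4) by (simp add: D_def)
  ultimately have "c * (\<delta> * \<epsilon> powr (1 - \<gamma>)) \<le> D"
    by (simp only: ennreal_le_iff)
  then have "\<epsilon> powr (1 - \<gamma>) \<le> D / (c * \<delta>)"
    using c \<delta> by (simp add: field_simps)
  then show False using e2(2)[of \<epsilon>] \<epsilon> by simp
qed

section \<open>Oscillating families\<close>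

lemma vderiv_has_vector_derivative:
  assumes "Ck_real m f" "k < m"
  shows "(vderiv k f has_vector_derivative vderiv (Suc k) f x) (at x)"
proof -
  have "vderiv k f differentiable_on UNIV"
    using assms by (simp add: Ck_real_def)
  then have "vderiv k f differentiable (at x)"
    by (simp add: differentiable_on_def)
  then show ?thesis
    by (simp add: vector_derivative_works vderiv_def)
qed

lemma continuous_on_vderiv:
  assumes "Ck_real m f" "k < m"
  shows "continuous_on UNIV (vderiv k f)"
  using assms by (auto simp: Ck_real_def intro: differentiable_imp_continuous_on)

lemma open_cube: "open (cube z A)"
  by (simp add: cube_def open_box)

lemma mem_cube: "z \<in> cube z0 A \<longleftrightarrow> (\<forall>b\<in>Basis. \<bar>z \<bullet> b - z0 \<bullet> b\<bar> < A)"
  by (force simp: cube_def mem_box inner_add_left inner_diff_left abs_less_iff)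

lemma emeasure_cube_bound:
  assumes "Q \<subseteq> cube z A" "open Q"
  shows "emeasure lebesgue Q \<le> ennreal (measure lborel (cube z A))"
proof -
  have "emeasure lebesgue Q = emeasure lborel Q"
    using assms(2) by simp
  also have "\<dots> \<le> emeasure lborel (cube z A)"
    using assms by (intro emeasure_mono) (auto simp: cube_def)
  also have "\<dots> = ennreal (measure lborel (cube z A))"
    using emeasure_lborel_box_finite[of "z - A *\<^sub>R One" "z + A *\<^sub>R One"]
    unfolding cube_def by (intro emeasure_eq_ennreal_measure) auto
  finally show ?thesis .
qed

text \<open>The time derivative is bounded at interior times only; the mean value theorem asks for
  no more.\<close>

lemma C1_per_lipschitz:
  assumes T: "0 < T" and W: "C1_per T W"
    and Kx: "\<And>t \<theta>. t \<in> {0..T} \<Longrightarrow> \<bar>deriv_x W (t, \<theta>)\<bar> \<le> K"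
    and Kt: "\<And>t \<theta>. t \<in> {0<..<T} \<Longrightarrow> \<bar>deriv_t T W (t, \<theta>)\<bar> \<le> K"
    and t: "t \<in> {0..T}" "t' \<in> {0..T}"
  shows "\<bar>W (t, \<theta>) - W (t', \<theta>')\<bar> \<le> K * (\<bar>t - t'\<bar> + \<bar>\<theta> - \<theta>'\<bar>)"
proof -
  have K: "0 \<le> K" using Kx[OF t(1), of 0] by linarith
  have x: "\<bar>W (t, \<theta>) - W (t, \<theta>')\<bar> \<le> K * \<bar>\<theta> - \<theta>'\<bar>"
    using field_differentiable_bound[of UNIV "\<lambda>\<eta>. W (t, \<eta>)" "\<lambda>\<eta>. deriv_x W (t, \<eta>)" K \<theta> \<theta>']
      C1_per_derivatives(3)[OF T W, of "(t, _)"] Kx[OF t(1)] t(1) by auto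
  have *: "\<bar>W (s', \<theta>') - W (s, \<theta>')\<bar> \<le> K * \<bar>s' - s\<bar>" if s: "s \<in> {0..T}" "s' \<in> {0..T}" "s < s'" for s s'
  proof -
    have cont: "continuous_on {s..s'} (\<lambda>\<tau>. W (\<tau>, \<theta>'))"
      by (rule continuous_on_compose2[OF has_derivative_continuous_on[OF C1_per_derivatives(1)[OF T W]], where f = "\<lambda>\<tau>. (\<tau>, \<theta>')"])
         (use s in \<open>auto intro!: continuous_intros\<close>)
    have der: "((\<lambda>\<tau>. W (\<tau>, \<theta>')) has_derivative (*) (deriv_t T W (\<tau>, \<theta>'))) (at \<tau>)" if "s < \<tau>" "\<tau> < s'" for \<tau>
    proof -
      have "\<tau> \<in> interior {0..T}" using that s by simp
      then have "at \<tau> within {0..T} = at \<tau>" by (rule at_within_interior)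
      then show ?thesis
        using C1_per_derivatives(2)[OF T W, of "(\<tau>, \<theta>')"] that s
        by (simp add: has_field_derivative_def)
    qed
    obtain \<xi> where \<xi>: "s < \<xi>" "\<xi> < s'" "W (s', \<theta>') - W (s, \<theta>') = deriv_t T W (\<xi>, \<theta>') * (s' - s)"
      using mvt[OF s(3) cont der] by auto
    have "\<bar>deriv_t T W (\<xi>, \<theta>')\<bar> \<le> K" using \<xi> s by (intro Kt) auto
    then show ?thesis
      unfolding \<xi>(3) abs_mult by (rule mult_right_mono) simp
  qed
  have "\<bar>W (t, \<theta>') - W (t', \<theta>')\<bar> \<le> K * \<bar>t - t'\<bar>"
    using *[of t t'] *[of t' t] t by (cases t t' rule: linorder_cases) (auto simp: abs_minus_commute)
  with x show ?thesis
    by (simp add: distrib_left)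
qed

lemma wave_profile_has_derivative:
  fixes w :: "real \<times> 'b::euclidean_space"
  assumes T: "0 < T" and W: "C1_per T W" and z: "fst z \<in> {0<..<T}"
  shows "((\<lambda>z. ubar + \<epsilon> * W (fst z, L * (w \<bullet> z))) has_derivative
      (\<lambda>h. \<epsilon> * (fst h * deriv_t T W (fst z, L * (w \<bullet> z)) + L * (w \<bullet> h) * deriv_x W (fst z, L * (w \<bullet> z))))) (at z)"
proof -
  have "((\<lambda>z. (fst z, L * (w \<bullet> z))) has_derivative (\<lambda>h. (fst h, L * (w \<bullet> h)))) (at z)"
    by (auto intro!: derivative_eq_intros)
  from has_derivative_compose[OF this C1_per_has_derivative_at[OF T W z]]
  have "((\<lambda>z. W (fst z, L * (w \<bullet> z))) has_derivative
      (\<lambda>h. fst h * deriv_t T W (fst z, L * (w \<bullet> z)) + L * (w \<bullet> h) * deriv_x W (fst z, L * (w \<bullet> z)))) (at z)"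
    by (simp only: fst_conv snd_conv)
  then have "((\<lambda>z. ubar + \<epsilon> * W (fst z, L * (w \<bullet> z))) has_derivative
      (\<lambda>h. 0 + \<epsilon> * (fst h * deriv_t T W (fst z, L * (w \<bullet> z)) + L * (w \<bullet> h) * deriv_x W (fst z, L * (w \<bullet> z))))) (at z)"
    by (intro has_derivative_add has_derivative_const has_derivative_mult_right)
  then show ?thesis by simp
qed

text \<open>A nonconstant \<open>U0\<close> has a point \<open>\<theta>1\<close> of nonzero slope
  and a point \<open>\<theta>2\<close> with another value. The value gap survives for a short time
  by the uniform bound on time derivatives. The sign of the slope survives by continuity of the
  slope of \<open>U\<close> and, for small \<open>\<epsilon>\<close>, by \<open>C\<^sup>1\<close>
  convergence.\<close>

lemma nonconstant_profile:
  fixes W :: "real \<Rightarrow> real \<times> real \<Rightarrow> real"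
  assumes T: "0 < T"
    and W: "\<And>\<epsilon>. \<epsilon> \<in> {0<..1} \<Longrightarrow> C1_per T (W \<epsilon>)"
    and init: "\<And>\<epsilon> \<theta>. \<epsilon> \<in> {0<..1} \<Longrightarrow> W \<epsilon> (0, \<theta>) = U0 \<theta>"
    and U: "C1_per T U" "\<And>\<theta>. U (0, \<theta>) = U0 \<theta>"
    and Kx: "\<And>\<epsilon> t \<theta>. \<epsilon> \<in> {0<..1} \<Longrightarrow> t \<in> {0..T} \<Longrightarrow> \<bar>deriv_x (W \<epsilon>) (t, \<theta>)\<bar> \<le> K"
    and Kt: "\<And>\<epsilon> t \<theta>. \<epsilon> \<in> {0<..1} \<Longrightarrow> t \<in> {0<..<T} \<Longrightarrow> \<bar>deriv_t T (W \<epsilon>) (t, \<theta>)\<bar> \<le> K"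
    and K: "0 < K"
    and conv: "\<And>\<kappa>. 0 < \<kappa> \<Longrightarrow> \<exists>e>0. \<forall>\<epsilon>\<in>{0<..<e}. \<epsilon> \<le> 1 \<longrightarrow> C1_norm T (\<lambda>z. W \<epsilon> z - U z) \<le> \<kappa>"
    and nonconst: "\<not> U0 constant_on UNIV"
  obtains \<delta> \<tau> e0 \<eta> \<sigma> \<theta>1 \<theta>2 where "0 < \<delta>" "0 < \<tau>" "\<tau> \<le> T" "0 < e0" "e0 \<le> 1" "0 < \<eta>" "\<eta> < 1 / 2" "\<bar>\<sigma>\<bar> = 1"
    and "\<And>\<epsilon> t t' \<theta> \<theta>' k k'. \<epsilon> \<in> {0<..1} \<Longrightarrow> t \<in> {0..\<tau>} \<Longrightarrow> t' \<in> {0..\<tau>} \<Longrightarrow> \<bar>\<theta> - \<theta>1 - of_int k\<bar> \<le> \<eta>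
        \<Longrightarrow> \<bar>\<theta>' - \<theta>2 - of_int k'\<bar> \<le> \<eta> \<Longrightarrow> \<delta> \<le> \<bar>W \<epsilon> (t, \<theta>) - W \<epsilon> (t', \<theta>')\<bar>"
    and "\<And>\<epsilon> t \<theta> k. \<epsilon> \<in> {0<..<e0} \<Longrightarrow> t \<in> {0..\<tau>} \<Longrightarrow> \<bar>\<theta> - \<theta>1 - of_int k\<bar> \<le> \<eta>
        \<Longrightarrow> \<delta> \<le> \<sigma> * deriv_x (W \<epsilon>) (t, \<theta>)"
proof -
  let ?S = "{0..T} \<times> (UNIV :: real set)"
  have t0: "0 \<in> {0..T}" using T by simp
  have dU0: "(U0 has_real_derivative deriv_x U (0, \<theta>)) (at \<theta>)" for \<theta>
    using C1_per_derivatives(3)[OF T U(1), of "(0, \<theta>)"] t0 by (simp add: U(2))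
  have contU0: "isCont U0 \<theta>" for \<theta>
    using dU0 by (rule DERIV_isCont)
  have "\<exists>\<theta>1. deriv_x U (0, \<theta>1) \<noteq> 0"
  proof (rule ccontr)
    assume "\<nexists>\<theta>1. deriv_x U (0, \<theta>1) \<noteq> 0"
    then have "\<forall>\<theta>. (U0 has_real_derivative 0) (at \<theta>)" using dU0 by metis
    then have "U0 \<theta> = U0 0" for \<theta> by (rule DERIV_isconst_all)
    then show False using nonconst by (auto simp: constant_on_def)
  qed
  then obtain \<theta>1 where \<theta>1: "deriv_x U (0, \<theta>1) \<noteq> 0" ..
  obtain \<theta>2 where \<theta>2: "U0 \<theta>2 \<noteq> U0 \<theta>1"
    using nonconst unfolding constant_on_def by metis
  \<comment> \<open>Of the slope \<open>4 * \<kappa>\<close>, one \<open>\<kappa>\<close> is spent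
    on replacing \<open>W \<epsilon>\<close> by \<open>U\<close> and one on moving away from
    \<open>(0, \<theta>1)\<close>.\<close>
  define \<kappa> where "\<kappa> = \<bar>deriv_x U (0, \<theta>1)\<bar> / 4"
  define \<sigma> where "\<sigma> = sgn (deriv_x U (0, \<theta>1))"
  have \<kappa>: "0 < \<kappa>" "\<sigma> * deriv_x U (0, \<theta>1) = 4 * \<kappa>" and \<sigma>: "\<bar>\<sigma>\<bar> = 1"
    using \<theta>1 by (auto simp: \<kappa>_def \<sigma>_def sgn_if abs_if)
  \<comment> \<open>Of the gap \<open>5 * d\<close>, each of the two points costs \<open>d\<close>
    for its phase and \<open>d / 2\<close> for its time.\<close>
  define d where "d = \<bar>U0 \<theta>2 - U0 \<theta>1\<bar> / 5"
  have d: "0 < d" using \<theta>2 by (simp add: d_def)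
  have "(0, \<theta>1) \<in> ?S" using T by simp
  then obtain \<rho> where \<rho>: "0 < \<rho>" "\<And>z. z \<in> ?S \<Longrightarrow> dist z (0, \<theta>1) < \<rho> \<Longrightarrow> dist (deriv_x U z) (deriv_x U (0, \<theta>1)) < \<kappa>"
    using C1_per_derivatives(5)[OF T U(1) \<open>(0, \<theta>1) \<in> ?S\<close>] \<kappa>(1) unfolding continuous_on_iff by metis
  have "\<exists>\<rho>>0. \<forall>\<theta>. \<bar>\<theta> - \<theta>i\<bar> < \<rho> \<longrightarrow> \<bar>U0 \<theta> - U0 \<theta>i\<bar> < d" for \<theta>i
    using contU0[of \<theta>i] d unfolding continuous_at_eps_delta by (auto simp: dist_real_def)
  then obtain \<rho>1 \<rho>2 where \<rho>1: "0 < \<rho>1" "\<And>\<theta>. \<bar>\<theta> - \<theta>1\<bar> < \<rho>1 \<Longrightarrow> \<bar>U0 \<theta> - U0 \<theta>1\<bar> < d"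
    and \<rho>2: "0 < \<rho>2" "\<And>\<theta>. \<bar>\<theta> - \<theta>2\<bar> < \<rho>2 \<Longrightarrow> \<bar>U0 \<theta> - U0 \<theta>2\<bar> < d"
    by metis
  obtain e where e: "0 < e" "\<forall>\<epsilon>\<in>{0<..<e}. \<epsilon> \<le> 1 \<longrightarrow> C1_norm T (\<lambda>z. W \<epsilon> z - U z) \<le> \<kappa>"
    using conv[OF \<kappa>(1)] by blast
  \<comment> \<open>A third of \<open>\<rho>\<close> here and in \<open>\<tau>\<close> keeps phase
    and time errors together below \<open>\<rho>\<close>.\<close>
  define \<eta> where "\<eta> = min (min (\<rho> / 3) (1 / 4)) (min (\<rho>1 / 2) (\<rho>2 / 2))"
  define \<tau> where "\<tau> = min T (min (\<rho> / 3) (d / (2 * K)))"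
  define \<delta> where "\<delta> = min d \<kappa>"
  have \<eta>: "0 < \<eta>" "\<eta> < 1 / 2" "\<eta> \<le> \<rho> / 3" "\<eta> < \<rho>1" "\<eta> < \<rho>2"
    using \<rho>(1) \<rho>1(1) \<rho>2(1) by (auto simp: \<eta>_def min_def)
  have \<tau>: "0 < \<tau>" "\<tau> \<le> T" "\<tau> \<le> \<rho> / 3" "K * \<tau> \<le> d / 2"
  proof -
    show "0 < \<tau>" "\<tau> \<le> T" "\<tau> \<le> \<rho> / 3" using T \<rho>(1) d K by (auto simp: \<tau>_def)
    have "\<tau> \<le> d / (2 * K)" by (simp add: \<tau>_def)
    then show "K * \<tau> \<le> d / 2" using K by (simp add: field_simps)
  qed
  show ?thesis
  proof (rule that)
    show "0 < \<delta>" using d \<kappa> by (simp add: \<delta>_def)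
    show "0 < \<tau>" "\<tau> \<le> T" by fact+
    show "0 < min e 1" "min e 1 \<le> 1" using e(1) by simp_all
    show "0 < \<eta>" "\<eta> < 1 / 2" "\<bar>\<sigma>\<bar> = 1" by fact+
    fix \<epsilon> t \<theta> and k :: int
    assume t: "t \<in> {0..\<tau>}" and \<theta>: "\<bar>\<theta> - \<theta>1 - of_int k\<bar> \<le> \<eta>"
    have tT: "t \<in> {0..T}" using t \<tau> by auto
    {
      fix t' \<theta>' and k' :: int
      assume \<epsilon>: "\<epsilon> \<in> {0<..(1::real)}" and t': "t' \<in> {0..\<tau>}" and \<theta>': "\<bar>\<theta>' - \<theta>2 - of_int k'\<bar> \<le> \<eta>"
      have near0: "\<bar>W \<epsilon> (s, \<theta>) - U0 (\<theta> - of_int k)\<bar> \<le> d / 2" if s: "s \<in> {0..\<tau>}" for s \<theta> and k :: int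
      proof -
        have "W \<epsilon> (0, \<theta>) = U0 (\<theta> - of_int k)"
          using C1_per_periodic[OF T W[OF \<epsilon>] t0, of "\<theta> - of_int k" k] by (simp add: init[OF \<epsilon>])
        moreover have "\<bar>W \<epsilon> (s, \<theta>) - W \<epsilon> (0, \<theta>)\<bar> \<le> K * (\<bar>s - 0\<bar> + \<bar>\<theta> - \<theta>\<bar>)"
          by (rule C1_per_lipschitz[OF T W[OF \<epsilon>] Kx[OF \<epsilon>] Kt[OF \<epsilon>]]) (use s \<tau> in auto)
        moreover have "K * s \<le> K * \<tau>" using s K by simp
        ultimately show ?thesis using \<tau>(4) s by simp
      qed
      have "\<bar>U0 (\<theta> - of_int k) - U0 \<theta>1\<bar> < d" "\<bar>U0 (\<theta>' - of_int k') - U0 \<theta>2\<bar> < d"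
        using \<theta> \<theta>' \<eta> by (auto intro!: \<rho>1 \<rho>2)
      moreover have "\<bar>U0 \<theta>2 - U0 \<theta>1\<bar> = 5 * d" by (simp add: d_def)
      ultimately have "d \<le> \<bar>W \<epsilon> (t, \<theta>) - W \<epsilon> (t', \<theta>')\<bar>"
        using near0[OF t, of \<theta> k] near0[OF t', of \<theta>' k'] by linarith
      then show "\<delta> \<le> \<bar>W \<epsilon> (t, \<theta>) - W \<epsilon> (t', \<theta>')\<bar>"
        by (simp add: \<delta>_def)
    next
      assume "\<epsilon> \<in> {0<..<min e 1}"
      then have \<epsilon>: "\<epsilon> \<in> {0<..1}" "\<epsilon> \<in> {0<..<e}" by auto
      have "C1_norm T (\<lambda>z. W \<epsilon> z - U z) \<le> \<kappa>" using e(2) \<epsilon> by auto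
      then have 1: "\<bar>deriv_x (W \<epsilon>) (t, \<theta>) - deriv_x U (t, \<theta>)\<bar> \<le> \<kappa>"
        using C1_norm_bounds(3)[OF T C1_per_diff(1)[OF T W[OF \<epsilon>(1)] U(1)] tT, of \<theta>]
        unfolding C1_per_diff(3)[OF T W[OF \<epsilon>(1)] U(1) tT] by linarith
      have "dist (t, \<theta> - of_int k) (0, \<theta>1) \<le> \<bar>t\<bar> + \<bar>\<theta> - of_int k - \<theta>1\<bar>"
        using sqrt_sum_squares_le_sum_abs[of t "\<theta> - of_int k - \<theta>1"] by (simp add: dist_Pair_Pair dist_real_def)
      also have "\<dots> < \<rho>"
        using t \<theta> \<tau>(3) \<eta>(3) \<rho>(1) by auto
      finally have "\<bar>deriv_x U (t, \<theta> - of_int k) - deriv_x U (0, \<theta>1)\<bar> < \<kappa>"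
        using \<rho>(2)[of "(t, \<theta> - of_int k)"] tT by (simp add: dist_real_def)
      moreover have "deriv_x U (t, \<theta> - of_int k) = deriv_x U (t, \<theta>)"
        using deriv_x_periodic[OF T U(1) tT, of "\<theta> - of_int k" k] by simp
      ultimately have "\<bar>deriv_x (W \<epsilon>) (t, \<theta>) - deriv_x U (0, \<theta>1)\<bar> \<le> 2 * \<kappa>"
        using 1 by linarith
      then have "\<bar>\<sigma> * (deriv_x (W \<epsilon>) (t, \<theta>) - deriv_x U (0, \<theta>1))\<bar> \<le> 2 * \<kappa>"
        unfolding abs_mult \<sigma> by simp
      then have "\<kappa> \<le> \<sigma> * deriv_x (W \<epsilon>) (t, \<theta>)"
        using \<kappa> unfolding right_diff_distrib by linarith
      then show "\<delta> \<le> \<sigma> * deriv_x (W \<epsilon>) (t, \<theta>)"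
        by (simp add: \<delta>_def)
    }
  qed
qed

theorem theorem4p1:
  fixes \<gamma> T0 ubar b r :: real
    and q :: nat
    and F a :: "real \<Rightarrow> real ^ 'n"
    and v :: "real ^ 'n"
    and U0 :: "real \<Rightarrow> real"
    and u :: "real \<Rightarrow> real \<times> (real ^ 'n) \<Rightarrow> real"
    and Ueps :: "real \<Rightarrow> real \<times> real \<Rightarrow> real"
    and U :: "real \<times> real \<Rightarrow> real"
  assumes gamma: "\<gamma> > 1"
    and q: "real q - 1 < \<gamma>" "\<gamma> \<le> real q"
    and F: "Ck_real (q + 3) F"
    and a: "a = vderiv 1 F"
    and U0: "C1_on UNIV U0" "\<forall>\<theta>. U0 (\<theta> + 1) = U0 \<theta>"
    and v: "v \<noteq> 0" "\<forall>k\<in>{1..q - 1}. vderiv k a ubar \<bullet> v = 0"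
    and T0: "T0 > 0"
    and entropy: "\<forall>\<epsilon>\<in>{0<..1}.
          entropy_solution F (\<lambda>x. ubar + \<epsilon> * U0 (\<epsilon> powr (- \<gamma>) * (v \<bullet> x))) (u \<epsilon>)"
    and initial: "\<forall>\<epsilon>\<in>{0<..1}. \<forall>x. u \<epsilon> (0, x) = ubar + \<epsilon> * U0 (\<epsilon> powr (- \<gamma>) * (v \<bullet> x))"
    and u_C1: "\<forall>\<epsilon>\<in>{0<..1}. C1_on ({0..T0} \<times> UNIV) (u \<epsilon>)"
    and Ueps_C1: "\<forall>\<epsilon>\<in>{0<..1}. C1_per T0 (Ueps \<epsilon>)"
    and profile: "\<forall>\<epsilon>\<in>{0<..1}. \<forall>t\<in>{0..T0}. \<forall>x.
          u \<epsilon> (t, x) = ubar + \<epsilon> * Ueps \<epsilon> (t, \<epsilon> powr (- \<gamma>) * (v \<bullet> (x - t *\<^sub>R a ubar)))"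
    and b: "b = (if \<gamma> = real q then (vderiv q a ubar \<bullet> v) / fact (q + 1) else 0)"
    and U_C1: "C1_per T0 U"
    and U_pde: "\<forall>t\<in>{0..T0}. \<forall>\<theta>. \<exists>Ut Dflux.
          ((\<lambda>\<tau>. U (\<tau>, \<theta>)) has_real_derivative Ut) (at t within {0..T0}) \<and>
          ((\<lambda>\<eta>. U (t, \<eta>) ^ (q + 1)) has_real_derivative Dflux) (at \<theta>) \<and>
          Ut + b * Dflux = 0"
    and U_initial: "\<forall>\<theta>. U (0, \<theta>) = U0 \<theta>"
    and r: "r = (if \<gamma> = real q then 1 else real q - \<gamma>)"
    and convergence:
          "(\<lambda>\<epsilon>. C1_norm T0 (\<lambda>z. Ueps \<epsilon> z - U z)) \<in> O[at_right 0](\<lambda>\<epsilon>. \<epsilon> powr r)"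
  shows "\<forall>p\<ge>1.
      bounded_C0_Wloc {0<..1} T0 (1 / \<gamma>) p u \<and>
      bounded_Wloc_spacetime {0<..1} T0 (1 / \<gamma>) p u \<and>
      (\<not> U0 constant_on UNIV \<longrightarrow>
         (\<forall>s>1 / \<gamma>. \<not> bounded_C0_Wloc {0<..<1} T0 s p u \<and>
                   \<not> bounded_Wloc_spacetime {0<..<1} T0 s p u))"
proof -

  \<comment> \<open>Phase variable and equation of the profiles\<close>
  define S where "S = {0<..<T0} \<times> (UNIV :: (real ^ 'n) set)"
  have openS: "open S" by (simp add: S_def open_Times)
  define L where "L \<epsilon> = \<epsilon> powr (- \<gamma>)" for \<epsilon> :: real
  have L: "0 < L \<epsilon>" "\<epsilon> * L \<epsilon> = \<epsilon> powr (1 - \<gamma>)" "L \<epsilon> = 1 / \<epsilon> powr \<gamma>" if "0 < \<epsilon>" for \<epsilon>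
    using that powr_add[of \<epsilon> 1 "- \<gamma>"] by (simp_all add: L_def powr_minus_divide)
  \<comment> \<open>The phase v \<bullet> (x - t a(ubar)) is linear in space-time; \<open>w\<close>
    represents it.\<close>
  define w where "w = (- (v \<bullet> a ubar), v)"
  have w0: "w \<noteq> 0" using v(1) by (simp add: w_def zero_prod_def)
  have vv: "0 < v \<bullet> v" using v(1) by simp
  have a': "(a has_vector_derivative vderiv 2 F y) (at y)" for y
    unfolding a using vderiv_has_vector_derivative[OF F, of 1] by (simp add: numeral_2_eq_2)
  have F': "(F has_vector_derivative a y) (at y)" for y
    unfolding a using vderiv_has_vector_derivative[OF F, of 0] by (simp add: vderiv_def)
  have conta': "continuous_on UNIV (vderiv 2 F)"
    using continuous_on_vderiv[OF F, of 2] by simp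
  have conta: "continuous_on UNIV a"
    unfolding a using continuous_on_vderiv[OF F, of 1] by simp
  have t0: "0 \<in> {0..T0}" using T0 by simp
  have W: "C1_per T0 (Ueps \<epsilon>)" if "\<epsilon> \<in> {0<..1}" for \<epsilon>
    using Ueps_C1 that by blast
  have init: "Ueps \<epsilon> (0, \<theta>) = U0 \<theta>" if \<epsilon>: "\<epsilon> \<in> {0<..1}" for \<epsilon> \<theta>
  proof -
    \<comment> \<open>As \<open>v\<close> is nonzero every phase is attained, so data that agree as
      functions of \<open>x\<close> agree as profiles.\<close>
    define x where "x = (\<theta> / L \<epsilon> / (v \<bullet> v)) *\<^sub>R v"
    have "L \<epsilon> * (v \<bullet> x) = \<theta>"
      using L(1)[of \<epsilon>] \<epsilon> vv by (simp add: x_def)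
    moreover have "ubar + \<epsilon> * Ueps \<epsilon> (0, L \<epsilon> * (v \<bullet> (x - 0 *\<^sub>R a ubar))) = ubar + \<epsilon> * U0 (L \<epsilon> * (v \<bullet> x))"
      unfolding L_def using profile[rule_format, OF \<epsilon> t0, of x] initial[rule_format, OF \<epsilon>, of x] by (simp only:)
    ultimately show ?thesis using \<epsilon> by simp
  qed
  have u_eq: "u \<epsilon> z = ubar + \<epsilon> * Ueps \<epsilon> (fst z, L \<epsilon> * (w \<bullet> z))" if "\<epsilon> \<in> {0<..1}" "fst z \<in> {0..T0}" for \<epsilon> z
  proof -
    have "v \<bullet> (snd z - fst z *\<^sub>R a ubar) = w \<bullet> z"
      by (simp add: w_def inner_prod_def inner_diff_right)
    then show ?thesis
      using profile[rule_format, OF that, of "snd z"] by (simp add: L_def)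
  qed
  define V' where "V' \<epsilon> z h = \<epsilon> * (fst h * deriv_t T0 (Ueps \<epsilon>) (fst z, L \<epsilon> * (w \<bullet> z))
      + L \<epsilon> * (w \<bullet> h) * deriv_x (Ueps \<epsilon>) (fst z, L \<epsilon> * (w \<bullet> z)))" for \<epsilon> and z h :: "real \<times> (real ^ 'n)"
  have V': "(u \<epsilon> has_derivative V' \<epsilon> z) (at z)" if \<epsilon>: "\<epsilon> \<in> {0<..1}" and z: "z \<in> S" for \<epsilon> z
  proof -
    have "((\<lambda>z. ubar + \<epsilon> * Ueps \<epsilon> (fst z, L \<epsilon> * (w \<bullet> z))) has_derivative V' \<epsilon> z) (at z)"
      unfolding V'_def using z by (intro wave_profile_has_derivative[OF T0 W[OF \<epsilon>]]) (auto simp: S_def)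
    then show ?thesis
      by (rule has_derivative_transform_within_open[OF _ openS z])
         (rule u_eq[OF \<epsilon>, symmetric], auto simp: S_def)
  qed
  have pde: "deriv_t T0 (Ueps \<epsilon>) (t, \<theta>)
      + \<epsilon> powr (- \<gamma>) * ((a (ubar + \<epsilon> * Ueps \<epsilon> (t, \<theta>)) - a ubar) \<bullet> v) * deriv_x (Ueps \<epsilon>) (t, \<theta>) = 0"
    if \<epsilon>: "\<epsilon> \<in> {0<..1}" and t: "t \<in> {0<..<T0}" for \<epsilon> t \<theta>
  proof -
    obtain u' :: "real \<times> (real ^ 'n) \<Rightarrow> (real \<times> (real ^ 'n)) \<Rightarrow>\<^sub>L real"
      where u': "continuous_on ({0..T0} \<times> UNIV) u'"
        "\<And>z. z \<in> {0..T0} \<times> UNIV \<Longrightarrow> (u \<epsilon> has_derivative u' z) (at z within {0..T0} \<times> UNIV)"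
      using u_C1 \<epsilon> unfolding C1_on_def by blast
    have sub: "S \<subseteq> {0..T0} \<times> UNIV" and pos: "S \<subseteq> {0<..} \<times> UNIV" by (auto simp: S_def)
    have u'S: "(u \<epsilon> has_derivative u' z) (at z)" if "z \<in> S" for z
      using has_derivative_subset[OF u'(2)[OF subsetD[OF sub that]] sub]
      by (simp only: at_within_open[OF that openS])
    \<comment> \<open>A point at time \<open>t\<close> whose rescaled phase is
      \<open>\<theta>\<close>.\<close>
    define z where "z = (t, ((\<theta> / L \<epsilon> + t * (v \<bullet> a ubar)) / (v \<bullet> v)) *\<^sub>R v)"
    have z: "z \<in> S" using t by (simp add: z_def S_def)
    have "L \<epsilon> * (w \<bullet> z) = \<theta>"
      using L(1)[of \<epsilon>] \<epsilon> vv by (simp add: z_def w_def)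
    moreover have "fst z = t" by (simp add: z_def)
    moreover have "u' z (1, a (u \<epsilon> z)) = 0"
      by (rule entropy_solution_classical[OF entropy[rule_format, OF \<epsilon>] F' conta openS pos u'S
            continuous_on_subset[OF u'(1) sub] z])
    \<comment> \<open>\<open>u'\<close> comes from the regularity of the solution, \<open>V'\<close>
      from its wave form; at an interior point they coincide, which transfers the equation to the
      profile.\<close>
    then have "V' \<epsilon> z (1, a (u \<epsilon> z)) = 0"
      using has_derivative_unique[OF u'S[OF z] V'[OF \<epsilon> z]] by simp
    moreover have "u \<epsilon> z = ubar + \<epsilon> * Ueps \<epsilon> (fst z, L \<epsilon> * (w \<bullet> z))"
      using t by (intro u_eq[OF \<epsilon>]) (simp add: z_def)
    moreover have "w \<bullet> (1, y) = (y - a ubar) \<bullet> v" for y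
      by (simp add: w_def inner_diff_right inner_commute[of "y - a ubar" v])
    ultimately have "\<epsilon> * (deriv_t T0 (Ueps \<epsilon>) (t, \<theta>)
        + L \<epsilon> * ((a (ubar + \<epsilon> * Ueps \<epsilon> (t, \<theta>)) - a ubar) \<bullet> v) * deriv_x (Ueps \<epsilon>) (t, \<theta>)) = 0"
      by (simp only: V'_def fst_conv mult_1)
    then show ?thesis using \<epsilon> by (simp add: L_def)
  qed

  \<comment> \<open>Uniform bounds in \<open>\<epsilon>\<close>\<close>
  have r0: "0 < r" using q r by auto
  obtain c1 where c1: "0 < c1" "\<forall>\<^sub>F \<epsilon> in at_right 0. norm (C1_norm T0 (\<lambda>z. Ueps \<epsilon> z - U z)) \<le> c1 * norm (\<epsilon> powr r)"
    using convergence by (elim landau_o.bigE)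
  then obtain e1 where e1: "0 < e1" "\<And>\<epsilon>. 0 < \<epsilon> \<Longrightarrow> \<epsilon> < e1 \<Longrightarrow> C1_norm T0 (\<lambda>z. Ueps \<epsilon> z - U z) \<le> c1 * \<epsilon> powr r"
    unfolding eventually_at_right_field by force
  have conv: "\<exists>e>0. \<forall>\<epsilon>\<in>{0<..<e}. \<epsilon> \<le> 1 \<longrightarrow> C1_norm T0 (\<lambda>z. Ueps \<epsilon> z - U z) \<le> \<kappa>" if \<kappa>: "0 < \<kappa>" for \<kappa>
  proof (intro exI conjI ballI impI)
    show "0 < min e1 ((\<kappa> / c1) powr (1 / r))" using e1 c1 \<kappa> by simp
    fix \<epsilon> assume "\<epsilon> \<in> {0<..<min e1 ((\<kappa> / c1) powr (1 / r))}"
    then have \<epsilon>: "0 < \<epsilon>" "\<epsilon> < e1" "\<epsilon> < (\<kappa> / c1) powr (1 / r)" by auto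
    have "\<epsilon> powr r \<le> ((\<kappa> / c1) powr (1 / r)) powr r"
      using \<epsilon> r0 by (intro powr_mono2) auto
    also have "\<dots> = \<kappa> / c1" using r0 \<kappa> c1 by (simp add: powr_powr)
    finally have "c1 * \<epsilon> powr r \<le> \<kappa>" using c1 by (simp add: field_simps)
    then show "C1_norm T0 (\<lambda>z. Ueps \<epsilon> z - U z) \<le> \<kappa>" using e1(2)[OF \<epsilon>(1,2)] by linarith
  qed
  obtain e2 where e2: "0 < e2" "\<forall>\<epsilon>\<in>{0<..<e2}. \<epsilon> \<le> 1 \<longrightarrow> C1_norm T0 (\<lambda>z. Ueps \<epsilon> z - U z) \<le> 1"
    using conv[of 1] by auto
  obtain K where K: "0 < K"
    and K0: "\<And>\<epsilon> t \<theta>. \<epsilon> \<in> {0<..1} \<Longrightarrow> t \<in> {0..T0} \<Longrightarrow> \<bar>Ueps \<epsilon> (t, \<theta>)\<bar> \<le> K"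
    and Kx: "\<And>\<epsilon> t \<theta>. \<epsilon> \<in> {0<..1} \<Longrightarrow> t \<in> {0..T0} \<Longrightarrow> \<bar>deriv_x (Ueps \<epsilon>) (t, \<theta>)\<bar> \<le> K"
    and Kt: "\<And>\<epsilon> t \<theta>. \<epsilon> \<in> {0<..1} \<Longrightarrow> t \<in> {0<..<T0} \<Longrightarrow> \<bar>deriv_t T0 (Ueps \<epsilon>) (t, \<theta>)\<bar> \<le> K"
    by (rule profile_uniform_bounds[OF T0 a' conta' W init pde U_C1 e2(1), of 1]) (use e2(2) in auto)
  \<comment> \<open>One constant for the sup bound, the amplitude \<open>2 * K\<close> and the
    Lipschitz constants on time slices and in space-time.\<close>
  define M where "M = \<bar>ubar\<bar> + K * (3 + norm v + norm w)"
  have M0: "0 \<le> M" using K by (simp add: M_def)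
  have KM: "\<bar>ubar\<bar> + K \<le> M" "2 * K \<le> M" "K * norm v \<le> M" "K * (1 + norm w) \<le> M"
    using K abs_ge_zero[of ubar] mult_nonneg_nonneg[of K "norm v"] mult_nonneg_nonneg[of K "norm w"]
    unfolding M_def distrib_left by auto
  have u_bound: "\<bar>u \<epsilon> z\<bar> \<le> M" if \<epsilon>: "\<epsilon> \<in> {0<..1}" and z: "fst z \<in> {0..T0}" for \<epsilon> z
  proof -
    have "\<bar>\<epsilon> * Ueps \<epsilon> (fst z, L \<epsilon> * (w \<bullet> z))\<bar> \<le> 1 * K"
      unfolding abs_mult using \<epsilon> by (intro mult_mono K0[OF \<epsilon> z]) auto
    then show ?thesis unfolding u_eq[OF that] using KM(1) by linarith
  qed
  have u_far: "\<bar>u \<epsilon> z - u \<epsilon> z'\<bar> \<le> M * \<epsilon>"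
    if \<epsilon>: "\<epsilon> \<in> {0<..1}" and z: "fst z \<in> {0..T0}" "fst z' \<in> {0..T0}" for \<epsilon> z z'
  proof -
    have "u \<epsilon> z - u \<epsilon> z' = \<epsilon> * (Ueps \<epsilon> (fst z, L \<epsilon> * (w \<bullet> z)) - Ueps \<epsilon> (fst z', L \<epsilon> * (w \<bullet> z')))"
      unfolding u_eq[OF \<epsilon> z(1)] u_eq[OF \<epsilon> z(2)] by (simp add: algebra_simps)
    also have "\<bar>\<dots>\<bar> \<le> \<epsilon> * (2 * K)"
      unfolding abs_mult using \<epsilon> K0[OF \<epsilon> z(1), of "L \<epsilon> * (w \<bullet> z)"] K0[OF \<epsilon> z(2), of "L \<epsilon> * (w \<bullet> z')"]
      by (intro mult_mono) auto
    also have "\<dots> \<le> \<epsilon> * M" using \<epsilon> KM by (intro mult_left_mono) auto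
    finally show ?thesis by (simp add: mult.commute)
  qed
  have u_lip: "\<bar>u \<epsilon> z - u \<epsilon> z'\<bar> \<le> \<epsilon> * (K * (\<bar>fst z - fst z'\<bar> + L \<epsilon> * \<bar>w \<bullet> (z - z')\<bar>))"
    if \<epsilon>: "\<epsilon> \<in> {0<..1}" and z: "fst z \<in> {0..T0}" "fst z' \<in> {0..T0}" for \<epsilon> z z'
  proof -
    have e: "u \<epsilon> z - u \<epsilon> z' = \<epsilon> * (Ueps \<epsilon> (fst z, L \<epsilon> * (w \<bullet> z)) - Ueps \<epsilon> (fst z', L \<epsilon> * (w \<bullet> z')))"
      unfolding u_eq[OF \<epsilon> z(1)] u_eq[OF \<epsilon> z(2)] by (simp add: algebra_simps)
    have "\<bar>L \<epsilon> * (w \<bullet> z) - L \<epsilon> * (w \<bullet> z')\<bar> = L \<epsilon> * \<bar>w \<bullet> (z - z')\<bar>"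
      using L(1)[of \<epsilon>] \<epsilon> by (simp add: inner_diff_right right_diff_distrib[symmetric] abs_mult)
    then have "\<bar>Ueps \<epsilon> (fst z, L \<epsilon> * (w \<bullet> z)) - Ueps \<epsilon> (fst z', L \<epsilon> * (w \<bullet> z'))\<bar>
        \<le> K * (\<bar>fst z - fst z'\<bar> + L \<epsilon> * \<bar>w \<bullet> (z - z')\<bar>)"
      using C1_per_lipschitz[OF T0 W[OF \<epsilon>] Kx[OF \<epsilon>] Kt[OF \<epsilon>] z, of "L \<epsilon> * (w \<bullet> z)" "L \<epsilon> * (w \<bullet> z')"] by simp
    then show ?thesis
      unfolding e abs_mult using \<epsilon> by (simp add: mult_left_mono)
  qed
  have contu: "continuous_on ({0..T0} \<times> UNIV) (u \<epsilon>)" if "\<epsilon> \<in> {0<..1}" for \<epsilon>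
  proof -
    have "C1_on ({0..T0} \<times> UNIV) (u \<epsilon>)" using u_C1 that by blast
    then obtain u' :: "real \<times> (real ^ 'n) \<Rightarrow> (real \<times> (real ^ 'n)) \<Rightarrow>\<^sub>L real"
      where "\<forall>z\<in>{0..T0} \<times> UNIV. (u \<epsilon> has_derivative u' z) (at z within {0..T0} \<times> UNIV)"
      unfolding C1_on_def by blast
    then show ?thesis
      by (intro has_derivative_continuous_on) (rule bspec)
  qed
  \<comment> \<open>Merges the amplitude bound and the Lipschitz bound into the truncated form
    required by the kernel estimate.\<close>
  have osc_min: "X \<le> M * \<epsilon> * min 1 (d / \<epsilon> powr \<gamma>)"
    if "X \<le> M * \<epsilon>" "X \<le> \<epsilon> * (M * (L \<epsilon> * d))" "0 < \<epsilon>" for X \<epsilon> d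
    using that L(3)[of \<epsilon>] by (auto simp: min_def mult_ac)

  \<comment> \<open>Boundedness for the exponent 1/\<gamma>\<close>
  have bounded1: "bounded_C0_Wloc {0<..1} T0 (1 / \<gamma>) p u" if p: "1 \<le> p" for p
    unfolding bounded_C0_Wloc_def
  proof
    fix x0 :: "real ^ 'n"
    define m where "m = measure lborel (cube x0 1)"
    have "0 \<le> m" by (simp add: m_def)
    then obtain C where C: "0 \<le> C"
      and le: "\<And>Q (V :: real ^ 'n \<Rightarrow> real) \<epsilon>. 0 < \<epsilon> \<Longrightarrow> open Q \<Longrightarrow> continuous_on Q V \<Longrightarrow> emeasure lebesgue Q \<le> ennreal m
      \<Longrightarrow> (\<And>x. x \<in> Q \<Longrightarrow> \<bar>V x\<bar> \<le> M)
      \<Longrightarrow> (\<And>x y. x \<in> Q \<Longrightarrow> y \<in> Q \<Longrightarrow> \<bar>V x - V y\<bar> \<le> M * \<epsilon> * min 1 (norm (x - y) / \<epsilon> powr \<gamma>))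
      \<Longrightarrow> sobolev_norm (1 / \<gamma>) p Q V \<le> ennreal C"
      using sobolev_norm_oscillation_bound[OF gamma p _ M0] by blast
    have "sobolev_norm (1 / \<gamma>) p (cube x0 1) (\<lambda>x. u \<epsilon> (t, x)) \<le> ennreal C"
      if \<epsilon>: "\<epsilon> \<in> {0<..1}" and t: "t \<in> {0..T0}" for \<epsilon> t
    proof (rule le)
      show "0 < \<epsilon>" using \<epsilon> by simp
      show "continuous_on (cube x0 1) (\<lambda>x. u \<epsilon> (t, x))"
        by (rule continuous_on_compose2[OF contu[OF \<epsilon>]]) (use t in \<open>auto intro!: continuous_intros\<close>)
      show "emeasure lebesgue (cube x0 1) \<le> ennreal m"
        unfolding m_def by (rule emeasure_cube_bound) (auto simp: open_cube)
      show "\<bar>u \<epsilon> (t, x)\<bar> \<le> M" for x by (rule u_bound[OF \<epsilon>]) (use t in simp)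
      fix x y
      have "\<bar>u \<epsilon> (t, x) - u \<epsilon> (t, y)\<bar> \<le> \<epsilon> * (K * (L \<epsilon> * \<bar>v \<bullet> (x - y)\<bar>))"
        using u_lip[OF \<epsilon>, of "(t, x)" "(t, y)"] t by (simp add: w_def)
      also have "\<dots> \<le> \<epsilon> * (K * (L \<epsilon> * (norm v * norm (x - y))))"
        using \<epsilon> K L(1)[of \<epsilon>] by (intro mult_left_mono Cauchy_Schwarz_ineq2) auto
      also have "\<dots> = \<epsilon> * (K * norm v * (L \<epsilon> * norm (x - y)))" by (simp add: mult_ac)
      also have "\<dots> \<le> \<epsilon> * (M * (L \<epsilon> * norm (x - y)))"
        using \<epsilon> KM(3) L(1)[of \<epsilon>] by (intro mult_left_mono mult_right_mono) auto
      finally show "\<bar>u \<epsilon> (t, x) - u \<epsilon> (t, y)\<bar> \<le> M * \<epsilon> * min 1 (norm (x - y) / \<epsilon> powr \<gamma>)"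
        using u_far[OF \<epsilon>, of "(t, x)" "(t, y)"] t \<epsilon> by (intro osc_min) auto
    qed (rule open_cube)
    then show "\<exists>A>0. \<exists>C\<ge>0. \<forall>\<epsilon>\<in>{0<..1}. \<forall>t\<in>{0..T0}.
        sobolev_norm (1 / \<gamma>) p (cube x0 A) (\<lambda>x. u \<epsilon> (t, x)) \<le> ennreal C"
      using C zero_less_one by blast
  qed
  have bounded2: "bounded_Wloc_spacetime {0<..1} T0 (1 / \<gamma>) p u" if p: "1 \<le> p" for p
    unfolding bounded_Wloc_spacetime_def
  proof
    fix z0 :: "real \<times> (real ^ 'n)"
    define m where "m = measure lborel (cube z0 1)"
    have "0 \<le> m" by (simp add: m_def)
    then obtain C where C: "0 \<le> C"
      and le: "\<And>Q (V :: real \<times> (real ^ 'n) \<Rightarrow> real) \<epsilon>. 0 < \<epsilon> \<Longrightarrow> open Q \<Longrightarrow> continuous_on Q V \<Longrightarrow> emeasure lebesgue Q \<le> ennreal m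
      \<Longrightarrow> (\<And>x. x \<in> Q \<Longrightarrow> \<bar>V x\<bar> \<le> M)
      \<Longrightarrow> (\<And>x y. x \<in> Q \<Longrightarrow> y \<in> Q \<Longrightarrow> \<bar>V x - V y\<bar> \<le> M * \<epsilon> * min 1 (norm (x - y) / \<epsilon> powr \<gamma>))
      \<Longrightarrow> sobolev_norm (1 / \<gamma>) p Q V \<le> ennreal C"
      using sobolev_norm_oscillation_bound[OF gamma p _ M0] by blast
    have "sobolev_norm (1 / \<gamma>) p (cube z0 1 \<inter> S) (u \<epsilon>) \<le> ennreal C"
      if \<epsilon>: "\<epsilon> \<in> {0<..1}" for \<epsilon>
    proof (rule le)
      show "0 < \<epsilon>" using \<epsilon> by simp
      show op: "open (cube z0 1 \<inter> S)" by (intro open_Int open_cube openS)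
      show "continuous_on (cube z0 1 \<inter> S) (u \<epsilon>)"
        by (rule continuous_on_subset[OF contu[OF \<epsilon>]]) (auto simp: S_def)
      show "emeasure lebesgue (cube z0 1 \<inter> S) \<le> ennreal m"
        unfolding m_def by (rule emeasure_cube_bound[OF _ op]) auto
      show "\<bar>u \<epsilon> z\<bar> \<le> M" if "z \<in> cube z0 1 \<inter> S" for z
        by (rule u_bound[OF \<epsilon>]) (use that in \<open>auto simp: S_def\<close>)
      fix x y assume "x \<in> cube z0 1 \<inter> S" "y \<in> cube z0 1 \<inter> S"
      then have xy: "fst x \<in> {0..T0}" "fst y \<in> {0..T0}" by (auto simp: S_def)
      \<comment> \<open>Hence L \<ge> 1, so the slow time variation is absorbed by the fast phase
        variation.\<close>
      have "\<epsilon> powr \<gamma> \<le> 1"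
        using \<epsilon> gamma powr_mono2[of \<gamma> \<epsilon> 1] by simp
      then have L1: "1 \<le> L \<epsilon>" using \<epsilon> by (simp add: L(3))
      have "\<bar>fst x - fst y\<bar> \<le> norm (x - y)"
        by (metis fst_diff norm_fst_le prod.collapse real_norm_def)
      also have "\<dots> \<le> L \<epsilon> * norm (x - y)"
        using mult_right_mono[OF L1, of "norm (x - y)"] by simp
      finally have fst_le: "\<bar>fst x - fst y\<bar> \<le> L \<epsilon> * norm (x - y)" .
      have "\<bar>u \<epsilon> x - u \<epsilon> y\<bar> \<le> \<epsilon> * (K * (\<bar>fst x - fst y\<bar> + L \<epsilon> * \<bar>w \<bullet> (x - y)\<bar>))"
        by (rule u_lip[OF \<epsilon> xy])
      also have "\<dots> \<le> \<epsilon> * (K * (L \<epsilon> * norm (x - y) + L \<epsilon> * (norm w * norm (x - y))))"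
        using \<epsilon> K L(1)[of \<epsilon>] fst_le by (intro mult_left_mono add_mono Cauchy_Schwarz_ineq2) auto
      also have "\<dots> = \<epsilon> * (K * (1 + norm w) * (L \<epsilon> * norm (x - y)))" by (simp add: algebra_simps)
      also have "\<dots> \<le> \<epsilon> * (M * (L \<epsilon> * norm (x - y)))"
        using \<epsilon> KM(4) L(1)[of \<epsilon>] by (intro mult_left_mono mult_right_mono) auto
      finally show "\<bar>u \<epsilon> x - u \<epsilon> y\<bar> \<le> M * \<epsilon> * min 1 (norm (x - y) / \<epsilon> powr \<gamma>)"
        using u_far[OF \<epsilon> xy] \<epsilon> by (intro osc_min) auto
    qed
    then show "\<exists>A>0. \<exists>C\<ge>0. \<forall>\<epsilon>\<in>{0<..1}.
        sobolev_norm (1 / \<gamma>) p (cube z0 A \<inter> {0<..<T0} \<times> UNIV) (u \<epsilon>) \<le> ennreal C"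
      using C zero_less_one unfolding S_def by blast
  qed

  \<comment> \<open>Unboundedness for larger exponents\<close>
  have unbounded: "\<not> bounded_C0_Wloc {0<..<1} T0 s p u \<and> \<not> bounded_Wloc_spacetime {0<..<1} T0 s p u"
    if p: "1 \<le> p" and nonconst: "\<not> U0 constant_on UNIV" and s: "1 / \<gamma> < s" for p s
  proof -
    obtain \<delta> \<tau> e0 \<eta> \<sigma> \<theta>1 \<theta>2 where \<delta>: "0 < \<delta>" and \<tau>: "0 < \<tau>" "\<tau> \<le> T0" and e0: "0 < e0" "e0 \<le> 1"
      and \<eta>: "0 < \<eta>" "\<eta> < 1 / 2" and \<sigma>: "\<bar>\<sigma>\<bar> = 1"
      and osc: "\<And>\<epsilon> t t' \<theta> \<theta>' k k'. \<epsilon> \<in> {0<..1} \<Longrightarrow> t \<in> {0..\<tau>} \<Longrightarrow> t' \<in> {0..\<tau>} \<Longrightarrow> \<bar>\<theta> - \<theta>1 - of_int k\<bar> \<le> \<eta>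
        \<Longrightarrow> \<bar>\<theta>' - \<theta>2 - of_int k'\<bar> \<le> \<eta> \<Longrightarrow> \<delta> \<le> \<bar>Ueps \<epsilon> (t, \<theta>) - Ueps \<epsilon> (t', \<theta>')\<bar>"
      and slope: "\<And>\<epsilon> t \<theta> k. \<epsilon> \<in> {0<..<e0} \<Longrightarrow> t \<in> {0..\<tau>} \<Longrightarrow> \<bar>\<theta> - \<theta>1 - of_int k\<bar> \<le> \<eta>
        \<Longrightarrow> \<delta> \<le> \<sigma> * deriv_x (Ueps \<epsilon>) (t, \<theta>)"
      by (rule nonconstant_profile[OF T0 W init U_C1 U_initial[rule_format] Kx Kt K conv nonconst]) blast+
    \<comment> \<open>Weak derivatives are taken along basis vectors, so one not orthogonal to
      \<open>v\<close> is chosen.\<close>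
    obtain b where b: "b \<in> Basis" "v \<bullet> b \<noteq> 0"
      using v(1) by (metis euclidean_all_zero_iff)
    \<comment> \<open>The entry 1 serves the value gap; the entry \<bar>v \<bullet> b\<bar> serves
      the slope along \<open>b\<close>, whose sign goes into \<open>\<sigma>'\<close>.\<close>
    define \<delta>' where "\<delta>' = \<delta> * min 1 \<bar>v \<bullet> b\<bar>"
    define \<sigma>' where "\<sigma>' = \<sigma> * sgn (v \<bullet> b)"
    have \<delta>': "0 < \<delta>'" "\<delta>' \<le> \<delta>" "\<delta>' \<le> \<bar>v \<bullet> b\<bar> * \<delta>" and \<sigma>': "\<bar>\<sigma>'\<bar> = 1"
      using \<delta> b \<sigma> by (auto simp: \<delta>'_def \<sigma>'_def abs_mult abs_sgn_eq min_def mult.commute)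
    have slope': "\<delta>' * \<epsilon> powr (1 - \<gamma>) \<le> \<sigma>' * (\<epsilon> * (L \<epsilon> * (v \<bullet> b) * D))"
      if "\<delta> \<le> \<sigma> * D" "0 < \<epsilon>" for D \<epsilon>
    proof -
      have "\<delta>' \<le> \<bar>v \<bullet> b\<bar> * (\<sigma> * D)"
        using \<delta>'(3) mult_left_mono[OF that(1), of "\<bar>v \<bullet> b\<bar>"] by linarith
      then have "\<delta>' * \<epsilon> powr (1 - \<gamma>) \<le> \<bar>v \<bullet> b\<bar> * (\<sigma> * D) * \<epsilon> powr (1 - \<gamma>)"
        by (rule mult_right_mono) simp
      also have "\<dots> = \<sigma>' * (\<epsilon> * L \<epsilon> * (v \<bullet> b) * D)"
        unfolding L(2)[OF that(2)] by (simp add: \<sigma>'_def abs_sgn mult_ac)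
      finally show ?thesis by (simp add: mult_ac)
    qed
    have osc': "\<delta>' * \<epsilon> \<le> \<bar>u \<epsilon> z - u \<epsilon> z'\<bar>"
      if \<epsilon>: "\<epsilon> \<in> {0<..<e0}" and z: "fst z \<in> {0..\<tau>}" "fst z' \<in> {0..\<tau>}"
        and st: "z \<in> stripes w (L \<epsilon>) \<theta>1 \<eta>" "z' \<in> stripes w (L \<epsilon>) \<theta>2 \<eta>" for \<epsilon> z z'
    proof -
      have \<epsilon>1: "\<epsilon> \<in> {0<..1}" and zT: "fst z \<in> {0..T0}" "fst z' \<in> {0..T0}" using \<epsilon> e0 z \<tau> by auto
      obtain k k' :: int where k: "\<bar>L \<epsilon> * (w \<bullet> z) - \<theta>1 - of_int k\<bar> \<le> \<eta>" "\<bar>L \<epsilon> * (w \<bullet> z') - \<theta>2 - of_int k'\<bar> \<le> \<eta>"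
        using st by (auto simp: stripes_def)
      have "u \<epsilon> z - u \<epsilon> z' = \<epsilon> * (Ueps \<epsilon> (fst z, L \<epsilon> * (w \<bullet> z)) - Ueps \<epsilon> (fst z', L \<epsilon> * (w \<bullet> z')))"
        unfolding u_eq[OF \<epsilon>1 zT(1)] u_eq[OF \<epsilon>1 zT(2)] by (simp add: algebra_simps)
      then have "\<bar>u \<epsilon> z - u \<epsilon> z'\<bar> = \<bar>Ueps \<epsilon> (fst z, L \<epsilon> * (w \<bullet> z)) - Ueps \<epsilon> (fst z', L \<epsilon> * (w \<bullet> z'))\<bar> * \<epsilon>"
        using \<epsilon> by (simp add: abs_mult)
      moreover have "\<delta>' \<le> \<bar>Ueps \<epsilon> (fst z, L \<epsilon> * (w \<bullet> z)) - Ueps \<epsilon> (fst z', L \<epsilon> * (w \<bullet> z'))\<bar>"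
        using osc[OF \<epsilon>1 z k] \<delta>'(2) by linarith
      ultimately show ?thesis
        using \<epsilon> by (simp add: mult_right_mono)
    qed
    \<comment> \<open>The single time t = 0 and a single centre already give the
      contradiction.\<close>
    have "\<not> bounded_C0_Wloc {0<..<1} T0 s p u"
    proof
      assume "bounded_C0_Wloc {0<..<1} T0 s p u"
      then obtain A C where A: "0 < A" and C: "0 \<le> C"
        and le: "\<And>\<epsilon>. \<epsilon> \<in> {0<..<1} \<Longrightarrow> sobolev_norm s p (cube 0 A) (\<lambda>x. u \<epsilon> (0, x)) \<le> ennreal C"
        unfolding bounded_C0_Wloc_def using t0 by metis
      define l r :: "real ^ 'n" where "l = - ((A / 2) *\<^sub>R One)" and "r = (A / 2) *\<^sub>R One"
      show False
      proof (rule oscillations_unbounded_in_sobolev[where Q = "cube 0 A" and l = l and u = r and w = v and b = b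
            and V = "\<lambda>\<epsilon> x. u \<epsilon> (0, x)" and \<eta> = \<eta> and \<delta> = \<delta>' and \<sigma> = \<sigma>' and ?e0.0 = e0 and C = C
            and V' = "\<lambda>\<epsilon> x h. \<epsilon> * (L \<epsilon> * (v \<bullet> h) * deriv_x (Ueps \<epsilon>) (0, L \<epsilon> * (v \<bullet> x)))"
            and M = "measure lborel (cube (0 :: real ^ 'n) A)" and ?\<theta>1.0 = \<theta>1 and ?\<theta>2.0 = \<theta>2,
            OF gamma p s open_cube _ _ _ _ v(1) b(1) \<eta> \<delta>'(1) \<sigma>' e0(1) C])
        show "cbox l r \<subseteq> cube 0 A"
          using A by (force simp: mem_cube mem_box l_def r_def)
        show "emeasure lebesgue (cube (0 :: real ^ 'n) A) \<le> ennreal (measure lborel (cube (0 :: real ^ 'n) A))"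
          by (rule emeasure_cube_bound) (auto simp: open_cube)
        show "box l r \<noteq> {}" using A by (auto simp: box_ne_empty l_def r_def)
        fix \<epsilon> assume \<epsilon>: "\<epsilon> \<in> {0<..<e0}"
        then have \<epsilon>1: "\<epsilon> \<in> {0<..1}" "\<epsilon> \<in> {0<..<1}" using e0 by auto
        show "sobolev_norm s p (cube 0 A) (\<lambda>x. u \<epsilon> (0, x)) \<le> ennreal C" by (rule le[OF \<epsilon>1(2)])
        have w0x: "w \<bullet> (0, x) = v \<bullet> x" for x by (simp add: w_def)
        have st: "(0, x) \<in> stripes w (L \<epsilon>) \<theta> \<eta>" if "x \<in> stripes v (\<epsilon> powr (- \<gamma>)) \<theta> \<eta>" for x \<theta>
          using that by (simp add: stripes_def w0x L_def)
        show "\<delta>' * \<epsilon> \<le> \<bar>u \<epsilon> (0, x) - u \<epsilon> (0, y)\<bar>"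
          if "x \<in> box l r \<inter> stripes v (\<epsilon> powr (- \<gamma>)) \<theta>1 \<eta>" "y \<in> box l r \<inter> stripes v (\<epsilon> powr (- \<gamma>)) \<theta>2 \<eta>" for x y
          using that \<tau> by (intro osc'[OF \<epsilon>]) (auto intro: st)
        have d0: "((\<lambda>\<eta>. Ueps \<epsilon> (0, \<eta>)) has_derivative (\<lambda>h. h * deriv_x (Ueps \<epsilon>) (0, \<theta>))) (at \<theta>)" for \<theta>
          using C1_per_derivatives(3)[OF T0 W[OF \<epsilon>1(1)], of "(0, \<theta>)"] t0
          by (simp add: has_field_derivative_def mult_commute_abs)
        show "((\<lambda>x. u \<epsilon> (0, x)) has_derivative
            (\<lambda>h. \<epsilon> * (L \<epsilon> * (v \<bullet> h) * deriv_x (Ueps \<epsilon>) (0, L \<epsilon> * (v \<bullet> x))))) (at x)" for x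
        proof -
          have "((\<lambda>x. L \<epsilon> * (v \<bullet> x)) has_derivative (\<lambda>h. L \<epsilon> * (v \<bullet> h))) (at x)"
            by (auto intro!: derivative_eq_intros)
          from has_derivative_compose[OF this d0]
          have "((\<lambda>x. ubar + \<epsilon> * Ueps \<epsilon> (0, L \<epsilon> * (v \<bullet> x))) has_derivative
              (\<lambda>h. 0 + \<epsilon> * (L \<epsilon> * (v \<bullet> h) * deriv_x (Ueps \<epsilon>) (0, L \<epsilon> * (v \<bullet> x))))) (at x)"
            by (intro has_derivative_add has_derivative_const has_derivative_mult_right)
          moreover have "u \<epsilon> (0, x) = ubar + \<epsilon> * Ueps \<epsilon> (0, L \<epsilon> * (v \<bullet> x))" for x
            using u_eq[OF \<epsilon>1(1), of "(0, x)"] t0 by (simp add: w0x)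
          ultimately show ?thesis by simp
        qed
        show "continuous_on (cube 0 A) (\<lambda>x. \<epsilon> * (L \<epsilon> * (v \<bullet> b) * deriv_x (Ueps \<epsilon>) (0, L \<epsilon> * (v \<bullet> x))))"
          by (intro continuous_intros continuous_on_compose2[OF C1_per_derivatives(5)[OF T0 W[OF \<epsilon>1(1)], of "(0, 0)"]])
             (use T0 in auto)
        show "\<delta>' * \<epsilon> powr (1 - \<gamma>) \<le> \<sigma>' * (\<epsilon> * (L \<epsilon> * (v \<bullet> b) * deriv_x (Ueps \<epsilon>) (0, L \<epsilon> * (v \<bullet> x))))"
          if x: "x \<in> box l r \<inter> stripes v (\<epsilon> powr (- \<gamma>)) \<theta>1 \<eta>" for x
        proof (rule slope')
          obtain k :: int where "\<bar>L \<epsilon> * (v \<bullet> x) - \<theta>1 - of_int k\<bar> \<le> \<eta>"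
            using x by (auto simp: stripes_def L_def)
          then show "\<delta> \<le> \<sigma> * deriv_x (Ueps \<epsilon>) (0, L \<epsilon> * (v \<bullet> x))"
            using \<tau> by (intro slope[OF \<epsilon>]) auto
        qed (use \<epsilon> in simp)
      qed simp
    qed
    moreover have "\<not> bounded_Wloc_spacetime {0<..<1} T0 s p u"
    proof
      assume "bounded_Wloc_spacetime {0<..<1} T0 s p u"
      \<comment> \<open>A boundary point is chosen because the stripes are under control for short
        times only.\<close>
      moreover have "(0, 0) \<in> {0..T0} \<times> (UNIV :: (real ^ 'n) set)" using t0 by simp
      ultimately obtain A C where A: "0 < A" and C: "0 \<le> C"
        and le: "\<And>\<epsilon>. \<epsilon> \<in> {0<..<1} \<Longrightarrow> sobolev_norm s p (cube (0, 0) A \<inter> S) (u \<epsilon>) \<le> ennreal C"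
        unfolding bounded_Wloc_spacetime_def S_def by metis
      \<comment> \<open>The test box \<open>\<tau>' / 2 < t < \<tau>'\<close> stays away from t = 0,
        inside the cube and below \<open>\<tau>\<close>.\<close>
      define \<tau>' where "\<tau>' = min A \<tau> / 2"
      have \<tau>': "0 < \<tau>'" "\<tau>' < A" "\<tau>' < \<tau>" using A \<tau> by (auto simp: \<tau>'_def min_def)
      define l r :: "real \<times> (real ^ 'n)" where "l = (\<tau>' / 2, - ((A / 2) *\<^sub>R One))" and "r = (\<tau>', (A / 2) *\<^sub>R One)"
      \<comment> \<open>A purely spatial direction, along which the time derivative of the profile
        drops out of \<open>V'\<close>.\<close>
      define b' :: "real \<times> (real ^ 'n)" where "b' = (0, b)"
      have b': "b' \<in> Basis" "fst b' = 0" "w \<bullet> b' = v \<bullet> b" using b by (auto simp: b'_def w_def Basis_prod_def)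
      have sub: "cbox l r \<subseteq> cube (0, 0) A \<inter> S"
        using A \<tau>' \<tau> by (force simp: mem_cube mem_box l_def r_def S_def Basis_prod_def)
      have fst_lr: "fst z \<in> {0..\<tau>}" if "z \<in> box l r" for z
        using that \<tau>' by (cases z) (auto simp: mem_box l_def r_def Basis_prod_def)
      show False
      proof (rule oscillations_unbounded_in_sobolev[where Q = "cube (0, 0) A \<inter> S" and l = l and u = r and w = w and b = b'
            and V = u and \<eta> = \<eta> and \<delta> = \<delta>' and \<sigma> = \<sigma>' and ?e0.0 = e0 and C = C and V' = V'
            and M = "measure lborel (cube ((0, 0) :: real \<times> (real ^ 'n)) A)" and ?\<theta>1.0 = \<theta>1 and ?\<theta>2.0 = \<theta>2,
            OF gamma p s _ sub _ _ _ w0 b'(1) \<eta> \<delta>'(1) \<sigma>' e0(1) C])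
        show op: "open (cube (0, 0) A \<inter> S)" by (intro open_Int open_cube openS)
        show "emeasure lebesgue (cube ((0, 0) :: real \<times> (real ^ 'n)) A \<inter> S) \<le> ennreal (measure lborel (cube ((0, 0) :: real \<times> (real ^ 'n)) A))"
          by (rule emeasure_cube_bound[OF _ op]) auto
        show "box l r \<noteq> {}" using A \<tau>' by (auto simp: box_ne_empty l_def r_def Basis_prod_def)
        fix \<epsilon> assume \<epsilon>: "\<epsilon> \<in> {0<..<e0}"
        then have \<epsilon>1: "\<epsilon> \<in> {0<..1}" "\<epsilon> \<in> {0<..<1}" using e0 by auto
        show "sobolev_norm s p (cube (0, 0) A \<inter> S) (u \<epsilon>) \<le> ennreal C" by (rule le[OF \<epsilon>1(2)])
        show "\<delta>' * \<epsilon> \<le> \<bar>u \<epsilon> x - u \<epsilon> y\<bar>"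
          if "x \<in> box l r \<inter> stripes w (\<epsilon> powr (- \<gamma>)) \<theta>1 \<eta>" "y \<in> box l r \<inter> stripes w (\<epsilon> powr (- \<gamma>)) \<theta>2 \<eta>" for x y
          using that fst_lr by (intro osc'[OF \<epsilon>]) (auto simp: L_def)
        show "(u \<epsilon> has_derivative V' \<epsilon> x) (at x)" if "x \<in> cube (0, 0) A \<inter> S" for x
          using that by (intro V'[OF \<epsilon>1(1)]) auto
        have "continuous_on (cube (0, 0) A \<inter> S) (\<lambda>z. deriv_x (Ueps \<epsilon>) (fst z, L \<epsilon> * (w \<bullet> z)))"
          by (rule continuous_on_compose2[OF C1_per_derivatives(5)[OF T0 W[OF \<epsilon>1(1)], of "(0, 0)"]])
             (use T0 in \<open>auto simp: S_def intro!: continuous_intros\<close>)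
        then show "continuous_on (cube (0, 0) A \<inter> S) (\<lambda>z. V' \<epsilon> z b')"
          unfolding V'_def b' by (auto intro!: continuous_intros)
        show "\<delta>' * \<epsilon> powr (1 - \<gamma>) \<le> \<sigma>' * V' \<epsilon> x b'"
          if x: "x \<in> box l r \<inter> stripes w (\<epsilon> powr (- \<gamma>)) \<theta>1 \<eta>" for x
          unfolding V'_def b' mult_zero_left add_0
        proof (rule slope')
          obtain k :: int where "\<bar>L \<epsilon> * (w \<bullet> x) - \<theta>1 - of_int k\<bar> \<le> \<eta>"
            using x by (auto simp: stripes_def L_def)
          then show "\<delta> \<le> \<sigma> * deriv_x (Ueps \<epsilon>) (fst x, L \<epsilon> * (w \<bullet> x))"
            using fst_lr x by (intro slope[OF \<epsilon>]) auto
        qed (use \<epsilon> in simp)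
      qed simp
    qed
    ultimately show ?thesis by blast
  qed
  show ?thesis
    using bounded1 bounded2 unbounded by blast
qed

end
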